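(* For every $w\in\hat W$, $$\bar\psi^w=\sum_{\substack{(w_1,w_2)\in\hat W\times W\\ w_1*w_2=w}}p^*(\bar G^{w_1})\cup\mathrm{ev}_1^*(\bar\psi^{w_2}_{G/B})=\sum_{\substack{(w_1,w_2)\in\hat W\times W\\ w_1*w_2=w}}\theta(\bar\psi^{w_1})\cup\eta(\bar\psi^{w_2}).$$
   Context: $G$ is a complex semisimple simply-connected group with maximal torus $T$, Borel $B$, maximal compact $K$, $T_{\mathbb R}=K\cap T$, representation ring $R(T)$; $W$ finite Weyl group, $\hat W=Q^\vee\rtimes W$ the affine Weyl group (acting on $R(T)$ at level zero). $\hat{\mathrm{Fl}}\simeq LK/T_{\mathbb R}$, $\mathrm{Gr}\simeq\Omega K$, $p:\hat{\mathrm{Fl}}\to\mathrm{Gr}$ the projection. Demazure product $*$: associative with $s_i*v=s_iv$ if $s_iv>v$ and $v$ otherwise. The $K$-nilHecke ring is generated in $\mathrm{Frac}(R(T))\#\mathbb Q[\hat W]$ by $R(T)$ and $T_i=(1-e^{\alpha_i})^{-1}(s_i-1)$; $y_i=1+T_i$, $y_w=y_{i_1}\cdots y_{i_k}$ for a reduced word of $w$. Localization identifies $K_T^*(\hat{\mathrm{Fl}})$ with functions $\hat W\to R(T)$, paired with the nilHecke ring via $\langle\sum a_ww,\psi\rangle=\sum a_w\psi(w)$; $\{\bar\psi^w\}$ is the basis dual to $\{y_w\}$, and $\{\bar\psi^w_{G/B}:w\in W\}\subset K_T^*(G/B)$ is defined likewise using the finite nilHecke ring. $\varphi:\Omega K\to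 LK\to LK/T_{\mathbb R}$ induces $\varphi^*$, and $\bar G^w:=\varphi^*(\bar\psi^w)\in K_T^*(\mathrm{Gr})$. $\mathrm{ev}_1^*$ is pullback along evaluation of loops at the identity $LK/T_{\mathbb R}\to K/T_{\mathbb R}\simeq G/B$; $q:K/T_{\mathbb R}\to LK/T_{\mathbb R}$ the inclusion; $\theta=p^*\circ\varphi^*$ and $\eta=\mathrm{ev}_1^*\circ q^*$. *)

theory Defs
  imports "HOL-Library.Poly_Mapping" "HOL-Computational_Algebra.Fraction_Field"
begin

text \<open>
  Combinatorial (GKM / localization) model of the objects in the statement.
  The group G (semisimple, simply connected) is encoded by its Cartan matrix
  A (indices 0..n-1, A i j = <alpha_i^vee, alpha_j>).
  Weights P: integer vectors in the fundamental-weight basis (nat =>0 int,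
  coordinates below n).  R(T) = Z[P] is the group ring (wt =>0 int), an
  integral domain, so Frac(R(T)) is available as a fract.
  The affine Weyl group at level zero acts faithfully on P + Z delta
  (pairs (mu, m)); its elements are represented as maps on such pairs.
\<close>

type_synonym wt = "nat \<Rightarrow>\<^sub>0 int"
type_synonym aff = "wt \<times> int"
type_synonym rt = "wt \<Rightarrow>\<^sub>0 int"
type_synonym wel = "aff \<Rightarrow> aff"
type_synonym gen = "wt \<times> wel"   \<comment> \<open>(level-zero finite part of a simple root, its reflection)\<close>

definition is_gcm :: "nat \<Rightarrow> (nat \<Rightarrow> nat \<Rightarrow> int) \<Rightarrow> bool" where
  "is_gcm n A \<longleftrightarrow> (\<forall>i<n. A i i = 2) \<and> (\<forall>i<n. \<forall>j<n. i \<noteq> j \<longrightarrow> A i j \<le> 0)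
     \<and> (\<forall>i<n. \<forall>j<n. A i j = 0 \<longleftrightarrow> A j i = 0)"

definition smul :: "int \<Rightarrow> wt \<Rightarrow> wt" where
  "smul c \<alpha> = Poly_Mapping.map ((*) c) \<alpha>"

text \<open>simple root alpha_j in the fundamental weight basis\<close>
definition sroot :: "nat \<Rightarrow> (nat \<Rightarrow> nat \<Rightarrow> int) \<Rightarrow> nat \<Rightarrow> wt" where
  "sroot n A j = Abs_poly_mapping (\<lambda>i. if i < n then A i j else 0)"

text \<open>reflection in the affine root (alpha + k delta), given the coroot functional c = <alpha^vee, _>\<close>
definition arefl :: "(wt \<Rightarrow> int) \<Rightarrow> wt \<Rightarrow> int \<Rightarrow> wel" where
  "arefl c \<alpha> k = (\<lambda>(\<mu>, m). (\<mu> - smul (c \<mu>) \<alpha>, m - c \<mu> * k))"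

definition fin_refl :: "nat \<Rightarrow> (nat \<Rightarrow> nat \<Rightarrow> int) \<Rightarrow> nat \<Rightarrow> wel" where
  "fin_refl n A i = arefl (\<lambda>\<mu>. Poly_Mapping.lookup \<mu> i) (sroot n A i) 0"

inductive_set gen_group :: "wel set \<Rightarrow> wel set" for S :: "wel set" where
  gid: "id \<in> gen_group S"
| gstep: "s \<in> S \<Longrightarrow> u \<in> gen_group S \<Longrightarrow> s \<circ> u \<in> gen_group S"

definition Wfin :: "nat \<Rightarrow> (nat \<Rightarrow> nat \<Rightarrow> int) \<Rightarrow> wel set" where
  "Wfin n A = gen_group (fin_refl n A ` {..<n})"

definition wpart :: "wel \<Rightarrow> wt \<Rightarrow> wt" where
  "wpart u \<mu> = fst (u (\<mu>, 0))"

definition roots :: "nat \<Rightarrow> (nat \<Rightarrow> nat \<Rightarrow> int) \<Rightarrow> wt set" where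
  "roots n A = {wpart v (sroot n A i) | v i. v \<in> Wfin n A \<and> i < n}"

definition pos_roots :: "nat \<Rightarrow> (nat \<Rightarrow> nat \<Rightarrow> int) \<Rightarrow> wt set" where
  "pos_roots n A = {\<beta> \<in> roots n A. \<exists>c::nat \<Rightarrow> nat. \<beta> = (\<Sum>i<n. smul (int (c i)) (sroot n A i))}"

text \<open>maximal positive roots = highest roots of the simple factors\<close>
definition max_roots :: "nat \<Rightarrow> (nat \<Rightarrow> nat \<Rightarrow> int) \<Rightarrow> wt set" where
  "max_roots n A = {\<theta> \<in> pos_roots n A. \<forall>i<n. \<theta> + sroot n A i \<notin> roots n A}"

text \<open>coroot pairing <beta^vee, mu> for a root beta = v alpha_i: <alpha_i^vee, v^-1 mu>\<close>
definition coroot_pair :: "nat \<Rightarrow> (nat \<Rightarrow> nat \<Rightarrow> int) \<Rightarrow> wt \<Rightarrow> wt \<Rightarrow> int" where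
  "coroot_pair n A \<beta> \<mu> = (SOME c. \<exists>v v' i. v \<in> Wfin n A \<and> v' \<in> Wfin n A \<and> v' \<circ> v = id
      \<and> i < n \<and> \<beta> = wpart v (sroot n A i) \<and> c = Poly_Mapping.lookup (wpart v' \<mu>) i)"

text \<open>generators: finite simple reflections s_i (root alpha_i), and s_0 for alpha_0 = delta - theta
  (one for each highest root theta); the first component is the level-zero image of the root\<close>
definition fin_gens :: "nat \<Rightarrow> (nat \<Rightarrow> nat \<Rightarrow> int) \<Rightarrow> gen set" where
  "fin_gens n A = {(sroot n A i, fin_refl n A i) | i. i < n}"

definition aff_gens :: "nat \<Rightarrow> (nat \<Rightarrow> nat \<Rightarrow> int) \<Rightarrow> gen set" where
  "aff_gens n A = fin_gens n A \<union>
     {(- \<theta>, arefl (\<lambda>\<mu>. - coroot_pair n A \<theta> \<mu>) (- \<theta>) 1) | \<theta>. \<theta> \<in> max_roots n A}"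

definition grp :: "gen set \<Rightarrow> wel set" where
  "grp G = gen_group (snd ` G)"

definition word_prod :: "gen list \<Rightarrow> wel" where
  "word_prod ws = foldr (\<circ>) (map snd ws) id"

definition len :: "gen set \<Rightarrow> wel \<Rightarrow> nat" where
  "len G w = (LEAST k. \<exists>ws. set ws \<subseteq> G \<and> length ws = k \<and> word_prod ws = w)"

definition redword :: "gen set \<Rightarrow> wel \<Rightarrow> gen list" where
  "redword G w = (SOME ws. set ws \<subseteq> G \<and> length ws = len G w \<and> word_prod ws = w)"

definition dem :: "gen set \<Rightarrow> wel \<Rightarrow> wel \<Rightarrow> wel" where
  "dem G w1 w2 = foldr (\<lambda>g v. if len G (snd g \<circ> v) > len G v then snd g \<circ> v else v) (redword G w1) w2"

text \<open>Elements of Frac(R(T)) # Q[W^]: coefficient functions (finite support) W^ -> Frac(R(T)).\<close>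
type_synonym nh = "wel \<Rightarrow> rt fract"

definition ex :: "wel \<Rightarrow> wt \<Rightarrow> rt fract" where
  "ex u \<alpha> = Fract (Poly_Mapping.single (wpart u \<alpha>) 1) 1"   \<comment> \<open>u(e^alpha) = e^{u alpha}\<close>

text \<open>right multiplication by y_i = 1 + (1 - e^{alpha_i})^{-1}(s_i - 1)\<close>
definition mul_y :: "gen \<Rightarrow> nh \<Rightarrow> nh" where
  "mul_y g X = (\<lambda>u. X u - X u / (1 - ex u (fst g)) + X (u \<circ> snd g) / (1 - ex (u \<circ> snd g) (fst g)))"

definition y_word :: "gen list \<Rightarrow> nh" where
  "y_word ws = fold mul_y ws (\<lambda>u. if u = id then 1 else 0)"

definition yel :: "gen set \<Rightarrow> wel \<Rightarrow> nh" where
  "yel G w = y_word (redword G w)"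

definition pairing :: "nh \<Rightarrow> (wel \<Rightarrow> rt) \<Rightarrow> rt fract" where
  "pairing X \<psi> = (\<Sum>u\<in>{u. X u \<noteq> 0}. X u * Fract (\<psi> u) 1)"

definition Rlat :: "nat \<Rightarrow> rt set" where
  "Rlat n = {f. \<forall>\<mu>\<in>Poly_Mapping.keys f. Poly_Mapping.keys \<mu> \<subseteq> {..<n}}"

text \<open>dual basis element psi-bar^w (localization: a function on the fixed points grp G)\<close>
definition psibar :: "nat \<Rightarrow> gen set \<Rightarrow> wel \<Rightarrow> (wel \<Rightarrow> rt)" where
  "psibar n G w = (THE \<psi>. (\<forall>u. u \<notin> grp G \<longrightarrow> \<psi> u = 0) \<and> (\<forall>u. \<psi> u \<in> Rlat n)
       \<and> (\<forall>v\<in>grp G. pairing (yel G v) \<psi> = (if v = w then 1 else 0)))"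

text \<open>Decomposition w = t_lambda v (lambda in Q^vee, v in W)\<close>
definition QV :: "nat \<Rightarrow> (nat \<Rightarrow> nat \<Rightarrow> int) \<Rightarrow> wel set" where
  "QV n A = {t \<in> grp (aff_gens n A). \<forall>x. fst (t x) = fst x}"

definition trans_part :: "nat \<Rightarrow> (nat \<Rightarrow> nat \<Rightarrow> int) \<Rightarrow> wel \<Rightarrow> wel" where
  "trans_part n A w = (THE t. t \<in> QV n A \<and> (\<exists>v\<in>Wfin n A. w = t \<circ> v))"

definition fin_part :: "nat \<Rightarrow> (nat \<Rightarrow> nat \<Rightarrow> int) \<Rightarrow> wel \<Rightarrow> wel" where
  "fin_part n A w = (THE v. v \<in> Wfin n A \<and> (\<exists>t\<in>QV n A. w = t \<circ> v))"

text \<open>Pullbacks in localization.  Fixed points: Fl^ <-> W^, Gr <-> Q^vee, G/B <-> W.\<close>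
definition phi_star :: "nat \<Rightarrow> (nat \<Rightarrow> nat \<Rightarrow> int) \<Rightarrow> (wel \<Rightarrow> rt) \<Rightarrow> (wel \<Rightarrow> rt)" where
  "phi_star n A \<psi> = (\<lambda>t. if t \<in> QV n A then \<psi> t else 0)"

definition p_star :: "nat \<Rightarrow> (nat \<Rightarrow> nat \<Rightarrow> int) \<Rightarrow> (wel \<Rightarrow> rt) \<Rightarrow> (wel \<Rightarrow> rt)" where
  "p_star n A g = (\<lambda>w. if w \<in> grp (aff_gens n A) then g (trans_part n A w) else 0)"

definition ev1_star :: "nat \<Rightarrow> (nat \<Rightarrow> nat \<Rightarrow> int) \<Rightarrow> (wel \<Rightarrow> rt) \<Rightarrow> (wel \<Rightarrow> rt)" where
  "ev1_star n A f = (\<lambda>w. if w \<in> grp (aff_gens n A) then f (fin_part n A w) else 0)"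

definition q_star :: "nat \<Rightarrow> (nat \<Rightarrow> nat \<Rightarrow> int) \<Rightarrow> (wel \<Rightarrow> rt) \<Rightarrow> (wel \<Rightarrow> rt)" where
  "q_star n A \<psi> = (\<lambda>v. if v \<in> Wfin n A then \<psi> v else 0)"

definition theta_map :: "nat \<Rightarrow> (nat \<Rightarrow> nat \<Rightarrow> int) \<Rightarrow> (wel \<Rightarrow> rt) \<Rightarrow> (wel \<Rightarrow> rt)" where
  "theta_map n A = p_star n A \<circ> phi_star n A"

definition eta_map :: "nat \<Rightarrow> (nat \<Rightarrow> nat \<Rightarrow> int) \<Rightarrow> (wel \<Rightarrow> rt) \<Rightarrow> (wel \<Rightarrow> rt)" where
  "eta_map n A = ev1_star n A \<circ> q_star n A"

definition psibar_aff :: "nat \<Rightarrow> (nat \<Rightarrow> nat \<Rightarrow> int) \<Rightarrow> wel \<Rightarrow> (wel \<Rightarrow> rt)" where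
  "psibar_aff n A w = psibar n (aff_gens n A) w"

definition psibar_GB :: "nat \<Rightarrow> (nat \<Rightarrow> nat \<Rightarrow> int) \<Rightarrow> wel \<Rightarrow> (wel \<Rightarrow> rt)" where
  "psibar_GB n A w = psibar n (fin_gens n A) w"

definition Gbar :: "nat \<Rightarrow> (nat \<Rightarrow> nat \<Rightarrow> int) \<Rightarrow> wel \<Rightarrow> (wel \<Rightarrow> rt)" where
  "Gbar n A w = phi_star n A (psibar_aff n A w)"

text \<open>cup product = pointwise product in localization\<close>
definition cup :: "(wel \<Rightarrow> rt) \<Rightarrow> (wel \<Rightarrow> rt) \<Rightarrow> (wel \<Rightarrow> rt)" where
  "cup f g = (\<lambda>x. f x * g x)"

definition dem_pairs :: "nat \<Rightarrow> (nat \<Rightarrow> nat \<Rightarrow> int) \<Rightarrow> wel \<Rightarrow> (wel \<times> wel) set" where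
  "dem_pairs n A w = {(w1, w2). w1 \<in> grp (aff_gens n A) \<and> w2 \<in> Wfin n A
       \<and> dem (aff_gens n A) w1 w2 = w}"

end

theory Submission
  imports Defs "HOL-Library.Product_Plus"
begin

text \<open>
  Every group element \<open>u\<close>, seen in the nilHecke ring, expands as \<open>u = \<Sum>\<^sub>w \<psi>\<^sup>w(u) y\<^sub>w\<close> with coefficients in
  \<open>R(T)\<close>, because \<open>s\<^sub>i = e\<^bsup>\<alpha>\<^esup> + (1 - e\<^bsup>\<alpha>\<^esup>) y\<^sub>i\<close>; these coefficients are the dual basis.  For \<open>u = t v\<close> with \<open>t\<close> a
  translation and \<open>v\<close> finite, \<open>t\<close> commutes with scalars at level zero, so
  \<open>t v = \<Sum> \<psi>\<^bsup>w2\<^esup>(v) t y\<^bsub>w2\<^esub> = \<Sum> \<psi>\<^bsup>w1\<^esup>(t) \<psi>\<^bsup>w2\<^esup>(v) y\<^bsub>w1\<^esub> y\<^bsub>w2\<^esub>\<close>, and \<open>y\<^bsub>w1\<^esub> y\<^bsub>w2\<^esub> = y\<^bsub>w1*w2\<^esub>\<close>.  Comparing coefficients of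
  \<open>y\<^sub>w\<close> gives the formula.  That \<open>y\<^sub>w\<close> does not depend on the reduced word follows from the braid
  relations and from Tits' argument that \<open>w\<close> makes a simple root positive iff multiplying by its reflection
  increases the length; the finite case of that argument yields the positive/negative
  dichotomy for roots, from which the affine simple roots are seen to pair like a Cartan matrix.
\<close>

section \<open>The braid relation in rank two\<close>

text \<open>\<open>psibar\<close> is a definite description, so a dual function must be shown to
  exist with values in R(T), although products of the y_i carry denominators. For this the R(T)-span
  \<open>int_span\<close> of the y_w is shown to be stable under right multiplication by
  exponentials, by y_i and by reflections; hence it contains every group element. The level
  coordinate keeps translations visible as group elements, while scalars see only the weight. So a
  translation commutes with scalars although length and positivity are affine notions. Beyond the
  conditions on the matrix only finiteness of the Weyl group is assumed. The possible rank-two pairs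
  come from Cauchy-Schwarz; the pair (-2,-2) means infinite order and no relation, and (-1,-4) has
  to be excluded for a highest root. Braid relations are verified as identities of rational
  functions along an orbit, without a model of the dihedral groups. A sum over an infinite set is 0
  in HOL, so finiteness of the set of pairs with w1*w2 = w is part of what is proved: a Demazure
  product is never shorter than its left factor, and the right factor ranges over a finite
  group.\<close>

locale dihedral_action =
  fixes U :: "'u set" and \<sigma> \<tau> :: "'u \<Rightarrow> 'u" and a b :: "'u \<Rightarrow> 'k::field"
  assumes maps: "u \<in> U \<Longrightarrow> \<sigma> u \<in> U" "u \<in> U \<Longrightarrow> \<tau> u \<in> U"
    and invol: "u \<in> U \<Longrightarrow> \<sigma> (\<sigma> u) = u" "u \<in> U \<Longrightarrow> \<tau> (\<tau> u) = u"
    and nz: "u \<in> U \<Longrightarrow> a u \<noteq> 0" "u \<in> U \<Longrightarrow> b u \<noteq> 0"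
    and n1: "u \<in> U \<Longrightarrow> a u \<noteq> 1" "u \<in> U \<Longrightarrow> b u \<noteq> 1"
    and inv_a: "u \<in> U \<Longrightarrow> a (\<sigma> u) = inverse (a u)"
    and inv_b: "u \<in> U \<Longrightarrow> b (\<tau> u) = inverse (b u)"

definition demop :: "('u \<Rightarrow> 'k::field) \<Rightarrow> ('u \<Rightarrow> 'u) \<Rightarrow> ('u \<Rightarrow> 'k) \<Rightarrow> 'u \<Rightarrow> 'k" where
  "demop c s X u = c u / (c u - 1) * (X u + X (s u))"

text \<open>
  In the nilHecke ring \<open>y\<^sub>i = (1 + s\<^sub>i) (1 - e\<^bsup>-\<alpha>\<^esup>)\<^sup>-\<^sup>1\<close>, so right multiplication by \<open>y\<^sub>i\<close> is \<open>demop\<close>.  The braid relation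
  holds because the alternating product of full length is the symmetric expression
  \<open>(\<Sum>\<^sub>w w) \<Prod>\<^sub>\<beta> (1 - e\<^bsup>-\<beta>\<^esup>)\<^sup>-\<^sup>1\<close> over the dihedral group and its positive roots.
\<close>

definition qf :: "'k::field \<Rightarrow> 'k" where "qf t = t / (t - 1)"

text \<open>The identity \<open>qf t + qf (inverse t) = 1\<close> is the scalar form of y_i y_i =
  y_i; it also removes inverse roots from the iterates below.\<close>

lemma qf_inverse: "t \<noteq> 0 \<Longrightarrow> t \<noteq> 1 \<Longrightarrow> qf (inverse t) = 1 - qf t"
  by (simp add: qf_def field_simps)

context dihedral_action begin

lemma qf_a: "u \<in> U \<Longrightarrow> qf (a (\<sigma> u)) = 1 - qf (a u)"
  using nz n1 inv_a by (simp add: qf_inverse)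
lemma qf_b: "u \<in> U \<Longrightarrow> qf (b (\<tau> u)) = 1 - qf (b u)"
  using nz n1 inv_b by (simp add: qf_inverse)

lemma demop_a: "demop a \<sigma> X u = qf (a u) * (X u + X (\<sigma> u))"
  and demop_b: "demop b \<tau> X u = qf (b u) * (X u + X (\<tau> u))"
  by (simp_all add: demop_def qf_def)

context
  fixes X :: "'u \<Rightarrow> 'k"
begin
text \<open>The first \<open>demop a\<close> symmetrises over \<open>\<sigma>\<close>, so every
  later iterate depends on \<open>X\<close> only through these orbit sums.\<close>

definition "cs u = X u + X (\<sigma> u)"

lemma cs_s: "u \<in> U \<Longrightarrow> cs (\<sigma> u) = cs u"
  by (simp add: cs_def invol)

section \<open>Iterated products with two alternating generators\<close>

definition "z2 = demop b \<tau> (demop a \<sigma> X)"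
definition "z3 = demop a \<sigma> z2"
definition "z4 = demop b \<tau> z3"
definition "z5 = demop a \<sigma> z4"
definition "z6 = demop b \<tau> z5"

lemma z2: "z2 u = qf (b u) * (qf (a u) * cs u + qf (a (\<tau> u)) * cs (\<tau> u))"
  by (simp add: z2_def demop_a demop_b cs_def)

lemma z3: "u \<in> U \<Longrightarrow> z3 u = qf (a u) * (
     (qf (b u) * qf (a u) + qf (b (\<sigma> u)) * (1 - qf (a u))) * cs u
     + qf (b u) * qf (a (\<tau> u)) * cs (\<tau> u)
     + qf (b (\<sigma> u)) * qf (a (\<tau> (\<sigma> u))) * cs (\<tau> (\<sigma> u)))"
  by (simp add: z3_def demop_a z2 cs_s qf_a algebra_simps)

text \<open>Coefficients of the orbit sums in the fourth iterate (\<open>k4\<close>,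
  \<open>l4\<close>) and the fifth (\<open>e0\<close>, \<open>e1\<close>, \<open>e2\<close>). The
  remaining coefficients are these functions at shifted points.\<close>

definition "k4 u = qf (b u) * qf (a u) + qf (b (\<sigma> u)) * (1 - qf (a u)) + qf (a (\<tau> u)) * (1 - qf (b u))"
definition "l4 u = qf (a u) * qf (b (\<sigma> u)) * qf (a (\<tau> (\<sigma> u)))"
definition "e0 u = qf (b u) * qf (a u) * k4 u + qf (b (\<sigma> u)) * (1 - qf (a u)) * k4 (\<sigma> u)"
definition "e1 u = qf (b u) * qf (a (\<tau> u)) * k4 (\<tau> u) + qf (b (\<sigma> u)) * l4 (\<sigma> u)"
definition "e2 u = qf (b u) * l4 (\<tau> u)"

lemma z4: "u \<in> U \<Longrightarrow> z4 u = qf (b u) * (qf (a u) * k4 u * cs u + qf (a (\<tau> u)) * k4 (\<tau> u) * cs (\<tau> u)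
     + l4 u * cs (\<tau> (\<sigma> u)) + l4 (\<tau> u) * cs (\<tau> (\<sigma> (\<tau> u))))"
  by (simp add: z4_def demop_b z3 maps invol qf_b k4_def l4_def) (simp add: algebra_simps)

lemma z5: "u \<in> U \<Longrightarrow> z5 u = qf (a u) * (e0 u * cs u + e1 u * cs (\<tau> u) + e1 (\<sigma> u) * cs (\<tau> (\<sigma> u))
     + e2 u * cs (\<tau> (\<sigma> (\<tau> u))) + e2 (\<sigma> u) * cs (\<tau> (\<sigma> (\<tau> (\<sigma> u)))))"
  by (simp add: z5_def demop_a z4 maps invol qf_a cs_s e0_def e1_def e2_def) (simp add: algebra_simps)

text \<open>The last step symmetrises over \<open>\<tau>\<close>, so three of the six coefficients
  suffice. Their common value \<open>R\<close> will be the product over the positive roots other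
  than that of \<open>b\<close>, which \<open>\<tau>\<close> permutes.\<close>

lemma z6: 
  assumes "u \<in> U" and h0: "\<And>u. u \<in> U \<Longrightarrow> qf (a u) * e0 u + qf (a (\<tau> u)) * e1 (\<tau> u) = R u"
   and h1: "\<And>u. u \<in> U \<Longrightarrow> qf (a u) * e1 (\<sigma> u) + qf (a (\<tau> u)) * e2 (\<tau> u) = R u"
   and h2: "\<And>u. u \<in> U \<Longrightarrow> qf (a u) * e2 (\<sigma> u) = R u" and R: "R (\<tau> u) = R u"
  shows "z6 u = qf (b u) * R u * (cs u + cs (\<tau> u) + cs (\<tau> (\<sigma> u))
     + cs (\<tau> (\<sigma> (\<tau> u))) + cs (\<tau> (\<sigma> (\<tau> (\<sigma> u)))) + cs (\<tau> (\<sigma> (\<tau> (\<sigma> (\<tau> u))))))"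
proof -
  note m = maps(2)[OF assms(1)]
  have "z6 u = qf (b u) * ((qf (a u) * e0 u + qf (a (\<tau> u)) * e1 (\<tau> u)) * cs u 
     + (qf (a (\<tau> u)) * e0 (\<tau> u) + qf (a (\<tau> (\<tau> u))) * e1 (\<tau> (\<tau> u))) * cs (\<tau> u)
     + (qf (a u) * e1 (\<sigma> u) + qf (a (\<tau> u)) * e2 (\<tau> u)) * cs (\<tau> (\<sigma> u))
     + (qf (a (\<tau> u)) * e1 (\<sigma> (\<tau> u)) + qf (a (\<tau> (\<tau> u))) * e2 (\<tau> (\<tau> u))) * cs (\<tau> (\<sigma> (\<tau> u)))
     + (qf (a u) * e2 (\<sigma> u)) * cs (\<tau> (\<sigma> (\<tau> (\<sigma> u)))) 
     + (qf (a (\<tau> u)) * e2 (\<sigma> (\<tau> u))) * cs (\<tau> (\<sigma> (\<tau> (\<sigma> (\<tau> u))))))"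
    using assms(1) by (simp add: z6_def demop_b z5 maps invol) (simp add: algebra_simps)
  then show ?thesis 
    unfolding h0[OF assms(1)] h0[OF m] h1[OF assms(1)] h1[OF m] h2[OF assms(1)] h2[OF m] R
    by (simp add: algebra_simps)
qed

section \<open>Symmetric closed forms in types A1 x A1, A2, B2 and G2\<close>

lemma braid2:
  assumes "\<And>u. u \<in> U \<Longrightarrow> a (\<tau> u) = a u" "u \<in> U"
  shows "z2 u = qf (a u) * qf (b u) * (cs u + cs (\<tau> u))"
  using assms by (simp add: z2 algebra_simps)

lemma braid3:
  assumes "\<And>u. u \<in> U \<Longrightarrow> a (\<tau> u) = a u * b u" 
    and "\<And>u. u \<in> U \<Longrightarrow> b (\<sigma> u) = b u * a u"
    and u: "u \<in> U"
  shows "z3 u = qf (a u) * qf (b u) * qf (a u * b u) * (cs u + cs (\<tau> u) + cs (\<tau> (\<sigma> u)))"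
proof -
  have n: "a u \<noteq> 0" "b u \<noteq> 0" "a u \<noteq> 1" "b u \<noteq> 1" "a u * b u \<noteq> 1"
    using nz[OF u] n1[OF u] n1(1)[OF maps(2)[OF u]] assms(1)[OF u] by auto
  have "qf (b u) * qf (a u) + qf (a u * b u) * (1 - qf (a u)) = qf (b u) * qf (a u * b u)"
    using n by (simp add: qf_def divide_simps) algebra
  moreover have "a (\<tau> (\<sigma> u)) = b u" using assms n maps(1)[OF u] by (simp add: inv_a)
  ultimately show ?thesis using assms n by (simp add: z3 mult.commute[of "b u" "a u"] algebra_simps)
qed

text \<open>The non-simple positive roots of the rank-two system are values of simple ones at other
  points of the orbit, so the denominators in their \<open>qf\<close> factors do not vanish.\<close>

lemma nonunit:
  assumes "u \<in> U" shows "a (\<tau> u) \<noteq> 1" "b (\<sigma> u) \<noteq> 1" "a (\<tau> (\<sigma> u)) \<noteq> 1" "b (\<sigma> (\<tau> u)) \<noteq> 1"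
    "a (\<tau> (\<sigma> (\<tau> u))) \<noteq> 1" "b (\<sigma> (\<tau> (\<sigma> u))) \<noteq> 1"
  using assms by (auto simp: n1 maps)

text \<open>Type B2 with the root of \<open>a\<close> short. The variant \<open>braid4b\<close> has
  the lengths exchanged and serves the word read with the generators swapped.\<close>

lemma braid4a:
  assumes as: "\<And>u. u \<in> U \<Longrightarrow> a (\<tau> u) = a u * b u" 
    and bs: "\<And>u. u \<in> U \<Longrightarrow> b (\<sigma> u) = b u * a u ^ 2"
    and u: "u \<in> U"
  shows "z4 u = qf (a u) * qf (b u) * qf (a u * b u) * qf (a u ^ 2 * b u) * 
     (cs u + cs (\<tau> u) + cs (\<tau> (\<sigma> u)) + cs (\<tau> (\<sigma> (\<tau> u))))"
proof -
  \<comment> \<open>The digits ij of \<open>qij\<close> stand for the root i alpha + j beta;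
    \<open>r\<close> records how the two reflections move these roots.\<close>
  define q11 where "q11 u = qf (a u * b u)" for u
  define q21 where "q21 u = qf (a u ^ 2 * b u)" for u
  have r: "qf (a (\<tau> u)) = q11 u" "qf (b (\<sigma> u)) = q21 u" "q11 (\<sigma> u) = q11 u" "q11 (\<tau> u) = qf (a u)" 
     "q21 (\<sigma> u) = qf (b u)" "q21 (\<tau> u) = q21 u" if "u \<in> U" for u
    using that nz[OF that]
    by (simp_all add: q11_def q21_def as bs maps inv_a inv_b power2_eq_square field_simps)
  have core: "k4 u = q11 u * q21 u" if "u \<in> U" for u
    using that nz[OF that] n1[OF that] nonunit[OF that]
    unfolding k4_def r[OF that] q11_def q21_def qf_def as[OF that] bs[OF that]
    by (simp add: divide_simps mult.commute power2_eq_square) algebra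
  show ?thesis using u 
    by (simp add: z4 core l4_def r maps qf_b flip: q11_def q21_def) (simp add: algebra_simps)
qed

lemma braid4b:
  assumes as: "\<And>u. u \<in> U \<Longrightarrow> a (\<tau> u) = a u * b u ^ 2" 
    and bs: "\<And>u. u \<in> U \<Longrightarrow> b (\<sigma> u) = b u * a u"
    and u: "u \<in> U"
  shows "z4 u = qf (a u) * qf (b u) * qf (a u * b u) * qf (a u * b u ^ 2) * 
     (cs u + cs (\<tau> u) + cs (\<tau> (\<sigma> u)) + cs (\<tau> (\<sigma> (\<tau> u))))"
proof -
  define q11 where "q11 u = qf (a u * b u)" for u
  define q12 where "q12 u = qf (a u * b u ^ 2)" for u
  have r: "qf (a (\<tau> u)) = q12 u" "qf (b (\<sigma> u)) = q11 u" "q11 (\<sigma> u) = qf (b u)" "q11 (\<tau> u) = q11 u" 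
     "q12 (\<sigma> u) = q12 u" "q12 (\<tau> u) = qf (a u)" if "u \<in> U" for u
    using that nz[OF that]
    by (simp_all add: q11_def q12_def as bs maps inv_a inv_b power2_eq_square field_simps)
  have core: "k4 u = q11 u * q12 u" if "u \<in> U" for u
    using that nz[OF that] n1[OF that] nonunit[OF that]
    unfolding k4_def r[OF that] q11_def q12_def qf_def as[OF that] bs[OF that]
    by (simp add: divide_simps mult.commute power2_eq_square) algebra
  show ?thesis using u 
    by (simp add: z4 core l4_def r maps qf_b flip: q11_def q12_def) (simp add: algebra_simps)
qed

text \<open>Type G2 with the root of \<open>a\<close> short: the exponents (1,1), (2,1), (3,1),
  (3,2) are the non-simple positive roots.\<close>

lemma braid6a:
  assumes as: "\<And>u. u \<in> U \<Longrightarrow> a (\<tau> u) = a u * b u" 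
    and bs: "\<And>u. u \<in> U \<Longrightarrow> b (\<sigma> u) = b u * a u ^ 3"
    and u: "u \<in> U"
  shows "z6 u = qf (a u) * qf (b u) * qf (a u * b u) * qf (a u ^ 2 * b u) * qf (a u ^ 3 * b u) * qf (a u ^ 3 * b u ^ 2) * 
     (cs u + cs (\<tau> u) + cs (\<tau> (\<sigma> u)) + cs (\<tau> (\<sigma> (\<tau> u)))
     + cs (\<tau> (\<sigma> (\<tau> (\<sigma> u)))) + cs (\<tau> (\<sigma> (\<tau> (\<sigma> (\<tau> u))))))"
proof -
  define q11 where "q11 u = qf (a u * b u)" for u
  define q21 where "q21 u = qf (a u ^ 2 * b u)" for u
  define q31 where "q31 u = qf (a u ^ 3 * b u)" for u
  define q32 where "q32 u = qf (a u ^ 3 * b u ^ 2)" for u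
  have r: "qf (a (\<tau> u)) = q11 u" "qf (b (\<sigma> u)) = q31 u" "q11 (\<sigma> u) = q21 u" "q11 (\<tau> u) = qf (a u)" 
     "q21 (\<sigma> u) = q11 u" "q21 (\<tau> u) = q21 u" "q31 (\<sigma> u) = qf (b u)" "q31 (\<tau> u) = q32 u"
     "q32 (\<sigma> u) = q32 u" "q32 (\<tau> u) = q31 u" if "u \<in> U" for u
    using that nz[OF that]
    by (simp_all add: q11_def q21_def q31_def q32_def as bs maps inv_a inv_b eval_nat_numeral field_simps)
  have n: "a u \<noteq> 0" "b u \<noteq> 0" "a u \<noteq> 1" "b u \<noteq> 1" "a u * b u \<noteq> 1" "a u ^ 2 * b u \<noteq> 1" "a u ^ 3 * b u \<noteq> 1"
    "a u ^ 3 * b u ^ 2 \<noteq> 1" if "u \<in> U" for u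
    using that nz[OF that] n1[OF that] nonunit[OF that]
    by (simp_all add: as bs maps inv_a inv_b eval_nat_numeral field_simps)
  have k: "k4 u = qf (b u) * qf (a u) + q31 u * (1 - qf (a u)) + q11 u * (1 - qf (b u))"
     "l4 u = qf (a u) * q31 u * q21 u" if "u \<in> U" for u
    using that by (simp_all add: k4_def l4_def r maps)
  \<comment> \<open>What remains after substituting the action on the roots and splitting off common
    factors: \<open>core1\<close> is the second hypothesis of \<open>z6\<close>,
    \<open>core2\<close> the first.\<close>
  have core1: "qf (b u) * qf (a u) + q31 u * (1 - qf (a u)) + q11 u * (1 - qf (b u))
      + q21 u * (1 - q31 u) + q32 u * (1 - q21 u) = q11 u * q32 u" if "u \<in> U" for u
    using n[OF that]
    unfolding q11_def q21_def q31_def q32_def qf_def 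
    by (simp add: divide_simps) algebra
  have core2: "qf (b u) * qf (a u) * (qf (b u) * qf (a u) + q31 u * (1 - qf (a u)) + q11 u * (1 - qf (b u)))
     + q31 u * (1 - qf (a u)) * (qf (b u) * qf (a u) + q31 u * (1 - qf (a u)) + q21 u * (1 - q31 u))
     + q11 u * (1 - qf (b u)) * (qf (b u) * qf (a u) + q31 u * (1 - qf (a u)) + q11 u * (1 - qf (b u)) + q32 u * (1 - q11 u))
     = q11 u * q21 u * q31 u * q32 u" if "u \<in> U" for u
    using n[OF that]
    unfolding q11_def q21_def q31_def q32_def qf_def 
    by (simp add: divide_simps) algebra
  show ?thesis 
    apply (subst z6[OF u, where R = "\<lambda>u. qf (a u) * q11 u * q21 u * q31 u * q32 u"])
    subgoal for u
      using core2[of u] 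
      apply (simp add: e0_def e1_def e2_def k r maps qf_a qf_b)
      apply algebra
      done
    subgoal for u
      using core1[of u] 
      apply (simp add: e0_def e1_def e2_def k r maps qf_a qf_b)
      apply algebra
      done
    subgoal for u
      by (simp add: e0_def e1_def e2_def k r maps qf_a qf_b)
    using u by (simp_all add: r flip: q11_def q21_def q31_def q32_def)
qed

lemma braid6b:
  assumes as: "\<And>u. u \<in> U \<Longrightarrow> a (\<tau> u) = a u * b u ^ 3" 
    and bs: "\<And>u. u \<in> U \<Longrightarrow> b (\<sigma> u) = b u * a u"
    and u: "u \<in> U"
  shows "z6 u = qf (a u) * qf (b u) * qf (a u * b u) * qf (a u * b u ^ 2) * qf (a u * b u ^ 3) * qf (a u ^ 2 * b u ^ 3) * 
     (cs u + cs (\<tau> u) + cs (\<tau> (\<sigma> u)) + cs (\<tau> (\<sigma> (\<tau> u)))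
     + cs (\<tau> (\<sigma> (\<tau> (\<sigma> u)))) + cs (\<tau> (\<sigma> (\<tau> (\<sigma> (\<tau> u))))))"
proof -
  define q11 where "q11 u = qf (a u * b u)" for u
  define q12 where "q12 u = qf (a u * b u ^ 2)" for u
  define q13 where "q13 u = qf (a u * b u ^ 3)" for u
  define q23 where "q23 u = qf (a u ^ 2 * b u ^ 3)" for u
  have r: "qf (a (\<tau> u)) = q13 u" "qf (b (\<sigma> u)) = q11 u" "q11 (\<sigma> u) = qf (b u)" "q11 (\<tau> u) = q12 u" 
     "q12 (\<sigma> u) = q12 u" "q12 (\<tau> u) = q11 u" "q13 (\<sigma> u) = q23 u" "q13 (\<tau> u) = qf (a u)"
     "q23 (\<sigma> u) = q13 u" "q23 (\<tau> u) = q23 u" if "u \<in> U" for u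
    using that nz[OF that]
    by (simp_all add: q11_def q12_def q13_def q23_def as bs maps inv_a inv_b eval_nat_numeral field_simps)
  have n: "a u \<noteq> 0" "b u \<noteq> 0" "a u \<noteq> 1" "b u \<noteq> 1" "a u * b u \<noteq> 1" "a u * b u ^ 2 \<noteq> 1" "a u * b u ^ 3 \<noteq> 1"
    "a u ^ 2 * b u ^ 3 \<noteq> 1" if "u \<in> U" for u
    using that nz[OF that] n1[OF that] nonunit[OF that]
    by (simp_all add: as bs maps inv_a inv_b eval_nat_numeral field_simps)
  have k: "k4 u = qf (b u) * qf (a u) + q11 u * (1 - qf (a u)) + q13 u * (1 - qf (b u))"
     "l4 u = qf (a u) * q11 u * q23 u" if "u \<in> U" for u
    using that by (simp_all add: k4_def l4_def r maps)
  have core1: "qf (b u) * qf (a u) + q11 u * (1 - qf (a u)) + q13 u * (1 - qf (b u))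
      + q23 u * (1 - q11 u) + q12 u * (1 - q23 u) = q12 u * q13 u" if "u \<in> U" for u
    using n[OF that]
    unfolding q11_def q12_def q13_def q23_def qf_def 
    by (simp add: divide_simps) algebra
  have core2: "qf (b u) * qf (a u) * (qf (b u) * qf (a u) + q11 u * (1 - qf (a u)) + q13 u * (1 - qf (b u)))
     + q11 u * (1 - qf (a u)) * (qf (b u) * qf (a u) + q11 u * (1 - qf (a u)) + q23 u * (1 - q11 u))
     + q13 u * (1 - qf (b u)) * (qf (b u) * qf (a u) + q11 u * (1 - qf (a u)) + q13 u * (1 - qf (b u)) + q12 u * (1 - q13 u))
     = q11 u * q12 u * q13 u * q23 u" if "u \<in> U" for u
    using n[OF that]
    unfolding q11_def q12_def q13_def q23_def qf_def 
    by (simp add: divide_simps) algebra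
  show ?thesis 
    apply (subst z6[OF u, where R = "\<lambda>u. qf (a u) * q11 u * q12 u * q13 u * q23 u"])
    subgoal for u
      using core2[of u] 
      apply (simp add: e0_def e1_def e2_def k r maps qf_a qf_b)
      apply algebra
      done
    subgoal for u
      using core1[of u] 
      apply (simp add: e0_def e1_def e2_def k r maps qf_a qf_b)
      apply algebra
      done
    subgoal for u
      by (simp add: e0_def e1_def e2_def k r maps qf_a qf_b)
    using u by (simp_all add: r flip: q11_def q12_def q13_def q23_def)
qed

end

text \<open>The setting is symmetric in the two generators, so the closed forms of the opposite
  alternating words need no second computation.\<close>

lemma swap: "dihedral_action U \<tau> \<sigma> b a"
  by unfold_locales (simp_all add: maps invol nz n1 inv_a inv_b)

interpretation sw: dihedral_action U \<tau> \<sigma> b a by (rule swap)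

text \<open>Here and in the next three lemmas both words give the same product of root factors times
  a sum over the dihedral orbit. The two sums differ only in how the longest element is written,
  which the group relation settles.\<close>

lemma demop_braid2:
  assumes "\<And>u. u \<in> U \<Longrightarrow> a (\<tau> u) = a u" "\<And>u. u \<in> U \<Longrightarrow> b (\<sigma> u) = b u"
    and "\<And>u. u \<in> U \<Longrightarrow> \<sigma> (\<tau> u) = \<tau> (\<sigma> u)" and u: "u \<in> U"
  shows "demop b \<tau> (demop a \<sigma> X) u = demop a \<sigma> (demop b \<tau> X) u"
  using braid2[OF assms(1) u, of X] sw.braid2[OF assms(2) u, of X] assms(3)[OF u]
  by (simp add: z2_def sw.z2_def cs_def sw.cs_def algebra_simps)

lemma demop_braid3:
  assumes "\<And>u. u \<in> U \<Longrightarrow> a (\<tau> u) = a u * b u" "\<And>u. u \<in> U \<Longrightarrow> b (\<sigma> u) = b u * a u"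
    and "\<And>u. u \<in> U \<Longrightarrow> \<sigma> (\<tau> (\<sigma> u)) = \<tau> (\<sigma> (\<tau> u))" and u: "u \<in> U"
  shows "demop a \<sigma> (demop b \<tau> (demop a \<sigma> X)) u = demop b \<tau> (demop a \<sigma> (demop b \<tau> X)) u"
  using braid3[OF assms(1,2) u, of X] sw.braid3[OF assms(2,1) u, of X] assms(3)[OF u]
  by (simp add: z2_def sw.z2_def z3_def sw.z3_def cs_def sw.cs_def mult.commute[of "b u" "a u"])

lemma demop_braid4:
  assumes "\<And>u. u \<in> U \<Longrightarrow> a (\<tau> u) = a u * b u" "\<And>u. u \<in> U \<Longrightarrow> b (\<sigma> u) = b u * a u ^ 2"
    and "\<And>u. u \<in> U \<Longrightarrow> \<sigma> (\<tau> (\<sigma> (\<tau> u))) = \<tau> (\<sigma> (\<tau> (\<sigma> u)))" and u: "u \<in> U"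
  shows "demop b \<tau> (demop a \<sigma> (demop b \<tau> (demop a \<sigma> X))) u = demop a \<sigma> (demop b \<tau> (demop a \<sigma> (demop b \<tau> X))) u"
  using braid4a[OF assms(1,2) u, of X] sw.braid4b[OF assms(2,1) u, of X] assms(3)[OF u]
  by (simp add: z2_def sw.z2_def z3_def sw.z3_def z4_def sw.z4_def cs_def sw.cs_def 
     mult.commute[of "b u" "a u"] mult.commute[of "b u" "a u ^ 2"])

lemma demop_braid6:
  assumes "\<And>u. u \<in> U \<Longrightarrow> a (\<tau> u) = a u * b u" "\<And>u. u \<in> U \<Longrightarrow> b (\<sigma> u) = b u * a u ^ 3"
    and "\<And>u. u \<in> U \<Longrightarrow> \<sigma> (\<tau> (\<sigma> (\<tau> (\<sigma> (\<tau> u))))) = \<tau> (\<sigma> (\<tau> (\<sigma> (\<tau> (\<sigma> u)))))" and u: "u \<in> U"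
  shows "demop b \<tau> (demop a \<sigma> (demop b \<tau> (demop a \<sigma> (demop b \<tau> (demop a \<sigma> X))))) u 
    = demop a \<sigma> (demop b \<tau> (demop a \<sigma> (demop b \<tau> (demop a \<sigma> (demop b \<tau> X))))) u"
  using braid6a[OF assms(1,2) u, of X] sw.braid6b[OF assms(2,1) u, of X] assms(3)[OF u]
  by (simp add: z2_def sw.z2_def z3_def sw.z3_def z4_def sw.z4_def z5_def sw.z5_def z6_def sw.z6_def cs_def sw.cs_def 
     mult.commute[of "b u" "a u"] mult.commute[of "b u" "a u ^ 2"] mult.commute[of "b u" "a u ^ 3"] 
     mult.commute[of "b u ^ 2" "a u ^ 3"])

end

section \<open>Reflection groups and reduced words\<close>

lemma lookup_smul [simp]: "Poly_Mapping.lookup (smul c x) i = c * Poly_Mapping.lookup x i"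
  by (simp add: smul_def Poly_Mapping.map.rep_eq when_def)

lemma smul_0 [simp]: "smul 0 x = 0" "smul c 0 = 0"
  by (auto intro!: poly_mapping_eqI)
lemma smul_1 [simp]: "smul 1 x = x" by (auto intro!: poly_mapping_eqI)
lemma smul_minus1 [simp]: "smul (- 1) x = - x" by (auto intro!: poly_mapping_eqI)
lemma smul_add_left: "smul (a + b) x = smul a x + smul b x"
  by (rule poly_mapping_eqI) (simp add: lookup_add algebra_simps)
lemma smul_diff_left: "smul (a - b) x = smul a x - smul b x"
  by (rule poly_mapping_eqI) (simp add: lookup_minus algebra_simps)
lemma smul_minus_left: "smul (- a) x = - smul a x"
  by (auto intro!: poly_mapping_eqI)
lemma smul_add_right: "smul a (x + y) = smul a x + smul a y"
  by (rule poly_mapping_eqI) (simp add: lookup_add algebra_simps)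
lemma smul_minus_right: "smul a (- x) = - smul a x"
  by (auto intro!: poly_mapping_eqI)
lemma smul_smul [simp]: "smul a (smul b x) = smul (a * b) x"
  by (auto intro!: poly_mapping_eqI)

lemma additive_smul:
  assumes add: "\<And>x y. f (x + y) = f x + f y"
  shows "f (smul c x) = smul c (f x)"
proof -
  have 0: "f 0 = 0" using add[of 0 0] by simp
  have m: "f (- x) = - f x" for x using add[of x "- x"] 0 by (simp add: eq_neg_iff_add_eq_0 add.commute)
  have n: "f (smul (int k) x) = smul (int k) (f x)" for k
    by (induction k) (simp_all add: 0 add smul_add_left)
  show ?thesis
  proof (cases c rule: int_cases2)
    case (nonneg k) then show ?thesis using n by simp
  next
    case (nonpos k) then show ?thesis using n[of k] m by (simp add: smul_minus_left)
  qed
qed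

lemma additive_smul_int:
  fixes f :: "wt \<Rightarrow> int"
  assumes add: "\<And>x y. f (x + y) = f x + f y"
  shows "f (smul c x) = c * f x"
proof -
  have 0: "f 0 = 0" using add[of 0 0] by simp
  have m: "f (- x) = - f x" for x using add[of x "- x"] 0 by (simp add: eq_neg_iff_add_eq_0 add.commute)
  have n: "f (smul (int k) x) = int k * f x" for k
    by (induction k) (simp_all add: 0 add smul_add_left algebra_simps)
  show ?thesis
  proof (cases c rule: int_cases2)
    case (nonneg k) then show ?thesis using n by simp
  next
    case (nonpos k) then show ?thesis using n[of k] m by (simp add: smul_minus_left)
  qed
qed

section \<open>Words, length and reduced words\<close>

lemma word_prod_simps [simp]: "word_prod [] = id" "word_prod (g # ws) = snd g \<circ> word_prod ws"
  by (simp_all add: word_prod_def)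
lemma word_prod_append [simp]: "word_prod (us @ ws) = word_prod us \<circ> word_prod ws"
  by (induction us) (simp_all add: comp_assoc)

lemma grp_word: "w \<in> grp G \<longleftrightarrow> (\<exists>ws. set ws \<subseteq> G \<and> word_prod ws = w)"
proof
  assume "w \<in> grp G"
  then show "\<exists>ws. set ws \<subseteq> G \<and> word_prod ws = w" unfolding grp_def
  proof induction
    case gid show ?case by (intro exI[of _ "[]"]) simp
  next
    case (gstep s u)
    then obtain ws g where "set ws \<subseteq> G" "word_prod ws = u" "g \<in> G" "s = snd g" by auto
    then show ?case by (intro exI[of _ "g # ws"]) simp
  qed
next
  have "set ws \<subseteq> G \<Longrightarrow> word_prod ws \<in> grp G" for ws
    by (induction ws) (auto simp: grp_def intro: gen_group.intros)
  then show "\<exists>ws. set ws \<subseteq> G \<and> word_prod ws = w \<Longrightarrow> w \<in> grp G" by auto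
qed

lemma word_in_grp: "set ws \<subseteq> G \<Longrightarrow> word_prod ws \<in> grp G"
  by (auto simp: grp_word)
lemma grp_comp: "u \<in> grp G \<Longrightarrow> v \<in> grp G \<Longrightarrow> u \<circ> v \<in> grp G"
  unfolding grp_word by (metis le_sup_iff set_append word_prod_append)
lemma grp_id [simp]: "id \<in> grp G" by (simp add: grp_def gen_group.gid)
lemma grp_gen: "g \<in> G \<Longrightarrow> snd g \<in> grp G"
  using word_in_grp[of "[g]" G] by simp

lemma len_le: "set ws \<subseteq> G \<Longrightarrow> word_prod ws = w \<Longrightarrow> len G w \<le> length ws"
  unfolding len_def by (rule Least_le) auto

lemma redword:
  assumes "w \<in> grp G"
  shows "set (redword G w) \<subseteq> G" "length (redword G w) = len G w" "word_prod (redword G w) = w"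
proof -
  have "\<exists>k. \<exists>ws. set ws \<subseteq> G \<and> length ws = k \<and> word_prod ws = w" using assms by (auto simp: grp_word)
  then have "\<exists>ws. set ws \<subseteq> G \<and> length ws = len G w \<and> word_prod ws = w"
    unfolding len_def by (rule LeastI_ex)
  then have "set (redword G w) \<subseteq> G \<and> length (redword G w) = len G w \<and> word_prod (redword G w) = w"
    unfolding redword_def by (rule someI_ex)
  then show "set (redword G w) \<subseteq> G" "length (redword G w) = len G w" "word_prod (redword G w) = w" by auto
qed

lemma len_comp: "u \<in> grp G \<Longrightarrow> v \<in> grp G \<Longrightarrow> len G (u \<circ> v) \<le> len G u + len G v"
  using len_le[of "redword G u @ redword G v" G "u \<circ> v"] by (simp add: redword)

lemma len_id [simp]: "len G id = 0" using len_le[of "[]" G id] by simp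

definition is_red :: "gen set \<Rightarrow> gen list \<Rightarrow> bool" where
  "is_red G ws \<longleftrightarrow> set ws \<subseteq> G \<and> length ws = len G (word_prod ws)"

lemma is_red_redword: "w \<in> grp G \<Longrightarrow> is_red G (redword G w)"
  by (simp add: is_red_def redword)

text \<open>By subadditivity of length, a shorter word for the prefix would shorten the whole
  word.\<close>

lemma is_red_prefix:
  assumes "is_red G (us @ vs)" shows "is_red G us"
proof -
  have g: "set us \<subseteq> G" "set vs \<subseteq> G" using assms by (auto simp: is_red_def)
  have "length us + length vs \<le> len G (word_prod us) + len G (word_prod vs)"
    using assms len_comp[OF word_in_grp[OF g(1)] word_in_grp[OF g(2)]] by (simp add: is_red_def)
  moreover have "len G (word_prod us) \<le> length us" "len G (word_prod vs) \<le> length vs" using g len_le by auto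
  ultimately show "is_red G us" using g by (auto simp: is_red_def)
qed

text \<open>The last letter is the second argument \<open>h\<close>. The word grows from that end
  because right descents are stripped off later.\<close>

fun alt :: "gen \<Rightarrow> gen \<Rightarrow> nat \<Rightarrow> gen list" where
  "alt g h 0 = []"
| "alt g h (Suc k) = alt h g k @ [h]"

lemma alt_props: "set (alt g h k) \<subseteq> {g,h}" "length (alt g h k) = k"
  by (induction k arbitrary: g h) fastforce+

lemma alt_split: "m \<le> k \<Longrightarrow> \<exists>ys. set ys \<subseteq> {g,h} \<and> length ys = k - m \<and> alt g h k = ys @ alt g h m"
proof (induction m arbitrary: g h k)
  case 0 then show ?case using alt_props[of g h k] by auto
next
  case (Suc m)
  then obtain j where j: "k = Suc j" "m \<le> j" by (cases k) auto
  then obtain ys where "set ys \<subseteq> {h,g}" "length ys = j - m" "alt h g j = ys @ alt h g m" using Suc.IH[of j h g] by auto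
  then show ?case using j by (intro exI[of _ ys]) auto
qed

text \<open>A generator stores only the level-zero part of its root; the coroot functional
  \<open>cf\<close> and the coefficient \<open>lev\<close> of delta are therefore
  parameters.\<close>

locale refl_group =
  fixes G :: "gen set" and cf :: "gen \<Rightarrow> wt \<Rightarrow> int" and lev :: "gen \<Rightarrow> int"
  assumes refl_form: "g \<in> G \<Longrightarrow> snd g = arefl (cf g) (fst g) (lev g)"
    and cf_add: "g \<in> G \<Longrightarrow> cf g (x + y) = cf g x + cf g y"
    and cf_2: "g \<in> G \<Longrightarrow> cf g (fst g) = 2"
begin

abbreviation W :: "wel set" where "W \<equiv> grp G"
abbreviation ln :: "wel \<Rightarrow> nat" where "ln \<equiv> len G"
definition rt0 :: "gen \<Rightarrow> aff" where "rt0 g = (fst g, lev g)"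

lemma cf_smul: "g \<in> G \<Longrightarrow> cf g (smul c x) = c * cf g x"
  by (rule additive_smul_int) (simp add: cf_add)
lemma cf_minus: "g \<in> G \<Longrightarrow> cf g (- x) = - cf g x"
  using cf_smul[of g "-1" x] by simp
lemma cf_diff: "g \<in> G \<Longrightarrow> cf g (x - y) = cf g x - cf g y"
  using cf_add[of g x "- y"] by (simp add: cf_minus)

lemma refl_apply: "g \<in> G \<Longrightarrow> snd g (\<mu>, m) = (\<mu> - smul (cf g \<mu>) (fst g), m - cf g \<mu> * lev g)"
  by (simp add: refl_form arefl_def)

lemma gen_invol: "g \<in> G \<Longrightarrow> snd g \<circ> snd g = id"
  by (rule ext, clarsimp simp: refl_apply cf_diff cf_smul cf_2)
     (auto intro!: poly_mapping_eqI simp: lookup_minus)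

lemma gen_add: "g \<in> G \<Longrightarrow> snd g (x + y) = snd g x + snd g y"
  by (cases x; cases y) (auto intro!: poly_mapping_eqI simp: refl_apply cf_add lookup_add lookup_minus algebra_simps)

lemma W_induct [consumes 1, case_names id step]:
  assumes "w \<in> W" "P id" "\<And>g u. g \<in> G \<Longrightarrow> u \<in> W \<Longrightarrow> P u \<Longrightarrow> P (snd g \<circ> u)"
  shows "P w"
proof -
  have "set ws \<subseteq> G \<Longrightarrow> P (word_prod ws)" for ws
    by (induction ws) (use assms(2,3) word_in_grp in auto)
  then show ?thesis using assms(1) by (auto simp: grp_word)
qed

lemma W_add: "w \<in> W \<Longrightarrow> w (x + y) = w x + w y"
  by (induction arbitrary: x y rule: W_induct) (simp_all add: gen_add)

lemma W_zero: "w \<in> W \<Longrightarrow> w 0 = 0"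
  using W_add[of w 0 0] by simp
lemma W_neg: "w \<in> W \<Longrightarrow> w (- x) = - w x"
  using W_add[of w x "- x"] by (simp add: W_zero eq_neg_iff_add_eq_0 add.commute)

text \<open>The level is never fed back into the weight, so \<open>wpart\<close> is an action on
  weights alone.\<close>

lemma W_fst: "w \<in> W \<Longrightarrow> fst (w (\<mu>, m)) = wpart w \<mu>"
proof (induction rule: W_induct)
  case id then show ?case by (simp add: wpart_def)
next
  case (step g u)
  obtain x y where "u (\<mu>, m) = (x, y)" by fastforce
  moreover obtain x' y' where "u (\<mu>, 0) = (x', y')" by fastforce
  ultimately show ?case using step by (simp add: wpart_def refl_apply)
qed

lemma wpart_comp: "u \<in> W \<Longrightarrow> wpart (u \<circ> v) \<mu> = wpart u (wpart v \<mu>)"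
  using W_fst[of u "fst (v (\<mu>, 0))" "snd (v (\<mu>, 0))"] by (simp add: wpart_def)

lemma wpart_add: "u \<in> W \<Longrightarrow> wpart u (x + y) = wpart u x + wpart u y"
  using W_add[of u "(x,0)" "(y,0)"] by (simp add: wpart_def)

lemma wpart_smul: "u \<in> W \<Longrightarrow> wpart u (smul c x) = smul c (wpart u x)"
  by (rule additive_smul) (rule wpart_add)
lemma wpart_diff: "u \<in> W \<Longrightarrow> wpart u (x - y) = wpart u x - wpart u y"
  using wpart_add[of u x "- y"] wpart_smul[of u "-1" y] by simp

lemma wpart_gen: "g \<in> G \<Longrightarrow> wpart (snd g) x = x - smul (cf g x) (fst g)"
  by (simp add: wpart_def refl_apply)

lemma comp_gen_gen: "g \<in> G \<Longrightarrow> u \<circ> snd g \<circ> snd g = u"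
  by (simp add: comp_assoc gen_invol)
lemma gen_gen_comp: "g \<in> G \<Longrightarrow> snd g \<circ> (snd g \<circ> u) = u"
  by (simp add: gen_invol flip: comp_assoc)

lemma W_gen_right: "g \<in> G \<Longrightarrow> u \<circ> snd g \<in> W \<longleftrightarrow> u \<in> W"
  by (metis comp_gen_gen grp_comp grp_gen)

lemma word_prod_rev: "set ws \<subseteq> G \<Longrightarrow> word_prod (rev ws) \<circ> word_prod ws = id"
proof (induction ws)
  case (Cons g ws)
  then have "word_prod (rev (g # ws)) \<circ> word_prod (g # ws) = word_prod (rev ws) \<circ> (snd g \<circ> (snd g \<circ> word_prod ws))"
    by (simp add: comp_assoc)
  also have "\<dots> = id" using Cons gen_gen_comp[of g "word_prod ws"] by (simp only: list.set insert_subset)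
  finally show ?case .
qed simp

lemma W_inverse:
  assumes "w \<in> W"
  obtains v where "v \<in> W" "v \<circ> w = id" "w \<circ> v = id" "ln v \<le> ln w"
proof
  note r = redword[OF assms]
  let ?v = "word_prod (rev (redword G w))"
  show "?v \<in> W" using r by (intro word_in_grp) simp
  show "?v \<circ> w = id" using word_prod_rev[OF r(1)] r by simp
  show "w \<circ> ?v = id" using word_prod_rev[of "rev (redword G w)"] r by simp
  show "ln ?v \<le> ln w" using len_le[of "rev (redword G w)" G ?v] r by simp
qed

lemma ln_gen: "g \<in> G \<Longrightarrow> ln (snd g) \<le> 1"
  using len_le[of "[g]" G "snd g"] by simp

lemma ln_right_le: "g \<in> G \<Longrightarrow> w \<in> W \<Longrightarrow> ln (w \<circ> snd g) \<le> ln w + 1"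
  using len_comp[of w G "snd g"] ln_gen[of g] grp_gen[of g] by simp

lemma ln_right_ge: "g \<in> G \<Longrightarrow> w \<in> W \<Longrightarrow> ln w \<le> ln (w \<circ> snd g) + 1"
  using ln_right_le[of g "w \<circ> snd g"] by (simp add: W_gen_right comp_gen_gen)

text \<open>Coordinates in the plane of two simple affine roots, on which a rank-two subgroup
  acts.\<close>

definition comb :: "gen \<Rightarrow> gen \<Rightarrow> int \<Rightarrow> int \<Rightarrow> aff" where
  "comb g h a b = (smul a (fst g) + smul b (fst h), a * lev g + b * lev h)"

lemma comb_swap: "comb g h a b = comb h g b a"
  by (simp add: comb_def add.commute)

lemma rt0_comb: "rt0 g = comb g h 1 0" by (simp add: rt0_def comb_def)

lemma gen_comb: "g \<in> G \<Longrightarrow> snd g (comb g h a b) = comb g h (- a - b * cf g (fst h)) b"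
  unfolding comb_def
  by (subst refl_apply) (auto intro!: poly_mapping_eqI simp: cf_add cf_smul cf_2 lookup_add lookup_minus algebra_simps)

lemma gen_comb': "h \<in> G \<Longrightarrow> snd h (comb g h a b) = comb g h a (- b - a * cf h (fst g))"
  using gen_comb[of h g b a] by (simp add: comb_swap[of h g])

lemma gen_rt0: "g \<in> G \<Longrightarrow> snd g (rt0 g) = - rt0 g"
  using gen_comb[of g g 1 0] by (simp add: rt0_def comb_def)

end

text \<open>The pairs in \<open>rank2\<close> are the off-diagonal Cartan entries of types A1 x A1,
  A2, B2, G2 and affine A1. \<open>Pos\<close> is a predicate on all pairs, and no dichotomy is
  assumed: that every root is positive or negative comes out as
  \<open>root_dichotomy\<close>.\<close>

locale refl_system = refl_group G cf lev
  for G :: "gen set" and cf :: "gen \<Rightarrow> wt \<Rightarrow> int" and lev :: "gen \<Rightarrow> int" +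
  fixes n :: nat and Pos :: "aff \<Rightarrow> bool"
  assumes rank2: "g \<in> G \<Longrightarrow> h \<in> G \<Longrightarrow> g \<noteq> h \<Longrightarrow> (cf g (fst h), cf h (fst g)) \<in> 
      {(0,0),(-1,-1),(-1,-2),(-2,-1),(-1,-3),(-3,-1),(-2,-2)}"
    and Pos_add: "Pos p \<Longrightarrow> Pos q \<Longrightarrow> Pos (p + q)"
    and Pos_gen: "g \<in> G \<Longrightarrow> Pos (fst g, lev g)"
    and Pos_neg: "Pos p \<Longrightarrow> \<not> Pos (- p)"
    and finite_G: "finite G"
    and latt: "g \<in> G \<Longrightarrow> Poly_Mapping.keys (fst g) \<subseteq> {..<n}"
begin

lemma Pos_comb:
  assumes "w \<in> W" "Pos (w (rt0 g))" "Pos (w (rt0 h))" "0 \<le> a" "0 \<le> b" "0 < a + b"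
  shows "Pos (w (comb g h a b))"
proof -
  have st: "comb g h (a + 1) b = comb g h a b + rt0 g" "comb g h a (b + 1) = comb g h a b + rt0 h" for a b
    by (simp_all add: comb_def rt0_def smul_add_left algebra_simps)
  have "Pos (w (comb g h (int i) (int j)))" if "i + j > 0" for i j using that
  proof (induction "i + j" arbitrary: i j)
    case (Suc k)
    show ?case
    proof (cases "k = 0")
      case True
      then have "(i = 1 \<and> j = 0) \<or> (i = 0 \<and> j = 1)" using Suc by linarith
      then show ?thesis using assms by (auto simp: comb_def rt0_def)
    next
      case False
      show ?thesis
      proof (cases i)
        case 0
        then obtain j' where j: "j = Suc j'" using Suc by (cases j) auto
        have "Pos (w (comb g h (int i) (int j')))" using Suc(1)[of i j'] Suc False j by simp
        moreover have "comb g h (int i) (int j) = comb g h (int i) (int j') + rt0 h" using st(2)[of "int i" "int j'"] j by (simp add: add.commute)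
        ultimately show ?thesis using Pos_add assms by (simp add: W_add)
      next
        case (Suc i')
        have "Pos (w (comb g h (int i') (int j)))" using Suc.hyps(1)[of i' j] Suc.hyps(2) False Suc by simp
        moreover have "comb g h (int i) (int j) = comb g h (int i') (int j) + rt0 g" using st(1)[of "int i'" "int j"] Suc by (simp add: add.commute)
        ultimately show ?thesis using Pos_add assms by (simp add: W_add)
      qed
    qed
  qed simp
  from this[of "nat a" "nat b"] show ?thesis using assms by (simp, linarith)
qed


text \<open>The value \<open>0\<close> stands for infinite order.\<close>

definition mord :: "gen \<Rightarrow> gen \<Rightarrow> nat" where
  "mord g h = (if cf g (fst h) = 0 then 2 else let p = cf g (fst h) * cf h (fst g) in
     if p = 1 then 3 else if p = 2 then 4 else if p = 3 then 6 else 0)"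

text \<open>Every translate of the plane of two roots is stable under both reflections, so a
  relation between them can be checked by arithmetic in two coordinates at an arbitrary
  point.\<close>

lemma gen_pt: "g \<in> G \<Longrightarrow> snd g ((\<mu>, m) + comb g h p q) = (\<mu>, m) + comb g h (- p - q * cf g (fst h) - cf g \<mu>) q"
  unfolding comb_def add_Pair
  by (subst refl_apply) (auto intro!: poly_mapping_eqI simp: cf_add cf_smul cf_2 lookup_add lookup_minus algebra_simps)

lemma gen_pt': "h \<in> G \<Longrightarrow> snd h ((\<mu>, m) + comb g h p q) = (\<mu>, m) + comb g h p (- q - p * cf h (fst g) - cf h \<mu>)"
  using gen_pt[of h \<mu> m g q p] by (simp add: comb_swap[of h g])

lemma mord_cases:
  assumes "g \<in> G" "h \<in> G" "g \<noteq> h"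
  obtains "mord g h = 2" "cf g (fst h) = 0" "cf h (fst g) = 0"
  | "mord g h = 3" "cf g (fst h) = -1" "cf h (fst g) = -1"
  | "mord g h = 4" "cf g (fst h) = -2" "cf h (fst g) = -1"
  | "mord g h = 4" "cf g (fst h) = -1" "cf h (fst g) = -2"
  | "mord g h = 6" "cf g (fst h) = -3" "cf h (fst g) = -1"
  | "mord g h = 6" "cf g (fst h) = -1" "cf h (fst g) = -3"
  | "mord g h = 0" "cf g (fst h) = -2" "cf h (fst g) = -2"
  using rank2[OF assms] by (auto simp: mord_def)

lemma word_alt_Suc: "word_prod (alt g h (Suc k)) x = word_prod (alt h g k) (snd h x)"
  by simp

lemma alt_braid:
  assumes "g \<in> G" "h \<in> G" "g \<noteq> h"
  shows "word_prod (alt g h (mord g h)) = word_prod (alt h g (mord g h))"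
proof (rule ext)
  fix x
  obtain \<mu> m where x: "x = (\<mu>, m) + comb g h 0 0" by (cases x) (auto simp: comb_def zero_prod_def[symmetric])
  note r = gen_pt[OF assms(1)] gen_pt'[OF assms(2)]
  show "word_prod (alt g h (mord g h)) x = word_prod (alt h g (mord g h)) x" unfolding x
    using assms
    by (rule mord_cases) (simp_all add: eval_nat_numeral r mult.commute[of _ 2] del: add_Pair)
qed

text \<open>For the infinite dihedral group the invariant 0 \<le> b \<le> a passes to the pair (2a -
  b, a) with the generators exchanged, so no coordinate ever becomes negative.\<close>

lemma alt_root_inf:
  assumes "g \<in> G" "h \<in> G" "cf g (fst h) = -2" "cf h (fst g) = -2" "0 \<le> b" "b \<le> a" "0 < a"
  shows "\<exists>a' b'. 0 \<le> a' \<and> 0 \<le> b' \<and> 0 < a' + b' \<and> word_prod (alt g h k) (comb g h a b) = comb g h a' b'"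
  using assms
proof (induction k arbitrary: g h a b)
  case 0 then show ?case by (intro exI[of _ a] exI[of _ b]) auto
next
  case (Suc k)
  have "snd h (comb g h a b) = comb h g (2 * a - b) a" 
    using Suc.prems by (simp add: gen_comb' comb_swap[of h g] mult.commute[of a])
  moreover obtain a' b' where "0 \<le> a'" "0 \<le> b'" "0 < a' + b'" 
     "word_prod (alt h g k) (comb h g (2 * a - b) a) = comb h g a' b'"
    using Suc.IH[of h g a "2 * a - b"] Suc.prems by auto
  ultimately show ?case unfolding word_alt_Suc by (metis add.commute comb_swap)
qed

text \<open>Alternating words below the order keep the root of \<open>g\<close> positive as long as
  their last letter, which acts first, is \<open>h\<close>. In finite type at most six lengths have
  to be inspected.\<close>

lemma alt_root:
  assumes "g \<in> G" "h \<in> G" "g \<noteq> h" "mord g h = 0 \<or> k < mord g h"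
  shows "\<exists>a b. 0 \<le> a \<and> 0 \<le> b \<and> 0 < a + b \<and> word_prod (alt g h k) (rt0 g) = comb g h a b"
proof -
  note r = gen_comb[OF assms(1)] gen_comb'[OF assms(2)]
  have r0: "rt0 g = comb g h 1 0" by (rule rt0_comb)
  have k6: "k = 0 \<or> k = 1 \<or> k = 2 \<or> k = 3 \<or> k = 4 \<or> k = 5" if "k < 6" for k :: nat using that by arith
  define Q where "Q X \<longleftrightarrow> (\<exists>a b. 0 \<le> a \<and> 0 \<le> b \<and> 0 < a + b \<and> X = comb g h a b)" for X
  have Q: "Q (comb g h a b)" if "0 \<le> a" "0 \<le> b" "0 < a + b" for a b
    using that by (auto simp: Q_def)
  have "Q (word_prod (alt g h k) (comb g h 1 0))" using assms(1,2,3)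
  proof (cases rule: mord_cases)
    case 7
    then show ?thesis unfolding Q_def by (intro alt_root_inf) (use assms in auto)
  qed (use assms(4) k6[of k] in \<open>auto simp: eval_nat_numeral r intro!: Q\<close>)
  then show ?thesis by (simp only: r0 Q_def)
qed

text \<open>Strip right descents among the two generators until none is left; each one lowers the
  length by exactly one.\<close>

lemma coset_decomp:
  assumes "g \<in> G" "h \<in> G" "w \<in> W"
  shows "\<exists>v xs. v \<in> W \<and> set xs \<subseteq> {g,h} \<and> w = v \<circ> word_prod xs \<and> ln w = ln v + length xs
     \<and> ln v \<le> ln (v \<circ> snd g) \<and> ln v \<le> ln (v \<circ> snd h)"
  using assms(3)
proof (induction "ln w" arbitrary: w rule: less_induct)
  case less
  show ?case
  proof (cases "\<exists>s\<in>{g,h}. ln (w \<circ> snd s) < ln w")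
    case True
    then obtain s where s: "s \<in> {g,h}" "ln (w \<circ> snd s) < ln w" by blast
    then have sG: "s \<in> G" using assms by auto
    then have "w \<circ> snd s \<in> W" using less by (simp add: W_gen_right)
    from less.hyps[OF s(2) this] obtain v xs where v: "v \<in> W" "set xs \<subseteq> {g,h}" "w \<circ> snd s = v \<circ> word_prod xs"
      "ln (w \<circ> snd s) = ln v + length xs" "ln v \<le> ln (v \<circ> snd g)" "ln v \<le> ln (v \<circ> snd h)" by blast
    have "w = w \<circ> snd s \<circ> snd s" using sG by (simp add: comp_gen_gen)
    then have "w = v \<circ> word_prod (xs @ [s])" by (simp add: v comp_assoc)
    moreover have "ln w = ln v + length (xs @ [s])" using s v ln_right_ge[OF sG less.prems] by simp
    ultimately show ?thesis using v s by (intro exI[of _ v] exI[of _ "xs @ [s]"]) auto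
  next
    case False
    then show ?thesis using less by (intro exI[of _ w] exI[of _ "[]"]) auto
  qed
qed

lemma alternating:
  assumes "set xs \<subseteq> {g,h}" "\<And>ys z zs. xs \<noteq> ys @ [z,z] @ zs"
  shows "xs = alt g h (length xs) \<or> xs = alt h g (length xs)"
  using assms
proof (induction xs rule: rev_induct)
  case (snoc x xs)
  have "xs = alt g h (length xs) \<or> xs = alt h g (length xs)"
  proof (rule snoc.IH)
    show "xs \<noteq> ys @ [z, z] @ zs" for ys z zs using snoc.prems(2)[of ys z "zs @ [x]"] by auto
  qed (use snoc in auto)
  then show ?case
  proof (cases "length xs")
    case (Suc k)
    have "last xs \<noteq> x" using snoc.prems(2)[of "butlast xs" x "[]"] Suc 
      by (metis append.assoc append_Cons append_Nil append_butlast_last_id length_0_conv nat.simps(3))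
    with Suc \<open>xs = alt g h (length xs) \<or> xs = alt h g (length xs)\<close> show ?thesis
      using snoc.prems(1) by auto
  qed (use snoc in auto)
qed simp

text \<open>Stripping the descent \<open>h\<close> before all others makes the word end in
  \<open>h\<close>. A repeated letter would cancel and contradict additivity of lengths, so the word
  alternates.\<close>

lemma descent_decomp:
  assumes "g \<in> G" "h \<in> G" "g \<noteq> h" "w \<in> W" "ln (w \<circ> snd h) < ln w"
  obtains v k where "v \<in> W" "w = v \<circ> word_prod (alt g h k)" "ln w = ln v + k" "k \<ge> 1"
     "ln v \<le> ln (v \<circ> snd g)" "ln v \<le> ln (v \<circ> snd h)"
proof -
  have "w \<circ> snd h \<in> W" using assms by (simp add: W_gen_right)
  then obtain v xs where v: "v \<in> W" "set xs \<subseteq> {g,h}" "w \<circ> snd h = v \<circ> word_prod xs"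
      "ln (w \<circ> snd h) = ln v + length xs" "ln v \<le> ln (v \<circ> snd g)" "ln v \<le> ln (v \<circ> snd h)" 
    using coset_decomp[OF assms(1,2)] by meson
  let ?zs = "xs @ [h]"
  have "w = w \<circ> snd h \<circ> snd h" using assms by (simp add: comp_gen_gen)
  then have w: "w = v \<circ> word_prod ?zs" by (simp add: v comp_assoc)
  have l: "ln w = ln v + length ?zs" using v ln_right_ge[OF assms(2,4)] assms(5) by simp
  have "?zs = alt g h (length ?zs) \<or> ?zs = alt h g (length ?zs)"
  proof (rule alternating)
    show "set ?zs \<subseteq> {g,h}" using v by auto
    show "?zs \<noteq> ys @ [z,z] @ zs" for ys z zs
    proof
      assume e: "?zs = ys @ [z,z] @ zs"
      then have "set (ys @ [z,z] @ zs) \<subseteq> {g, h}" using \<open>set ?zs \<subseteq> {g,h}\<close> by simp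
      then have z: "z \<in> G" "set (ys @ zs) \<subseteq> G" using assms by auto
      have "word_prod ?zs = word_prod (ys @ zs)" unfolding e by (simp add: comp_assoc gen_gen_comp z)
      then have "ln w \<le> ln v + length (ys @ zs)" 
        using len_comp[OF v(1) word_in_grp[OF z(2)]] len_le[OF z(2) refl] w by simp
      then show False using l unfolding e by simp
    qed
  qed
  then have "?zs = alt g h (length ?zs)" using assms(3) by auto
  then show thesis using that[of v "length ?zs"] v w l by auto
qed

lemma W_exists_descent:
  assumes "w \<in> W" "w \<noteq> id"
  obtains h where "h \<in> G" "ln (w \<circ> snd h) < ln w"
proof -
  note r = redword[OF assms(1)]
  have "redword G w \<noteq> []" using r assms by auto
  then obtain xs h where e: "redword G w = xs @ [h]" by (metis rev_exhaust)
  then have "word_prod xs \<circ> snd h = w" "h \<in> G" "set xs \<subseteq> G" using r by auto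
  then have "w \<circ> snd h = word_prod xs" using comp_gen_gen by metis
  then have "ln (w \<circ> snd h) \<le> length xs" using len_le[OF \<open>set xs \<subseteq> G\<close> refl] by simp
  then show thesis using that[of h] \<open>h \<in> G\<close> r(2) e by simp
qed

text \<open>
  Tits' argument: split off from \<open>w\<close> a maximal alternating word in \<open>g\<close> and a right descent \<open>h\<close>; the
  remaining factor is shorter and keeps both simple roots positive, and the rank-two word sends
  the root of \<open>g\<close> to a nonnegative combination of them.
\<close>

theorem Pos_if_longer:
  assumes "g \<in> G" "w \<in> W" "ln w \<le> ln (w \<circ> snd g)"
  shows "Pos (w (rt0 g))"
  using assms
proof (induction "ln w" arbitrary: g w rule: less_induct)
  case less
  show ?case
  proof (cases "w = id")
    case True then show ?thesis using Pos_gen less by (simp add: rt0_def)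
  next
    case False
    then obtain h where h: "h \<in> G" "ln (w \<circ> snd h) < ln w" using W_exists_descent less by blast
    with less have gh: "g \<noteq> h" by auto
    obtain v k where v: "v \<in> W" "w = v \<circ> word_prod (alt g h k)" "ln w = ln v + k" "k \<ge> 1"
     "ln v \<le> ln (v \<circ> snd g)" "ln v \<le> ln (v \<circ> snd h)"
      using descent_decomp[OF less.prems(1) h(1) gh less.prems(2) h(2)] .
    have P: "Pos (v (rt0 g))" "Pos (v (rt0 h))" using less.hyps[of v] v less.prems h by auto
    \<comment> \<open>If \<open>k\<close> reached the order, the braid relation would rewrite the
      end of the word so that it ends in \<open>g\<close>; multiplication by \<open>g\<close> would
      then shorten \<open>w\<close>.\<close>
    have "mord g h = 0 \<or> k < mord g h"
    proof (rule ccontr)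
      assume "\<not> ?thesis"
      then obtain m where m: "mord g h = Suc m" "Suc m \<le> k" by (cases "mord g h") auto
      obtain ys where ys: "set ys \<subseteq> {g,h}" "length ys = k - Suc m" "alt g h k = ys @ alt g h (Suc m)"
        using alt_split[OF m(2)] by blast
      have "word_prod (alt g h (Suc m)) = word_prod (alt h g (Suc m))"
        using alt_braid[OF less.prems(1) h(1) gh] m by simp
      then have "w \<circ> snd g = v \<circ> (word_prod ys \<circ> (word_prod (alt g h m) \<circ> snd g \<circ> snd g))"
        unfolding v(2) ys(3) by (simp add: comp_assoc)
      then have "w \<circ> snd g = v \<circ> word_prod (ys @ alt g h m)" using less.prems by (simp add: comp_gen_gen)
      moreover have s: "set (ys @ alt g h m) \<subseteq> G" using ys alt_props[of g h m] less.prems h by auto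
      ultimately have "ln (w \<circ> snd g) \<le> ln v + length (ys @ alt g h m)"
        using len_comp[OF v(1) word_in_grp[OF s]] len_le[OF s refl] by simp
      then show False using ys v m less.prems(3) alt_props[of g h m] by simp
    qed
    then obtain a b where "0 \<le> a" "0 \<le> b" "0 < a + b" "word_prod (alt g h k) (rt0 g) = comb g h a b"
      using alt_root[OF less.prems(1) h(1) gh] by blast
    then show ?thesis using Pos_comb[OF v(1) P] v(2) by simp
  qed
qed

text \<open>The reflection negates its own root, so the positive case is applied to
  \<open>w \<circ> snd g\<close>.\<close>

lemma Neg_if_shorter:
  assumes "g \<in> G" "w \<in> W" "ln (w \<circ> snd g) \<le> ln w"
  shows "Pos (- w (rt0 g))"
  using Pos_if_longer[of g "w \<circ> snd g"] assms by (simp add: W_gen_right comp_gen_gen gen_rt0 W_neg)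

text \<open>Equal lengths would make the image of the root positive and negative at once; positivity
  does here the work of a sign character.\<close>

lemma ln_neq: "g \<in> G \<Longrightarrow> w \<in> W \<Longrightarrow> ln (w \<circ> snd g) \<noteq> ln w"
  using Pos_if_longer[of g w] Neg_if_shorter[of g w] Pos_neg by (metis order_refl)

lemma longer_iff_Pos: "g \<in> G \<Longrightarrow> w \<in> W \<Longrightarrow> ln w < ln (w \<circ> snd g) \<longleftrightarrow> Pos (w (rt0 g))"
  using Pos_if_longer[of g w] Neg_if_shorter[of g w] Pos_neg by (metis linorder_not_less order_less_imp_le)

lemma root_dichotomy: "g \<in> G \<Longrightarrow> w \<in> W \<Longrightarrow> Pos (w (rt0 g)) \<or> Pos (- w (rt0 g))"
  using Pos_if_longer[of g w] Neg_if_shorter[of g w] by (meson nle_le)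

text \<open>The alternating tail must be at least as long as the order, which is then finite:
  otherwise \<open>alt_root\<close> would make the image of the root of \<open>g\<close> positive
  although \<open>g\<close> is a descent.\<close>

lemma two_descents:
  assumes "g \<in> G" "h \<in> G" "g \<noteq> h" "w \<in> W" "ln (w \<circ> snd g) < ln w" "ln (w \<circ> snd h) < ln w"
  obtains v where "v \<in> W" "w = v \<circ> word_prod (alt g h (mord g h))" "ln w = ln v + mord g h" "mord g h > 0"
proof -
  obtain v k where v: "v \<in> W" "w = v \<circ> word_prod (alt g h k)" "ln w = ln v + k" "k \<ge> 1"
     "ln v \<le> ln (v \<circ> snd g)" "ln v \<le> ln (v \<circ> snd h)"
    using descent_decomp[OF assms(1-4,6)] .
  have P: "Pos (v (rt0 g))" "Pos (v (rt0 h))" using Pos_if_longer v assms by auto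
  have m: "mord g h > 0" "mord g h \<le> k"
  proof -
    have "\<not> (mord g h = 0 \<or> k < mord g h)"
    proof
      assume "mord g h = 0 \<or> k < mord g h"
      then obtain a b where "0 \<le> a" "0 \<le> b" "0 < a + b" "word_prod (alt g h k) (rt0 g) = comb g h a b"
        using alt_root[OF assms(1-3)] by blast
      then have "Pos (w (rt0 g))" using Pos_comb[OF v(1) P] v(2) by simp
      then show False using longer_iff_Pos[OF assms(1,4)] assms(5) by simp
    qed
    then show "mord g h > 0" "mord g h \<le> k" by auto
  qed
  obtain ys where ys: "set ys \<subseteq> {g,h}" "length ys = k - mord g h" "alt g h k = ys @ alt g h (mord g h)"
    using alt_split[OF m(2)] by blast
  have yG: "set ys \<subseteq> G" "set (alt g h (mord g h)) \<subseteq> G" using ys assms alt_props[of g h] by auto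
  let ?v = "v \<circ> word_prod ys"
  have vW: "?v \<in> W" using v yG by (simp add: grp_comp word_in_grp)
  have w: "w = ?v \<circ> word_prod (alt g h (mord g h))" using v(2) ys(3) by (simp add: comp_assoc)
  have "ln w \<le> ln ?v + mord g h" 
    using w len_comp[OF vW word_in_grp[OF yG(2)]] len_le[OF yG(2) refl] alt_props[of g h "mord g h"] by simp
  moreover have "ln ?v \<le> ln v + (k - mord g h)" 
    using len_comp[OF v(1) word_in_grp[OF yG(1)]] len_le[OF yG(1) refl] ys by simp
  ultimately have "ln w = ln ?v + mord g h" using v m by linarith
  then show thesis using that vW w m by blast
qed

end

section \<open>Independence of the reduced word\<close>

abbreviation fr :: "rt \<Rightarrow> rt fract" where "fr r \<equiv> Fract r 1"

text \<open>These rules let \<open>fr\<close> be used as a ring homomorphism. The general fraction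
  rules, removed from the simplifier just below, would merge sums and products into one
  fraction.\<close>

lemma fr_simps: "fr 0 = 0" "fr 1 = 1" "fr (a + b) = fr a + fr b" "fr (a * b) = fr a * fr b" "fr (- a) = - fr a"
  by (simp_all add: Zero_fract_def One_fract_def)
declare add_fract [simp del] mult_fract [simp del] minus_fract [simp del]

lemma fr_inj [simp]: "fr a = fr b \<longleftrightarrow> a = b"
  by (simp add: eq_fract)
lemma fr_0_iff [simp]: "fr a = 0 \<longleftrightarrow> a = 0"
  using fr_inj[of a 0] by (simp only: fr_simps)
lemma fr_sum: "fr (sum f S) = (\<Sum>i\<in>S. fr (f i))"
  by (induction S rule: infinite_finite_induct) (simp_all only: sum.infinite sum.empty sum.insert fr_simps simp_thms)

section \<open>Lattice weights and the ring R(T)\<close>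

definition latt_wt :: "nat \<Rightarrow> wt \<Rightarrow> bool" where "latt_wt n x \<longleftrightarrow> (\<forall>i\<ge>n. Poly_Mapping.lookup x i = 0)"

lemma latt_wt_keys: "latt_wt n x \<longleftrightarrow> Poly_Mapping.keys x \<subseteq> {..<n}"
  by (auto simp: latt_wt_def in_keys_iff not_less) (metis in_keys_iff lessThan_iff linorder_not_less subsetD)

lemma latt_wt_closed: "latt_wt n x \<Longrightarrow> latt_wt n y \<Longrightarrow> latt_wt n (x + y)" 
  "latt_wt n x \<Longrightarrow> latt_wt n y \<Longrightarrow> latt_wt n (x - y)" "latt_wt n x \<Longrightarrow> latt_wt n (smul c x)" "latt_wt n 0"
  by (simp_all add: latt_wt_def lookup_add lookup_minus)

lemma Rlat_alt: "f \<in> Rlat n \<longleftrightarrow> (\<forall>\<mu>\<in>Poly_Mapping.keys f. latt_wt n \<mu>)"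
  by (simp add: Rlat_def latt_wt_keys)

lemma Rlat_0: "0 \<in> Rlat n" by (simp add: Rlat_def)
lemma Rlat_single: "latt_wt n \<mu> \<Longrightarrow> Poly_Mapping.single \<mu> c \<in> Rlat n"
  by (simp add: Rlat_alt)
lemma Rlat_1: "1 \<in> Rlat n"
  using Rlat_single[of n 0 1] by (simp add: latt_wt_closed single_one)
lemma Rlat_add: "f \<in> Rlat n \<Longrightarrow> g \<in> Rlat n \<Longrightarrow> f + g \<in> Rlat n"
  using Poly_Mapping.keys_add[of f g] by (auto simp: Rlat_alt)
lemma Rlat_mult: "f \<in> Rlat n \<Longrightarrow> g \<in> Rlat n \<Longrightarrow> f * g \<in> Rlat n"
  using keys_mult[of f g] by (force simp: Rlat_alt intro: latt_wt_closed)
lemma Rlat_uminus: "f \<in> Rlat n \<Longrightarrow> - f \<in> Rlat n"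
  by (simp add: Rlat_alt)

section \<open>Exponentials and right multiplication by the generators\<close>

context refl_system begin

lemma latt_gen: "g \<in> G \<Longrightarrow> latt_wt n (fst g)"
  using latt by (simp add: latt_wt_keys)

lemma ex_fr: "ex u x = fr (Poly_Mapping.single (wpart u x) 1)"
  by (simp add: ex_def)

lemma ex_add: "u \<in> W \<Longrightarrow> ex u (x + y) = ex u x * ex u y"
  by (simp add: ex_def wpart_add mult_single mult_fract)
lemma ex_zero: "u \<in> W \<Longrightarrow> ex u 0 = 1"
  using wpart_smul[of u 0 0] by (simp add: ex_def One_fract_def single_one)
lemma ex_nz: "ex u x \<noteq> 0"
  unfolding ex_fr fr_0_iff by (metis lookup_single_eq lookup_zero zero_neq_one)
lemma ex_minus: "u \<in> W \<Longrightarrow> ex u (- x) = inverse (ex u x)"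
  using ex_add[of u x "- x"] ex_nz[of u x] by (simp add: ex_zero field_simps)
lemma ex_smul: "u \<in> W \<Longrightarrow> ex u (smul (int k) x) = ex u x ^ k"
  by (induction k) (simp_all add: ex_zero ex_add smul_add_left)

lemma wpart_inj: "u \<in> W \<Longrightarrow> wpart u x = wpart u y \<Longrightarrow> x = y"
  by (metis W_inverse wpart_comp fst_conv id_apply wpart_def)

lemma ex_eq_1: "u \<in> W \<Longrightarrow> ex u x = 1 \<Longrightarrow> x = 0"
proof -
  assume u: "u \<in> W" and "ex u x = 1"
  then have "Poly_Mapping.single (wpart u x) 1 = (Poly_Mapping.single 0 1 :: rt)"
    by (simp add: ex_fr flip: fr_simps)
  then have "wpart u x = 0" by (metis lookup_single_eq lookup_single_not_eq zero_neq_one)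
  also have "0 = wpart u 0" using wpart_smul[OF u, of 0 0] by simp
  finally show "x = 0" using wpart_inj[OF u] by blast
qed

lemma fst_nz: "g \<in> G \<Longrightarrow> fst g \<noteq> 0"
  using cf_2[of g] cf_smul[of g 0 0] by auto

lemma ex_gen_n1: "u \<in> W \<Longrightarrow> g \<in> G \<Longrightarrow> ex u (fst g) \<noteq> 1"
  using ex_eq_1 fst_nz by blast

lemma ex_comp_gen: "u \<in> W \<Longrightarrow> g \<in> G \<Longrightarrow> ex (u \<circ> snd g) x = ex u (x - smul (cf g x) (fst g))"
  by (simp add: ex_def wpart_comp wpart_gen)

lemma ex_comp_self: "u \<in> W \<Longrightarrow> g \<in> G \<Longrightarrow> ex (u \<circ> snd g) (fst g) = inverse (ex u (fst g))"
proof -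
  assume a: "u \<in> W" "g \<in> G"
  have "fst g - smul 2 (fst g) = - fst g"
    by (rule poly_mapping_eqI) (simp add: lookup_minus)
  then show ?thesis using a by (simp only: ex_comp_gen cf_2 ex_minus)
qed

abbreviation ea :: "gen \<Rightarrow> wel \<Rightarrow> rt fract" where "ea g u \<equiv> ex u (fst g)"
abbreviation rm :: "gen \<Rightarrow> wel \<Rightarrow> wel" where "rm g u \<equiv> u \<circ> snd g"

text \<open>Both 1 - 1/(1 - a) and 1/(1 - 1/a) equal a/(a - 1), so right multiplication by y_i is
  one common factor times an orbit sum.\<close>

lemma mul_y_demop:
  assumes "u \<in> W" "g \<in> G"
  shows "mul_y g X u = demop (ea g) (rm g) X u"
proof -
  have "X u - X u / (1 - a) + Y / (1 - inverse a) = a / (a - 1) * (X u + Y)" if "a \<noteq> 0" "a \<noteq> 1" for a Y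
    using that by (simp add: divide_simps) (simp add: algebra_simps)
  then show ?thesis unfolding mul_y_def demop_def ex_comp_self[OF assms]
    using ex_nz ex_gen_n1[OF assms] by blast
qed

lemma mul_y_qf: "u \<in> W \<Longrightarrow> g \<in> G \<Longrightarrow> mul_y g X u = qf (ea g u) * (X u + X (u \<circ> snd g))"
  by (simp add: mul_y_demop demop_def qf_def)

lemma qf_nz: "u \<in> W \<Longrightarrow> g \<in> G \<Longrightarrow> qf (ea g u) \<noteq> 0"
  using ex_nz ex_gen_n1 by (simp add: qf_def)

text \<open>The involutions are right multiplications by two generators and the functions are
  u(e^alpha) and u(e^beta); the inversion laws hold because a reflection negates its root.\<close>

lemma dihedral: "g \<in> G \<Longrightarrow> h \<in> G \<Longrightarrow> dihedral_action W (rm g) (rm h) (ea g) (ea h)"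
  by unfold_locales (simp_all add: W_gen_right comp_gen_gen ex_nz ex_gen_n1 ex_comp_self)

text \<open>Coefficient functions are defined on all maps, while every root computation needs a
  group element; vanishing off the group lets equality be tested there.\<close>

definition supp_on_W :: "nh \<Rightarrow> bool" where "supp_on_W X \<longleftrightarrow> (\<forall>u. u \<notin> W \<longrightarrow> X u = 0)"

lemma supp_on_W_mul_y: "g \<in> G \<Longrightarrow> supp_on_W X \<Longrightarrow> supp_on_W (mul_y g X)"
  by (simp add: supp_on_W_def mul_y_def W_gen_right)
lemma supp_on_W_fold: "set ws \<subseteq> G \<Longrightarrow> supp_on_W X \<Longrightarrow> supp_on_W (fold mul_y ws X)"
  by (induction ws arbitrary: X) (simp_all add: supp_on_W_mul_y)
lemma supp_on_W_eqI: "supp_on_W X \<Longrightarrow> supp_on_W Y \<Longrightarrow> (\<And>u. u \<in> W \<Longrightarrow> X u = Y u) \<Longrightarrow> X = Y"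
  unfolding supp_on_W_def by (metis ext)

abbreviation dm :: "gen \<Rightarrow> nh \<Rightarrow> nh" where "dm g \<equiv> demop (ea g) (rm g)"

lemma fold_dm:
  assumes "set ws \<subseteq> G" "\<And>u. u \<in> W \<Longrightarrow> X u = Y u" "u \<in> W"
  shows "fold mul_y ws X u = fold dm ws Y u"
  using assms
proof (induction ws arbitrary: X Y)
  case (Cons g ws)
  show ?case unfolding fold_simps
  proof (rule Cons.IH)
    fix u assume u: "u \<in> W"
    then have "u \<circ> snd g \<in> W" using Cons.prems by (simp add: W_gen_right)
    then have "X (u \<circ> snd g) = Y (u \<circ> snd g)" by (rule Cons.prems(2))
    then show "mul_y g X u = dm g Y u" using Cons.prems u by (simp add: mul_y_demop demop_def)
  qed (use Cons.prems in auto)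
qed simp

lemma dm_braid:
  assumes g: "g \<in> G" "h \<in> G" "g \<noteq> h" and u: "u \<in> W"
  shows "fold dm (alt g h (mord g h)) X u = fold dm (alt h g (mord g h)) X u"
proof -
  interpret D: dihedral_action W "rm g" "rm h" "ea g" "ea h" using dihedral g by blast
  interpret E: dihedral_action W "rm h" "rm g" "ea h" "ea g" using dihedral g by blast
  \<comment> \<open>This is the form that the hypotheses of the dihedral lemmas take, with the
    negated Cartan integer as exponent. In cases 4 and 6 the root of \<open>h\<close> is the short
    one, so the interpretation with exchanged generators is used.\<close>
  have c: "ea x (rm y v) = ea x v * ea y v ^ k" if "cf y (fst x) = - int k" "x \<in> G" "y \<in> G" "v \<in> W" for y x k v
    using that by (simp add: ex_comp_gen smul_minus_left ex_add ex_smul)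
  show ?thesis using g
  proof (cases rule: mord_cases)
    case 1
    have e: "snd g \<circ> snd h = snd h \<circ> snd g" using alt_braid[OF g] 1 by (simp add: eval_nat_numeral comp_assoc)
    show ?thesis unfolding 1(1)
      by (simp add: eval_nat_numeral, rule D.demop_braid2)
         (use c[of g h 0] c[of h g 0] g u 1 e in \<open>simp_all add: comp_assoc\<close>)
  next
    case 2
    have e: "snd h \<circ> (snd g \<circ> snd h) = snd g \<circ> (snd h \<circ> snd g)" using alt_braid[OF g] 2 by (simp add: eval_nat_numeral comp_assoc)
    show ?thesis unfolding 2(1)
      by (simp add: eval_nat_numeral, rule D.demop_braid3[symmetric])
         (use c[of g h 1] c[of h g 1] g u 2 e in \<open>simp_all add: comp_assoc\<close>)
  next
    case 3
    have e: "snd g \<circ> (snd h \<circ> (snd g \<circ> snd h)) = snd h \<circ> (snd g \<circ> (snd h \<circ> snd g))" using alt_braid[OF g] 3 by (simp add: eval_nat_numeral comp_assoc)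
    show ?thesis unfolding 3(1)
      by (simp add: eval_nat_numeral, rule D.demop_braid4)
         (use c[of g h 2] c[of h g 1] g u 3 e in \<open>simp_all add: comp_assoc\<close>)
  next
    case 4
    have e: "snd g \<circ> (snd h \<circ> (snd g \<circ> snd h)) = snd h \<circ> (snd g \<circ> (snd h \<circ> snd g))" using alt_braid[OF g] 4 by (simp add: eval_nat_numeral comp_assoc)
    show ?thesis unfolding 4(1)
      by (simp add: eval_nat_numeral, rule E.demop_braid4[symmetric])
         (use c[of g h 1] c[of h g 2] g u 4 e in \<open>simp_all add: comp_assoc\<close>)
  next
    case 5
    have e: "snd g \<circ> (snd h \<circ> (snd g \<circ> (snd h \<circ> (snd g \<circ> snd h)))) = snd h \<circ> (snd g \<circ> (snd h \<circ> (snd g \<circ> (snd h \<circ> snd g))))" using alt_braid[OF g] 5 by (simp add: eval_nat_numeral comp_assoc)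
    show ?thesis unfolding 5(1)
      by (simp add: eval_nat_numeral, rule D.demop_braid6)
         (use c[of g h 3] c[of h g 1] g u 5 e in \<open>simp_all add: comp_assoc\<close>)
  next
    case 6
    have e: "snd g \<circ> (snd h \<circ> (snd g \<circ> (snd h \<circ> (snd g \<circ> snd h)))) = snd h \<circ> (snd g \<circ> (snd h \<circ> (snd g \<circ> (snd h \<circ> snd g))))" using alt_braid[OF g] 6 by (simp add: eval_nat_numeral comp_assoc)
    show ?thesis unfolding 6(1)
      by (simp add: eval_nat_numeral, rule E.demop_braid6[symmetric])
         (use c[of g h 1] c[of h g 3] g u 6 e in \<open>simp_all add: comp_assoc\<close>)
  qed simp
qed

lemma mul_y_braid:
  assumes g: "g \<in> G" "h \<in> G" "g \<noteq> h" and "supp_on_W X"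
  shows "fold mul_y (alt g h (mord g h)) X = fold mul_y (alt h g (mord g h)) X"
proof -
  have s: "set (alt g h (mord g h)) \<subseteq> G" "set (alt h g (mord g h)) \<subseteq> G" using alt_props(1) g by fastforce+
  show ?thesis by (rule supp_on_W_eqI) (use supp_on_W_fold s assms in \<open>auto simp: fold_dm[OF _ refl] dm_braid[OF g]\<close>)
qed

text \<open>Matsumoto's argument: reduced words with last letters \<open>g\<close> and
  \<open>h\<close> are both compared, by induction on the prefixes, with a fixed reduced word of
  \<open>v\<close> followed by an alternating word; a single braid relation joins the two.\<close>

theorem fold_mul_y_reduced:
  assumes "is_red G ws" "is_red G ws'" "word_prod ws = word_prod ws'" "supp_on_W X"
  shows "fold mul_y ws X = fold mul_y ws' X"
  using assms
proof (induction "length ws" arbitrary: ws ws' rule: less_induct)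
  case less
  have ll: "length ws' = length ws" using less.prems by (simp add: is_red_def)
  show ?case
  proof (cases ws rule: rev_exhaust)
    case Nil then show ?thesis using ll by simp
  next
    case (snoc us g)
    then obtain us' h where ws': "ws' = us' @ [h]" using ll by (cases ws' rule: rev_exhaust) auto
    have r: "is_red G us" "is_red G us'" using less.prems is_red_prefix snoc ws' by blast+
    have gh: "g \<in> G" "h \<in> G" using less.prems snoc ws' by (auto simp: is_red_def)
    define w where "w = word_prod ws"
    have wW: "w \<in> W" using less.prems by (auto simp: w_def is_red_def intro!: word_in_grp)
    have wg: "w \<circ> snd g = word_prod us" using snoc gh by (simp add: w_def comp_gen_gen)
    have wh: "w \<circ> snd h = word_prod us'" using ws' gh less.prems by (simp add: w_def comp_gen_gen)
    have lw: "ln w = length ws" using less.prems by (simp add: w_def is_red_def)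
    have l: "ln (w \<circ> snd g) < ln w" "ln (w \<circ> snd h) < ln w" 
      using lw r wg wh snoc ws' ll by (auto simp: is_red_def)
    show ?thesis
    proof (cases "g = h")
      case True
      then have "word_prod us = word_prod us'" using wg wh by simp
      then have "fold mul_y us X = fold mul_y us' X" using less.hyps[of us us'] r snoc less.prems by simp
      then show ?thesis using snoc ws' True by simp
    next
      case False
      obtain v where v: "v \<in> W" "w = v \<circ> word_prod (alt g h (mord g h))" "ln w = ln v + mord g h" "mord g h > 0"
        using two_descents[OF gh False wW l] .
      then obtain m where m: "mord g h = Suc m" by (cases "mord g h") auto
      have v2: "w = v \<circ> word_prod (alt h g (mord g h))" using v alt_braid[OF gh False] by simp
      note rv = redword[OF v(1)]
      \<comment> \<open>Used once for each last letter. Removing \<open>x\<close> leaves a shorter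
        reduced word, so the induction hypothesis applies.\<close>
      have one: "fold mul_y (xs @ [x]) X = fold mul_y (redword G v @ alt y x (Suc m)) X" 
        if "is_red G xs" "x \<in> G" "y \<in> G" "w = v \<circ> word_prod (alt y x (Suc m))" "w \<circ> snd x = word_prod xs" "length xs < length ws" for x y xs
      proof -
        have "word_prod (redword G v @ alt x y m) = w \<circ> snd x"
          using that rv comp_gen_gen[of x "v \<circ> word_prod (alt x y m)"] by (simp add: comp_assoc)
        moreover have "length (redword G v @ alt x y m) = length xs"
          using that v m rv alt_props[of x y m] lw ln_right_le[OF \<open>x \<in> G\<close> wW] ln_right_ge[OF \<open>x \<in> G\<close> wW]
          by (simp add: is_red_def)
        moreover have "set (redword G v @ alt x y m) \<subseteq> G" using rv alt_props(1)[of x y m] that by auto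
        ultimately have "is_red G (redword G v @ alt x y m)" using that by (simp add: is_red_def)
        then have "fold mul_y xs X = fold mul_y (redword G v @ alt x y m) X"
          using less.hyps[of xs "redword G v @ alt x y m"] that less.prems \<open>word_prod (redword G v @ alt x y m) = w \<circ> snd x\<close> by simp
        then show ?thesis by simp
      qed
      have "fold mul_y ws X = fold mul_y (redword G v @ alt h g (Suc m)) X"
        unfolding snoc by (rule one) (use r gh v2 wg snoc m in auto)
      also have "\<dots> = fold mul_y (redword G v @ alt g h (Suc m)) X"
        using mul_y_braid[OF gh False supp_on_W_fold[OF rv(1) less.prems(4)]] m by simp
      also have "\<dots> = fold mul_y ws' X"
        unfolding ws' by (rule one[symmetric]) (use r gh v wh ws' ll m in auto)
      finally show ?thesis .
    qed
  qed
qed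

end

section \<open>The nilHecke ring and its dual basis\<close>

definition dlt :: "wel \<Rightarrow> nh" where "dlt w u = (if u = w then 1 else 0)"

context refl_system begin


lemma supp_on_W_dlt: "w \<in> W \<Longrightarrow> supp_on_W (dlt w)" by (auto simp: supp_on_W_def dlt_def)

lemma y_word_dlt: "y_word ws = fold mul_y ws (dlt id)"
  by (simp add: y_word_def dlt_def[abs_def])

abbreviation yl :: "wel \<Rightarrow> nh" where "yl \<equiv> yel G"

lemma yl_red: "is_red G ws \<Longrightarrow> yl (word_prod ws) = fold mul_y ws (dlt id)"
  unfolding yel_def y_word_dlt
  by (rule fold_mul_y_reduced) (simp_all add: is_red_redword is_red_def redword word_in_grp supp_on_W_dlt)

lemma supp_on_W_yl: "w \<in> W \<Longrightarrow> supp_on_W (yl w)"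
  unfolding yel_def y_word_dlt by (rule supp_on_W_fold) (simp_all add: redword supp_on_W_dlt)

lemma yl_id: "yl id = dlt id"
  using yl_red[of "[]"] by (simp add: is_red_def)

lemma is_red_snoc: "g \<in> G \<Longrightarrow> w \<in> W \<Longrightarrow> ln w < ln (w \<circ> snd g) \<Longrightarrow> is_red G (redword G w @ [g])"
  using ln_right_le[of g w] by (simp add: is_red_def redword)

lemma mul_y_yl_longer: "g \<in> G \<Longrightarrow> w \<in> W \<Longrightarrow> ln w < ln (w \<circ> snd g) \<Longrightarrow> mul_y g (yl w) = yl (w \<circ> snd g)"
  using yl_red[OF is_red_snoc[of g w]] by (simp add: redword yel_def y_word_dlt)

lemma mul_y_idem:
  assumes "g \<in> G" "supp_on_W X" shows "mul_y g (mul_y g X) = mul_y g X"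
proof (rule supp_on_W_eqI)
  fix u assume u: "u \<in> W"
  then have ug: "u \<circ> snd g \<in> W" using assms by (simp add: W_gen_right)
  have "qf (ea g (u \<circ> snd g)) = 1 - qf (ea g u)" 
    using u assms by (simp only: ex_comp_self qf_inverse[OF ex_nz ex_gen_n1])
  then show "mul_y g (mul_y g X) u = mul_y g X u"
    using u ug assms by (simp add: mul_y_qf comp_gen_gen) (simp add: algebra_simps)
qed (use assms supp_on_W_mul_y in auto)

text \<open>With a right descent, y_w = y_v y_g for v = w s_g, and the second factor y_g is absorbed
  by idempotency.\<close>

lemma mul_y_yl_shorter:
  assumes "g \<in> G" "w \<in> W" "ln (w \<circ> snd g) < ln w" shows "mul_y g (yl w) = yl w"
proof -
  let ?v = "w \<circ> snd g"
  have v: "?v \<in> W" using assms by (simp add: W_gen_right)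
  have "mul_y g (yl ?v) = yl w" using mul_y_yl_longer[of g ?v] assms v by (simp add: comp_gen_gen)
  then show ?thesis using mul_y_idem[OF assms(1) supp_on_W_yl[OF v]] by simp
qed

lemma mul_y_yl:
  assumes "g \<in> G" "w \<in> W"
  obtains w' where "w' \<in> W" "mul_y g (yl w) = yl w'" "ln w \<le> ln w'"
proof (cases "ln w < ln (w \<circ> snd g)")
  case True then show ?thesis using that[of "w \<circ> snd g"] mul_y_yl_longer assms by (simp add: W_gen_right)
next
  case False then show ?thesis using that[of w] mul_y_yl_shorter[OF assms] ln_neq[OF assms] assms by simp
qed

lemma fold_mul_y_yl: "set ws \<subseteq> G \<Longrightarrow> w \<in> W \<Longrightarrow> \<exists>w'\<in>W. fold mul_y ws (yl w) = yl w' \<and> ln w \<le> ln w'"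
proof (induction ws arbitrary: w)
  case (Cons g ws)
  then obtain w1 where "w1 \<in> W" "mul_y g (yl w) = yl w1" "ln w \<le> ln w1" using mul_y_yl[of g w] by auto
  then show ?case using Cons.IH[of w1] Cons.prems by fastforce
qed auto

section \<open>Triangularity and linear independence of the y_w\<close>

lemma yl_support:
  assumes "w \<in> W"
  shows "(\<forall>u\<in>W. yl w u \<noteq> 0 \<longrightarrow> u = w \<or> ln u < ln w) \<and> yl w w \<noteq> 0"
  using assms
proof (induction "ln w" arbitrary: w rule: less_induct)
  case less
  show ?case
  proof (cases "w = id")
    case True then show ?thesis by (simp add: yl_id dlt_def)
  next
    case False
    then obtain g where g: "g \<in> G" "ln (w \<circ> snd g) < ln w" using W_exists_descent less by blast
    let ?v = "w \<circ> snd g"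
    have v: "?v \<in> W" using less g by (simp add: W_gen_right)
    note IH = less.hyps[OF g(2) v]
    have y: "yl w = mul_y g (yl ?v)" using mul_y_yl_longer[of g ?v] g v by (simp add: comp_gen_gen)
    have "u = w \<or> ln u < ln w" if u: "u \<in> W" and nz: "yl w u \<noteq> 0" for u
    proof -
      have ug: "u \<circ> snd g \<in> W" using u g by (simp add: W_gen_right)
      have "yl ?v u \<noteq> 0 \<or> yl ?v (u \<circ> snd g) \<noteq> 0" using nz u g by (auto simp: y mul_y_qf)
      then have "u = ?v \<or> ln u < ln ?v \<or> u \<circ> snd g = ?v \<or> ln (u \<circ> snd g) < ln ?v" using IH u ug by blast
      moreover have "u = w" if "u \<circ> snd g = ?v" using that comp_gen_gen[OF g(1)] by metis
      ultimately show ?thesis using g(2) ln_right_ge[OF g(1) u] by auto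
    qed
    \<comment> \<open>The shorter element contributes nothing at \<open>w\<close> itself, so the
      leading coefficient comes from the term shifted by \<open>snd g\<close> alone.\<close>
    moreover have "yl ?v w = 0" using IH g(2) less.prems by force
    then have "yl w w \<noteq> 0" using IH g less.prems qf_nz by (simp add: y mul_y_qf)
    ultimately show ?thesis by blast
  qed
qed

lemma yl_nz: "w \<in> W \<Longrightarrow> yl w u \<noteq> 0 \<Longrightarrow> u \<in> W \<and> (u = w \<or> ln u < ln w)"
  using yl_support supp_on_W_yl unfolding supp_on_W_def by blast

lemma finite_ln_le: "finite {w \<in> W. ln w \<le> k}"
proof -
  have "{w \<in> W. ln w \<le> k} \<subseteq> word_prod ` {ws. set ws \<subseteq> G \<and> length ws \<le> k}"
  proof
    fix w assume "w \<in> {w \<in> W. ln w \<le> k}"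
    then show "w \<in> word_prod ` {ws. set ws \<subseteq> G \<and> length ws \<le> k}"
      using redword[of w G] by (intro image_eqI[of _ _ "redword G w"]) simp_all
  qed
  then show ?thesis by (rule finite_surj[OF finite_lists_length_le[OF finite_G]])
qed

lemma finite_yl: "w \<in> W \<Longrightarrow> finite {u. yl w u \<noteq> 0}"
proof (rule finite_subset[OF _ finite_ln_le[of "ln w"]])
  assume w: "w \<in> W"
  show "{u. yl w u \<noteq> 0} \<subseteq> {v \<in> W. ln v \<le> ln w}"
  proof
    fix u assume "u \<in> {u. yl w u \<noteq> 0}"
    then show "u \<in> {v \<in> W. ln v \<le> ln w}" using yl_nz[OF w, of u] by auto
  qed
qed

text \<open>Evaluate at an element of greatest length among those with nonzero coefficient: by
  triangularity only its own term survives.\<close>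

lemma yl_indep:
  assumes S: "finite S" "S \<subseteq> W" and z: "\<And>u. u \<in> W \<Longrightarrow> (\<Sum>w\<in>S. c w * yl w u) = 0" and "v \<in> S"
  shows "c v = 0"
proof (rule ccontr)
  assume "c v \<noteq> 0"
  let ?T = "{w \<in> S. c w \<noteq> 0}"
  have T: "finite ?T" "?T \<noteq> {}" using S assms(4) \<open>c v \<noteq> 0\<close> by auto
  have "Max (ln ` ?T) \<in> ln ` ?T" using T by (intro Max_in) auto
  then obtain w where w: "w \<in> ?T" "ln w = Max (ln ` ?T)" by auto
  have mx: "ln w' \<le> ln w" if "w' \<in> ?T" for w' unfolding w(2) using T that by (intro Max_ge) auto
  have "(\<Sum>w'\<in>S. c w' * yl w' w) = (\<Sum>w'\<in>S. if w' = w then c w * yl w w else 0)"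
  proof (rule sum.cong[OF refl])
    fix w' assume w': "w' \<in> S"
    show "c w' * yl w' w = (if w' = w then c w * yl w w else 0)"
    proof (cases "w' = w \<or> c w' = 0")
      case False
      then have "ln w' \<le> ln w" using mx w' by simp
      then show ?thesis using yl_nz[of w' w] False w' S by auto
    qed auto
  qed
  also have "\<dots> = c w * yl w w" using w(1) S(1) by simp
  finally have "c w * yl w w = 0" using z[of w] w(1) S(2) by auto
  moreover have "yl w w \<noteq> 0" using w(1) S(2) yl_support[of w] by blast
  ultimately show False using w(1) by simp
qed

lemma yl_inj: "v \<in> W \<Longrightarrow> w \<in> W \<Longrightarrow> yl v = yl w \<Longrightarrow> v = w"
  using yl_support[of v] yl_support[of w] by (metis less_asym)

lemma mul_y_sum: "mul_y g (\<lambda>u. \<Sum>i\<in>S. c i * X i u) = (\<lambda>u. \<Sum>i\<in>S. c i * mul_y g (X i) u)"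
  unfolding mul_y_def sum_divide_distrib sum_subtractf[symmetric] sum.distrib[symmetric]
  by (intro ext sum.cong) (simp_all add: algebra_simps)
lemma fold_mul_y_sum: "fold mul_y ws (\<lambda>u. \<Sum>i\<in>S. c i * X i u) = (\<lambda>u. \<Sum>i\<in>S. c i * fold mul_y ws (X i) u)"
proof (induction ws arbitrary: X)
  case (Cons g ws)
  show ?case unfolding fold_simps mul_y_sum by (rule Cons.IH)
qed simp

text \<open>The left R(T)-module spanned by the y_w. A factor \<open>fr r\<close> independent of
  \<open>u\<close> is a scalar on the left, whereas a right factor e^x appears as
  \<open>ex u x\<close>.\<close>

inductive int_span :: "nh \<Rightarrow> bool" where
  int_span0: "int_span (\<lambda>u. 0)"
| int_spana: "w \<in> W \<Longrightarrow> r \<in> Rlat n \<Longrightarrow> int_span X \<Longrightarrow> int_span (\<lambda>u. fr r * yl w u + X u)"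

lemma int_span_yl: "w \<in> W \<Longrightarrow> int_span (yl w)"
  using int_spana[OF _ Rlat_1 int_span0, of w] by (simp add: fr_simps)

lemma int_span_add: "int_span X \<Longrightarrow> int_span Y \<Longrightarrow> int_span (\<lambda>u. X u + Y u)"
proof (induction rule: int_span.induct)
  case (int_spana w r X)
  show ?case using int_span.int_spana[OF int_spana(1,2) int_spana(4)[OF int_spana(5)]] by (simp only: add.assoc)
qed simp

lemma int_span_scale: 
  assumes "r \<in> Rlat n" "int_span X" shows "int_span (\<lambda>u. fr r * X u)"
  using assms(2)
proof (induction rule: int_span.induct)
  case (int_spana w r' X)
  show ?case using int_span.int_spana[OF int_spana(1) Rlat_mult[OF assms(1) int_spana(2)] int_spana(4)]
    by (simp only: fr_simps distrib_left mult.assoc)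
qed (simp add: int_span0)

lemma int_span_uminus: "int_span X \<Longrightarrow> int_span (\<lambda>u. - X u)"
  using int_span_scale[of "- 1" X] by (simp only: Rlat_uminus Rlat_1 fr_simps) simp

lemma int_span_sum: "(\<And>i. i \<in> S \<Longrightarrow> int_span (X i)) \<Longrightarrow> int_span (\<lambda>u. \<Sum>i\<in>S. X i u)"
proof (induction S rule: infinite_finite_induct)
  case (insert i S)
  have "int_span (\<lambda>u. X i u + (\<Sum>i\<in>S. X i u))" by (rule int_span_add) (use insert in auto)
  then show ?case using insert.hyps by simp
qed (simp_all add: int_span0)

text \<open>A product y_w y_g is again a single y_w', so no new coefficients arise.\<close>

lemma int_span_mul_y: 
  assumes "g \<in> G" "int_span X" shows "int_span (mul_y g X)"
  using assms(2)
proof (induction rule: int_span.induct)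
  case int_span0
  then show ?case by (simp add: mul_y_def int_span.int_span0)
next
  case (int_spana w r X)
  obtain w' where w': "w' \<in> W" "mul_y g (yl w) = yl w'" using mul_y_yl[OF assms(1) int_spana(1)] by blast
  have "mul_y g (\<lambda>u. fr r * yl w u + X u) = (\<lambda>u. fr r * mul_y g (yl w) u + mul_y g X u)"
    by (rule ext) (simp add: mul_y_def add_divide_distrib algebra_simps)
  then show ?case using int_span.int_spana[OF w'(1) int_spana(2) int_spana(4)] w'(2) by simp
qed

lemma int_span_N0: "int_span X \<Longrightarrow> supp_on_W X"
  by (induction rule: int_span.induct) (use supp_on_W_yl in \<open>auto simp: supp_on_W_def\<close>)

text \<open>Uses \<open>y\<^sub>i e\<^sup>x = e\<^bsup>s x\<^esup> y\<^sub>i + e\<^sup>\<alpha> (e\<^bsup>s x\<^esup> - e\<^sup>x) / (1 - e\<^sup>\<alpha>)\<close>, where the last term is a finite geometric sum.\<close>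

lemma int_span_yl_ex:
  assumes "w \<in> W" "latt_wt n x"
  shows "int_span (\<lambda>u. yl w u * ex u x)"
  using assms
proof (induction "ln w" arbitrary: w x rule: less_induct)
  case less
  show ?case
  proof (cases "w = id")
    case True
    have "(\<lambda>u. yl w u * ex u x) = (\<lambda>u. fr (Poly_Mapping.single x 1) * yl id u)"
      by (rule ext) (simp add: True yl_id dlt_def ex_fr wpart_def)
    then show ?thesis using int_span_scale[OF Rlat_single int_span_yl[of id]] less.prems by simp
  next
    case False
    then obtain g where g: "g \<in> G" "ln (w \<circ> snd g) < ln w" using W_exists_descent[OF less.prems(1)] by blast
    let ?v = "w \<circ> snd g"
    have v: "?v \<in> W" using less.prems(1) g by (simp add: W_gen_right)
    have y: "yl w = mul_y g (yl ?v)" using mul_y_yl_longer[of g ?v] g v by (simp add: comp_gen_gen)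
    define k where "k = cf g x"
    define x' where "x' = x - smul k (fst g)"
    have L: "latt_wt n x'" "latt_wt n (fst g)" using less.prems latt_gen g by (auto simp: x'_def latt_wt_closed)
    \<comment> \<open>The weight stays arbitrary in the induction, as the correction term involves
      exponentials of several weights.\<close>
    have IH: "int_span (\<lambda>u. yl ?v u * ex u z)" if "latt_wt n z" for z using less.hyps[OF g(2) v that] .
    define d where "d u = qf (ea g u) * (ex u x - ex u x')" for u
    have d: "int_span (\<lambda>u. yl ?v u * d u)"
    proof -
      have geo: "qf (ea g u) * (ex u z * ea g u ^ m - ex u z) = (\<Sum>j<m. ex u (z + smul (int (Suc j)) (fst g)))"
        if u: "u \<in> W" for u z m
      proof -
        have "(\<Sum>j<m. ex u (z + smul (int (Suc j)) (fst g))) = ex u z * ea g u * (\<Sum>j<m. ea g u ^ j)"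
          unfolding sum_distrib_left
          by (rule sum.cong) (use u in \<open>simp_all add: ex_add ex_smul mult_ac del: of_nat_Suc\<close>)
        moreover have "ea g u ^ m - 1 = (ea g u - 1) * (\<Sum>j<m. ea g u ^ j)" by (rule power_diff_1_eq)
        moreover have "ex u z * ea g u ^ m - ex u z = ex u z * (ea g u ^ m - 1)" by (simp add: algebra_simps)
        ultimately show ?thesis using ex_gen_n1[OF u g(1)] by (simp add: qf_def)
      qed
      have key: "int_span (\<lambda>u. yl ?v u * (qf (ea g u) * (ex u z * ea g u ^ m - ex u z)))" if "latt_wt n z" for z m
      proof -
        have "(\<lambda>u. yl ?v u * (qf (ea g u) * (ex u z * ea g u ^ m - ex u z))) = 
           (\<lambda>u. \<Sum>j<m. yl ?v u * ex u (z + smul (int (Suc j)) (fst g)))"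
        proof (rule ext)
          fix u show "yl ?v u * (qf (ea g u) * (ex u z * ea g u ^ m - ex u z)) = 
             (\<Sum>j<m. yl ?v u * ex u (z + smul (int (Suc j)) (fst g)))"
            using geo[of u z m] supp_on_W_yl[OF v] by (cases "u \<in> W") (simp_all add: supp_on_W_def sum_distrib_left del: of_nat_Suc)
        qed
        moreover have "int_span \<dots>" by (rule int_span_sum, rule IH) (use that L in \<open>simp add: latt_wt_closed del: of_nat_Suc\<close>)
        ultimately show ?thesis by simp
      qed
      show ?thesis
      \<comment> \<open>The geometric sum runs along the root string between \<open>x'\<close> and
        \<open>x\<close>, whose direction depends on the sign of \<open>k\<close>; the negative case
        only changes the overall sign.\<close>
      proof (cases k rule: int_cases2)
        case (nonneg m)
        have "x = x' + smul (int m) (fst g)" by (simp add: x'_def nonneg)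
        then have e: "ex u x = ex u x' * ea g u ^ m" if "u \<in> W" for u 
          using ex_add[OF that, of x' "smul (int m) (fst g)"] ex_smul[OF that] by simp
        have "yl ?v u * d u = yl ?v u * (qf (ea g u) * (ex u x' * ea g u ^ m - ex u x'))" for u
          using supp_on_W_yl[OF v] unfolding supp_on_W_def d_def by (cases "u \<in> W") (simp_all add: e)
        then show ?thesis using key[OF L(1), of m] by (simp only:)
      next
        case (nonpos m)
        have "x' = x + smul (int m) (fst g)" by (simp add: x'_def nonpos smul_minus_left)
        then have e: "ex u x' = ex u x * ea g u ^ m" if "u \<in> W" for u 
          using ex_add[OF that, of x "smul (int m) (fst g)"] ex_smul[OF that] by simp
        have "yl ?v u * d u = - (yl ?v u * (qf (ea g u) * (ex u x * ea g u ^ m - ex u x)))" for u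
          using supp_on_W_yl[OF v] unfolding supp_on_W_def d_def by (cases "u \<in> W") (simp_all add: e right_diff_distrib)
        then show ?thesis using int_span_uminus[OF key[OF less.prems(2), of m]] by (simp only:)
      qed
    qed
    have "(\<lambda>u. yl w u * ex u x) = (\<lambda>u. mul_y g (\<lambda>u. yl ?v u * ex u x') u + yl ?v u * d u)"
    proof (rule supp_on_W_eqI)
      show "supp_on_W (\<lambda>u. yl w u * ex u x)" using supp_on_W_yl[OF less.prems(1)] by (auto simp: supp_on_W_def)
      have N: "supp_on_W (\<lambda>u. yl ?v u * z u)" for z using supp_on_W_yl[OF v] by (simp add: supp_on_W_def)
      show "supp_on_W (\<lambda>u. mul_y g (\<lambda>u. yl ?v u * ex u x') u + yl ?v u * d u)"
        using supp_on_W_mul_y[OF g(1) N[of "\<lambda>u. ex u x'"]] N[of d] unfolding supp_on_W_def by simp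
      fix u assume u: "u \<in> W"
      have "x' - smul (cf g x') (fst g) = x" unfolding x'_def k_def using g
        by (intro poly_mapping_eqI) (simp add: lookup_minus cf_diff cf_smul cf_2)
      then have "ex (u \<circ> snd g) x' = ex u x" using u g by (simp only: ex_comp_gen)
      then show "yl w u * ex u x = mul_y g (\<lambda>u. yl ?v u * ex u x') u + yl ?v u * d u"
        using u g by (simp add: y mul_y_qf d_def algebra_simps)
    qed
    then show ?thesis using int_span_add[OF int_span_mul_y[OF g(1) IH[OF L(1)]] d] by simp
  qed
qed

lemma int_span_ex: "int_span X \<Longrightarrow> latt_wt n x \<Longrightarrow> int_span (\<lambda>u. X u * ex u x)"
proof (induction rule: int_span.induct)
  case (int_spana w r X)
  have "(\<lambda>u. (fr r * yl w u + X u) * ex u x) = (\<lambda>u. fr r * (yl w u * ex u x) + X u * ex u x)"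
    by (simp add: algebra_simps)
  then show ?case using int_span_add[OF int_span_scale[OF int_spana(2) int_span_yl_ex[OF int_spana(1,5)]] int_spana(4)[OF int_spana(5)]] by simp
qed (simp add: int_span0)

lemma int_span_right_gen:
  assumes "int_span X" "g \<in> G" shows "int_span (\<lambda>u. X (u \<circ> snd g))"
proof -
  have N: "supp_on_W X" using int_span_N0 assms by blast
  \<comment> \<open>\<open>?Y\<close> is X (1 - e^alpha). The scalar stands to the left of y_g, so
    it enters before \<open>mul_y\<close> and stability under right exponentials is needed.\<close>
  let ?Y = "\<lambda>u. X u + - (X u * ea g u)"
  have Y: "int_span ?Y" by (intro int_span_add int_span_uminus int_span_ex assms latt_gen)
  have "(\<lambda>u. X (u \<circ> snd g)) = (\<lambda>u. X u * ea g u + mul_y g ?Y u)"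
  proof (rule supp_on_W_eqI)
    show "supp_on_W (\<lambda>u. X (u \<circ> snd g))" using N assms by (simp add: supp_on_W_def W_gen_right)
    show "supp_on_W (\<lambda>u. X u * ea g u + mul_y g ?Y u)" 
      using N supp_on_W_mul_y[OF assms(2) int_span_N0[OF Y]] unfolding supp_on_W_def by simp
    fix u assume u: "u \<in> W"
    have "qf a * (x + - (x * a) + (z + - (z * inverse a))) = z - x * a" if "a \<noteq> 0" "a \<noteq> 1" for a x z :: "rt fract"
      using that by (simp add: qf_def field_simps)
    then show "X (u \<circ> snd g) = X u * ea g u + mul_y g ?Y u"
      using u assms ex_nz ex_gen_n1 by (simp add: mul_y_qf ex_comp_self)
  qed
  then show ?thesis using int_span_add[OF int_span_ex[OF assms(1) latt_gen[OF assms(2)]] int_span_mul_y[OF assms(2) Y]] by simp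
qed

lemma int_span_dlt: "u \<in> W \<Longrightarrow> int_span (dlt u)"
proof -
  have "set ws \<subseteq> G \<Longrightarrow> int_span (dlt (word_prod ws))" for ws
  proof (induction ws rule: rev_induct)
    case Nil
    show ?case using int_span_yl[of id] by (simp only: yl_id word_prod_simps grp_id)
  next
    case (snoc g ws)
    then have g: "g \<in> G" by simp
    have "v = word_prod ws \<circ> snd g \<longleftrightarrow> v \<circ> snd g = word_prod ws" for v
      using comp_gen_gen[OF g] by metis
    then have e: "dlt (word_prod (ws @ [g])) = (\<lambda>u. dlt (word_prod ws) (u \<circ> snd g))"
      by (intro ext) (simp add: dlt_def)
    have "int_span (dlt (word_prod ws))" using snoc by simp
    then show ?case unfolding e by (rule int_span_right_gen[OF _ g])
  qed
  then show "u \<in> W \<Longrightarrow> int_span (dlt u)" by (auto simp: grp_word)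
qed

section \<open>Normal forms and the dual basis\<close>

lemma int_span_normal:
  assumes "int_span X"
  shows "\<exists>c T. finite T \<and> T \<subseteq> W \<and> (\<forall>w. w \<notin> T \<longrightarrow> c w = 0) \<and> (\<forall>w. c w \<in> Rlat n) \<and> X = (\<lambda>u. \<Sum>w\<in>T. fr (c w) * yl w u)"
  using assms
proof (induction rule: int_span.induct)
  case int_span0
  then show ?case by (intro exI[of _ "\<lambda>_. 0"] exI[of _ "{}"]) (simp add: Rlat_0)
next
  case (int_spana w r X)
  then obtain c T where c: "finite T" "T \<subseteq> W" "\<forall>w. w \<notin> T \<longrightarrow> c w = 0" "\<forall>w. c w \<in> Rlat n" 
     "X = (\<lambda>u. \<Sum>w\<in>T. fr (c w) * yl w u)" by blast
  let ?T = "insert w T" and ?c = "c(w := c w + r)"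
  have "(\<Sum>v\<in>?T. fr (?c v) * yl v u) = fr r * yl w u + X u" for u
  proof -
    have 1: "X u = (\<Sum>v\<in>?T. fr (c v) * yl v u)"
    proof -
      have "(\<Sum>v\<in>T. fr (c v) * yl v u) = (\<Sum>v\<in>?T. fr (c v) * yl v u)"
        by (rule sum.mono_neutral_left) (use c(1-4) in \<open>auto simp: fr_simps\<close>)
      then show ?thesis by (subst c(5))
    qed
    have 2: "fr r * yl w u = (\<Sum>v\<in>?T. if v = w then fr r * yl w u else 0)"
      using c(1) by simp
    have "fr (?c v) * yl v u = (if v = w then fr r * yl w u else 0) + fr (c v) * yl v u" for v
      by (simp add: fr_simps distrib_right add.commute)
    then have "(\<Sum>v\<in>?T. fr (?c v) * yl v u) = (\<Sum>v\<in>?T. (if v = w then fr r * yl w u else 0) + fr (c v) * yl v u)"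
      by (intro sum.cong refl)
    then show ?thesis unfolding sum.distrib 1 using 2 by simp
  qed
  then have "(\<lambda>u. fr r * yl w u + X u) = (\<lambda>u. \<Sum>v\<in>?T. fr (?c v) * yl v u)" by (simp only:)
  moreover have "finite ?T" "?T \<subseteq> W" "\<forall>v. v \<notin> ?T \<longrightarrow> ?c v = 0" "\<forall>v. ?c v \<in> Rlat n"
    using c(1-4) int_spana(1,2) by (auto simp: Rlat_add)
  ultimately show ?case by (intro exI[of _ ?c] exI[of _ ?T] conjI)
qed

text \<open>Back substitution along the length: the pairing with y_v determines the value at
  \<open>v\<close> from values at shorter elements, since y_v has a nonzero coefficient at
  \<open>v\<close>.\<close>

lemma dual_unique:
  assumes "\<And>u. u \<notin> W \<Longrightarrow> \<psi> u = 0" "\<And>u. u \<notin> W \<Longrightarrow> \<psi>' u = 0"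
    and p: "\<And>v. v \<in> W \<Longrightarrow> pairing (yl v) \<psi> = pairing (yl v) \<psi>'"
  shows "\<psi> = \<psi>'"
proof -
  have "\<psi> v = \<psi>' v" if "v \<in> W" for v using that
  proof (induction "ln v" arbitrary: v rule: less_induct)
    case less
    let ?S = "{u. yl v u \<noteq> 0}"
    have v: "finite ?S" "v \<in> ?S" using finite_yl yl_support less by auto
    have "yl v u * fr (\<psi> u) = yl v u * fr (\<psi>' u)" if "u \<in> ?S - {v}" for u
      using less.hyps[of u] yl_nz[of v u] that less.prems by auto
    then have "(\<Sum>u\<in>?S - {v}. yl v u * fr (\<psi> u)) = (\<Sum>u\<in>?S - {v}. yl v u * fr (\<psi>' u))" by (rule sum.cong[OF refl])
    then have "yl v v * fr (\<psi> v) = yl v v * fr (\<psi>' v)"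
      using p[OF less.prems] v unfolding pairing_def by (simp add: sum.remove)
    then show ?case using v by simp
  qed
  then show ?thesis using assms(1,2) by (metis ext)
qed

text \<open>Expanding each group element in the y_w defines candidates. Expanding y_v in group
  elements and then back in the y_w shows that they are dual, and uniqueness identifies them with
  \<open>psibar\<close>.\<close>

lemma psibar_props:
  "\<exists>T. \<forall>u\<in>W. finite (T u) \<and> T u \<subseteq> W \<and> (\<forall>w\<in>W. w \<notin> T u \<longrightarrow> psibar n G w u = 0)
      \<and> dlt u = (\<lambda>x. \<Sum>w\<in>T u. fr (psibar n G w u) * yl w x)"
  and psibar_outside: "w \<in> W \<Longrightarrow> u \<notin> W \<Longrightarrow> psibar n G w u = 0"
proof -
  have "\<forall>u\<in>W. \<exists>cT. finite (snd cT) \<and> snd cT \<subseteq> W \<and> (\<forall>w. w \<notin> snd cT \<longrightarrow> fst cT w = 0) \<and> (\<forall>w. fst cT w \<in> Rlat n) 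
      \<and> dlt u = (\<lambda>x. \<Sum>w\<in>snd cT. fr (fst cT w) * yl w x)"
    using int_span_normal[OF int_span_dlt] by simp
  from bchoice[OF this] obtain f where f: "\<forall>u\<in>W. finite (snd (f u)) \<and> snd (f u) \<subseteq> W \<and> (\<forall>w. w \<notin> snd (f u) \<longrightarrow> fst (f u) w = 0) \<and> (\<forall>w. fst (f u) w \<in> Rlat n) 
      \<and> dlt u = (\<lambda>x. \<Sum>w\<in>snd (f u). fr (fst (f u) w) * yl w x)" by blast
  define psi where "psi w u = (if u \<in> W then fst (f u) w else 0)" for w u
  define T where "T u = snd (f u)" for u
  have T: "finite (T u)" "T u \<subseteq> W" "\<And>w. w \<notin> T u \<Longrightarrow> psi w u = 0" "\<And>w. psi w u \<in> Rlat n"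
     "dlt u = (\<lambda>x. \<Sum>w\<in>T u. fr (psi w u) * yl w x)" if "u \<in> W" for u
    using f that by (simp_all add: psi_def T_def)
  have dual: "pairing (yl v) (psi w) = (if v = w then 1 else 0)" if v: "v \<in> W" and w: "w \<in> W" for v w
  proof -
    let ?S = "{u. yl v u \<noteq> 0}"
    have S: "finite ?S" "?S \<subseteq> W" using finite_yl[OF v] yl_nz[OF v] by auto
    \<comment> \<open>\<open>v\<close> and \<open>w\<close> are added so that the pairings and the
      Kronecker delta are compared over one finite index set.\<close>
    let ?U = "(\<Union>u\<in>?S. T u) \<union> {v,w}"
    have U: "finite ?U" "?U \<subseteq> W" using S T v w by auto
    have exp: "yl v x = (\<Sum>w'\<in>?U. pairing (yl v) (psi w') * yl w' x)" for x
    proof -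
      have "yl v x = (\<Sum>u\<in>?S. yl v u * dlt u x)"
        using S by (simp add: dlt_def if_distrib[of "\<lambda>z. _ * z"] cong: if_cong)
      also have "\<dots> = (\<Sum>u\<in>?S. yl v u * (\<Sum>w'\<in>?U. fr (psi w' u) * yl w' x))"
      proof (rule sum.cong[OF refl])
        fix u assume u: "u \<in> ?S"
        then have uW: "u \<in> W" using S by auto
        have "dlt u x = (\<Sum>w'\<in>T u. fr (psi w' u) * yl w' x)" using T(5)[OF uW] by simp
        also have "\<dots> = (\<Sum>w'\<in>?U. fr (psi w' u) * yl w' x)"
          by (rule sum.mono_neutral_left) (use u U T(3)[OF uW] in \<open>auto simp: fr_simps\<close>)
        finally show "yl v u * dlt u x = yl v u * (\<Sum>w'\<in>?U. fr (psi w' u) * yl w' x)" by simp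
      qed
      also have "\<dots> = (\<Sum>w'\<in>?U. \<Sum>u\<in>?S. yl v u * fr (psi w' u) * yl w' x)"
        unfolding sum_distrib_left by (subst sum.swap) (simp add: mult.assoc)
      finally show ?thesis by (simp add: pairing_def sum_distrib_right)
    qed
    have "pairing (yl v) (psi w) - (if w = v then 1 else 0) = 0"
    proof (rule yl_indep[OF U, where c = "\<lambda>w'. pairing (yl v) (psi w') - (if w' = v then 1 else 0)"])
      show "w \<in> ?U" by simp
      fix u
      have "(\<Sum>w'\<in>?U. (if w' = v then 1 else 0) * yl w' u) = (\<Sum>w'\<in>?U. if w' = v then yl v u else 0)"
        by (rule sum.cong) auto
      also have "\<dots> = yl v u" using U by simp
      finally show "(\<Sum>w'\<in>?U. (pairing (yl v) (psi w') - (if w' = v then 1 else 0)) * yl w' u) = 0"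
        unfolding left_diff_distrib sum_subtractf using exp[of u] by simp
    qed
    then show ?thesis by (auto split: if_splits)
  qed
  have eq: "psibar n G w = psi w" if w: "w \<in> W" for w
    unfolding psibar_def
  proof (rule the_equality)
    show "(\<forall>u. u \<notin> W \<longrightarrow> psi w u = 0) \<and> (\<forall>u. psi w u \<in> Rlat n) \<and> (\<forall>v\<in>W. pairing (yl v) (psi w) = (if v = w then 1 else 0))"
      using dual w T(4) by (auto simp: psi_def Rlat_0)
    show "\<psi> = psi w" if "(\<forall>u. u \<notin> W \<longrightarrow> \<psi> u = 0) \<and> (\<forall>u. \<psi> u \<in> Rlat n) \<and> (\<forall>v\<in>W. pairing (yl v) \<psi> = (if v = w then 1 else 0))" for \<psi>
      by (rule dual_unique) (use that dual w in \<open>auto simp: psi_def\<close>)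
  qed
  show "\<exists>T. \<forall>u\<in>W. finite (T u) \<and> T u \<subseteq> W \<and> (\<forall>w\<in>W. w \<notin> T u \<longrightarrow> psibar n G w u = 0)
      \<and> dlt u = (\<lambda>x. \<Sum>w\<in>T u. fr (psibar n G w u) * yl w x)"
  proof (intro exI[of _ T] ballI conjI)
    fix u assume u: "u \<in> W"
    have "(\<lambda>x. \<Sum>w\<in>T u. fr (psibar n G w u) * yl w x) = (\<lambda>x. \<Sum>w\<in>T u. fr (psi w u) * yl w x)"
      using eq T(2)[OF u] by (intro ext sum.cong) auto
    then show "dlt u = (\<lambda>x. \<Sum>w\<in>T u. fr (psibar n G w u) * yl w x)" using T(5)[OF u] by simp
  qed (use T eq in auto)
  show "psibar n G w u = 0" if "w \<in> W" "u \<notin> W" using that by (simp add: eq psi_def)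
qed

lemma psibar_expand:
  assumes "u \<in> W"
  obtains T where "finite T" "T \<subseteq> W" "\<forall>w\<in>W. w \<notin> T \<longrightarrow> psibar n G w u = 0"
    "\<forall>x. dlt u x = (\<Sum>w\<in>T. fr (psibar n G w u) * yl w x)"
proof -
  obtain T where "\<forall>u\<in>W. finite (T u) \<and> T u \<subseteq> W \<and> (\<forall>w\<in>W. w \<notin> T u \<longrightarrow> psibar n G w u = 0)
      \<and> dlt u = (\<lambda>x. \<Sum>w\<in>T u. fr (psibar n G w u) * yl w x)"
    by (rule exE[OF psibar_props])
  from bspec[OF this assms] have T: "finite (T u)" "T u \<subseteq> W" "\<forall>w\<in>W. w \<notin> T u \<longrightarrow> psibar n G w u = 0"
    "dlt u = (\<lambda>x. \<Sum>w\<in>T u. fr (psibar n G w u) * yl w x)" by blast+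
  show thesis
    by (rule that[OF T(1,2,3)]) (use fun_cong[OF T(4)] in simp)
qed

text \<open>By linear independence over the fraction field, any finite expansion of \<open>u\<close>
  in the y_w may be used to read off the values at \<open>u\<close>.\<close>

lemma psibar_coeff:
  assumes "u \<in> W" "finite S" "S \<subseteq> W" "\<And>x. x \<in> W \<Longrightarrow> dlt u x = (\<Sum>w\<in>S. c w * yl w x)" "w \<in> W"
    and "w \<notin> S \<Longrightarrow> c w = 0"
  shows "fr (psibar n G w u) = c w"
proof -
  obtain T where T: "finite T" "T \<subseteq> W" "\<forall>w\<in>W. w \<notin> T \<longrightarrow> psibar n G w u = 0"
    "\<forall>x. dlt u x = (\<Sum>w\<in>T. fr (psibar n G w u) * yl w x)" using psibar_expand[OF assms(1)] .
  let ?c = "\<lambda>w. if w \<in> S then c w else 0"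
  have "fr (psibar n G w u) - ?c w = 0"
  proof (rule yl_indep[where c = "\<lambda>w. fr (psibar n G w u) - ?c w" and S = "insert w (S \<union> T)"])
    fix x assume x: "x \<in> W"
    have "(\<Sum>w\<in>insert w (S \<union> T). fr (psibar n G w u) * yl w x) = (\<Sum>w\<in>T. fr (psibar n G w u) * yl w x)"
      by (rule sum.mono_neutral_right) (use T assms in \<open>auto simp: fr_simps\<close>)
    moreover have "(\<Sum>w\<in>insert w (S \<union> T). ?c w * yl w x) = (\<Sum>w\<in>S. ?c w * yl w x)"
      by (rule sum.mono_neutral_right) (use T assms in auto)
    moreover have "\<dots> = (\<Sum>w\<in>S. c w * yl w x)" by (rule sum.cong) auto
    ultimately show "(\<Sum>w\<in>insert w (S \<union> T). (fr (psibar n G w u) - ?c w) * yl w x) = 0"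
      unfolding left_diff_distrib sum_subtractf using spec[OF T(4), of x] assms(4)[OF x] by simp
  qed (use assms T in auto)
  then show ?thesis using assms(6) by (auto split: if_splits)
qed

section \<open>The Demazure product and products of the y_w\<close>

lemma ln_left_neq:
  assumes g: "g \<in> G" and v: "v \<in> W" shows "ln (snd g \<circ> v) \<noteq> ln v"
proof -
  obtain v' where v': "v' \<in> W" "v' \<circ> v = id" "v \<circ> v' = id" "ln v' \<le> ln v" using W_inverse[OF v] .
  \<comment> \<open>An element and its inverse have the same length, so a left factor can be traded
    for a right factor of the inverse.\<close>
  have inv_eq: "ln a = ln b" if ab: "a \<in> W" "b \<in> W" "a \<circ> b = id" for a b
  proof -
    have *: "ln b \<le> ln a" if ab: "a \<in> W" "b \<in> W" "a \<circ> b = id" for a b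
    proof -
      obtain c where c: "c \<in> W" "c \<circ> a = id" "a \<circ> c = id" "ln c \<le> ln a" using W_inverse[OF ab(1)] .
      have "c = b" using c ab by (metis comp_assoc comp_id id_comp)
      then show ?thesis using c by simp
    qed
    obtain c where c: "c \<in> W" "c \<circ> a = id" "a \<circ> c = id" using W_inverse[OF ab(1)] .
    have "c = b" using c ab by (metis comp_assoc comp_id id_comp)
    then show ?thesis using *[OF ab] *[of b a] ab c by force
  qed
  have "(snd g \<circ> v) \<circ> (v' \<circ> snd g) = snd g \<circ> ((v \<circ> v') \<circ> snd g)" by (simp add: comp_assoc)
  also have "\<dots> = id" using v' gen_invol[OF g] by (simp only: id_comp)
  finally have "ln (snd g \<circ> v) = ln (v' \<circ> snd g)"
    using inv_eq[of "snd g \<circ> v" "v' \<circ> snd g"] g v v' by (simp only: grp_comp grp_gen)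
  moreover have "ln v = ln v'" using inv_eq[OF v v'(1,3)] .
  ultimately show ?thesis using ln_neq[OF g v'(1)] by simp
qed

text \<open>Right multiplication by y_w on an arbitrary element, whereas \<open>y_word\<close>
  starts from the identity.\<close>

definition yop :: "wel \<Rightarrow> nh \<Rightarrow> nh" where "yop w = fold mul_y (redword G w)"

lemma yop_cons:
  assumes "g \<in> G" "v \<in> W" "ln v < ln (snd g \<circ> v)" "supp_on_W X"
  shows "yop (snd g \<circ> v) X = yop v (mul_y g X)"
proof -
  have gv: "snd g \<circ> v \<in> W" using assms grp_comp grp_gen by blast
  have "length (g # redword G v) = ln (snd g \<circ> v)"
    using assms len_comp[of "snd g" G v] ln_gen[of g] grp_gen[of g G] redword[OF assms(2)] by simp
  then have r: "is_red G (g # redword G v)" using assms redword[OF assms(2)] by (simp add: is_red_def)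
  have "fold mul_y (redword G (snd g \<circ> v)) X = fold mul_y (g # redword G v) X"
    by (rule fold_mul_y_reduced) (use r is_red_redword[OF gv] redword gv assms in auto)
  then show ?thesis by (simp add: yop_def)
qed

text \<open>The two branches of a Demazure step: if \<open>g\<close> lengthens v on the left, then
  y_g y_v = y_gv; otherwise y_v begins with y_g and absorbs another one by idempotency.\<close>

lemma yop_dem_aux:
  assumes "set ws \<subseteq> G" "v \<in> W"
  defines "f \<equiv> \<lambda>g v. if ln (snd g \<circ> v) > ln v then snd g \<circ> v else v"
  shows "foldr f ws v \<in> W \<and> (\<forall>X. supp_on_W X \<longrightarrow> yop (foldr f ws v) X = yop v (fold mul_y ws X))"
  using assms(1)
proof (induction ws)
  case Nil then show ?case using assms by simp
next
  case (Cons g ws)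
  let ?v = "foldr f ws v"
  have g: "g \<in> G" and v: "?v \<in> W" and IH: "\<And>X. supp_on_W X \<Longrightarrow> yop ?v X = yop v (fold mul_y ws X)" using Cons by auto
  have gv: "snd g \<circ> ?v \<in> W" using g v grp_comp grp_gen by blast
  have "yop (f g ?v) X = yop ?v (mul_y g X)" if X: "supp_on_W X" for X
  proof (cases "ln (snd g \<circ> ?v) > ln ?v")
    case True then show ?thesis using yop_cons g v X by (simp add: f_def)
  next
    case False
    then have "ln (snd g \<circ> ?v) < ln ?v" using ln_left_neq[OF g v] by simp
    then have *: "yop ?v Y = yop (snd g \<circ> ?v) (mul_y g Y)" if "supp_on_W Y" for Y
      using yop_cons[OF g gv _ that] by (simp add: gen_gen_comp[OF g])
    show ?thesis using *[OF X] *[OF supp_on_W_mul_y[OF g X]] mul_y_idem[OF g X] False by (simp add: f_def)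
  qed
  moreover have "f g ?v \<in> W" using v gv by (simp add: f_def)
  ultimately show ?case using IH supp_on_W_mul_y[OF g] by simp
qed

text \<open>In ring notation the second part reads y_w y_v = y_(w*v).\<close>

lemma dem_W: "w \<in> W \<Longrightarrow> v \<in> W \<Longrightarrow> dem G w v \<in> W"
  and yop_dem: "w \<in> W \<Longrightarrow> v \<in> W \<Longrightarrow> yop v (yl w) = yl (dem G w v)"
  using yop_dem_aux[of "redword G w" v] supp_on_W_dlt[of id] by (simp_all add: dem_def redword yel_def y_word_dlt yop_def)

text \<open>Right multiplication of y_w by further generators never shortens its index, and y_w
  determines w.\<close>

lemma dem_len: "w \<in> W \<Longrightarrow> v \<in> W \<Longrightarrow> ln w \<le> ln (dem G w v)"
  using fold_mul_y_yl[of "redword G v" w] yop_dem[of w v] yl_inj dem_W[of w v] by (metis redword(1) yop_def)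

end

section \<open>Finite root systems and their affine extension\<close>

locale cartan =
  fixes n :: nat and A :: "nat \<Rightarrow> nat \<Rightarrow> int"
  assumes gcm: "is_gcm n A" and finW: "finite (Wfin n A)"
begin

abbreviation \<alpha> :: "nat \<Rightarrow> wt" where "\<alpha> \<equiv> sroot n A"
abbreviation lk :: "wt \<Rightarrow> nat \<Rightarrow> int" where "lk \<equiv> Poly_Mapping.lookup"
abbreviation cp :: "wt \<Rightarrow> wt \<Rightarrow> int" where "cp \<equiv> coroot_pair n A"
abbreviation FG :: "gen set" where "FG \<equiv> fin_gens n A"
abbreviation AG :: "gen set" where "AG \<equiv> aff_gens n A"
abbreviation R :: "wt set" where "R \<equiv> roots n A"

lemma lookup_sroot: "lk (\<alpha> j) i = (if i < n then A i j else 0)"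
  unfolding sroot_def by (subst lookup_Abs_poly_mapping) (auto intro: finite_subset[of _ "{..<n}"])

lemma sroot_latt: "latt_wt n (\<alpha> j)" by (simp add: latt_wt_def lookup_sroot)

lemma fin_refl_apply: "fin_refl n A i (\<mu>, m) = (\<mu> - smul (lk \<mu> i) (\<alpha> i), m)"
  by (simp add: fin_refl_def arefl_def)

lemma sroot_diag: "i < n \<Longrightarrow> lk (\<alpha> i) i = 2"
  using gcm by (simp add: lookup_sroot is_gcm_def)

text \<open>The i-th fundamental weight is moved by the i-th reflection and fixed by all other
  simple ones. This is what lets \<open>idx\<close> recover the index from a generator.\<close>

lemma gen_index_inj:
  assumes "i < n" "(\<alpha> i, fin_refl n A i) = (\<alpha> j, fin_refl n A j)" shows "i = j"
proof (rule ccontr)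
  assume ne: "i \<noteq> j"
  let ?e = "Poly_Mapping.single i 1 :: wt"
  have "fin_refl n A i (?e, 0) = fin_refl n A j (?e, 0)" using assms by simp
  then have "?e - \<alpha> i = ?e" using ne by (simp add: fin_refl_apply lookup_single when_def)
  then have "lk (?e - \<alpha> i) i = lk ?e i" by (rule arg_cong)
  then show False using sroot_diag[OF assms(1)] by (simp add: lookup_minus)
qed

definition idx :: "gen \<Rightarrow> nat" where "idx g = (THE i. i < n \<and> g = (\<alpha> i, fin_refl n A i))"

lemma idx: "i < n \<Longrightarrow> idx (\<alpha> i, fin_refl n A i) = i"
  unfolding idx_def by (rule the_equality) (use gen_index_inj in auto)

text \<open>The coroot functional is recovered from the generator: a finite one gives the coordinate
  at its index, an affine one carries -theta, whose coroot is the negative of that of theta.\<close>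

definition cfa :: "gen \<Rightarrow> wt \<Rightarrow> int" where
  "cfa g \<mu> = (if g \<in> FG then lk \<mu> (idx g) else - cp (- fst g) \<mu>)"
definition leva :: "gen \<Rightarrow> int" where "leva g = (if g \<in> FG then 0 else 1)"

lemma FG_iff: "g \<in> FG \<longleftrightarrow> (\<exists>i<n. g = (\<alpha> i, fin_refl n A i))"
  by (auto simp: fin_gens_def)

lemma FG_cf: "i < n \<Longrightarrow> cfa (\<alpha> i, fin_refl n A i) \<mu> = lk \<mu> i"
  by (auto simp: cfa_def idx FG_iff)
lemma FG_lev: "g \<in> FG \<Longrightarrow> leva g = 0" by (simp add: leva_def)

lemma FG_form: "g \<in> FG \<Longrightarrow> snd g = arefl (cfa g) (fst g) (leva g)"
  using FG_lev[of g] unfolding FG_iff by (auto simp: fun_eq_iff fin_refl_apply arefl_def FG_cf)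

lemma Wfin_grp: "Wfin n A = grp FG"
proof -
  have "snd ` FG = fin_refl n A ` {..<n}" by (auto simp: fin_gens_def image_iff)
  then show ?thesis by (simp add: Wfin_def grp_def)
qed

sublocale F0: refl_group FG cfa leva
  by unfold_locales (auto simp: FG_form, auto simp: FG_iff FG_cf lookup_add sroot_diag)

abbreviation W0 :: "wel set" where "W0 \<equiv> grp FG"

lemma finW0: "finite W0" using finW by (simp add: Wfin_grp)

lemma W0_apply: "v \<in> W0 \<Longrightarrow> v (\<mu>, m) = (wpart v \<mu>, m)"
proof (induction rule: F0.W_induct)
  case id then show ?case by (simp add: wpart_def)
next
  case (step g u)
  have "wpart (snd g \<circ> u) \<mu> = wpart u \<mu> - smul (cfa g (wpart u \<mu>)) (fst g)"
    using step(1) by (simp only: F0.wpart_comp[OF grp_gen] F0.wpart_gen)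
  moreover have "snd g (wpart u \<mu>, m) = (wpart u \<mu> - smul (cfa g (wpart u \<mu>)) (fst g), m)"
    using FG_lev[OF step(1)] F0.refl_apply[OF step(1)] by simp
  moreover have "(snd g \<circ> u) (\<mu>, m) = snd g (u (\<mu>, m))" by (rule comp_apply)
  ultimately show ?case using step(3) by metis
qed

lemma W0_gen: "i < n \<Longrightarrow> fin_refl n A i \<in> W0"
  using grp_gen[of "(\<alpha> i, fin_refl n A i)" FG] by (auto simp: FG_iff)

lemma wpart_fin_refl: "wpart (fin_refl n A i) \<mu> = \<mu> - smul (lk \<mu> i) (\<alpha> i)"
  by (simp add: wpart_def fin_refl_apply)

lemma W0_inverse:
  assumes "v \<in> W0"
  obtains v' where "v' \<in> W0" "v' \<circ> v = id" "v \<circ> v' = id"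
    "\<And>\<mu>. wpart v' (wpart v \<mu>) = \<mu>" "\<And>\<mu>. wpart v (wpart v' \<mu>) = \<mu>"
proof -
  obtain v' where v': "v' \<in> W0" "v' \<circ> v = id" "v \<circ> v' = id" using F0.W_inverse[OF assms] by blast
  have "wpart v' (wpart v \<mu>) = \<mu>" "wpart v (wpart v' \<mu>) = \<mu>" for \<mu>
    using F0.wpart_comp[OF v'(1), of v \<mu>] F0.wpart_comp[OF assms, of v' \<mu>] v' by (simp_all add: wpart_def)
  then show thesis using that v' by blast
qed

text \<open>
  Averaging over the finite group gives an invariant form, definite on weights supported below \<open>n\<close>;
  it replaces any appeal to the classification of Cartan matrices.
\<close>

definition B :: "wt \<Rightarrow> wt \<Rightarrow> int" where
  "B x y = (\<Sum>v\<in>W0. \<Sum>i<n. lk (wpart v x) i * lk (wpart v y) i)"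

lemma B_sym: "B x y = B y x" by (simp add: B_def mult.commute)

lemma B_add: "B (x + y) z = B x z + B y z"
  by (simp add: B_def F0.wpart_add lookup_add distrib_right sum.distrib)

lemma B_smul: "B (smul c x) z = c * B x z"
  using additive_smul_int[of "\<lambda>x. B x z"] B_add by blast
lemma B_minus: "B (- x) z = - B x z" using B_smul[of "-1" x z] by simp
lemma B_diff: "B (x - y) z = B x z - B y z" using B_add[of x "- y" z] B_minus by simp
lemma B_zero: "B 0 z = 0" using B_smul[of 0 0 z] by simp
lemma B_add': "B z (x + y) = B z x + B z y" by (metis B_add B_sym)
lemma B_smul': "B z (smul c x) = c * B z x" by (metis B_smul B_sym)
lemma B_minus': "B z (- x) = - B z x" by (metis B_minus B_sym)
lemma B_diff': "B z (x - y) = B z x - B z y" by (metis B_diff B_sym)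
lemmas B_lin = B_add B_smul B_minus B_diff B_add' B_smul' B_minus' B_diff'

lemma B_sum: "B (\<Sum>i\<in>S. f i) z = (\<Sum>i\<in>S. B (f i) z)"
  by (induction S rule: infinite_finite_induct) (simp_all add: B_zero B_add)

lemma B_inv: 
  assumes "u \<in> W0" shows "B (wpart u x) (wpart u y) = B x y"
proof -
  obtain u' where u': "u' \<in> W0" "u' \<circ> u = id" "u \<circ> u' = id" using W0_inverse[OF assms] by blast
  have "B (wpart u x) (wpart u y) = (\<Sum>v\<in>W0. \<Sum>i<n. lk (wpart (v \<circ> u) x) i * lk (wpart (v \<circ> u) y) i)"
    unfolding B_def by (rule sum.cong) (simp_all add: F0.wpart_comp)
  also have "\<dots> = B x y" unfolding B_def
    by (rule sum.reindex_bij_witness[of _ "\<lambda>v. v \<circ> u'" "\<lambda>v. v \<circ> u"])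
       (use u' assms in \<open>auto simp: comp_assoc grp_comp\<close>)
  finally show ?thesis .
qed

lemma B_nonneg: "0 \<le> B x x" by (simp add: B_def sum_nonneg)

text \<open>The summand of the identity is already the sum of squares of the coordinates below
  \<open>n\<close>.\<close>

lemma B_eq_0:
  assumes "B x x = 0" "latt_wt n x" shows "x = 0"
proof -
  have "(\<Sum>i<n. lk (wpart id x) i * lk (wpart id x) i) = 0"
    using assms(1) finW0 unfolding B_def by (subst (asm) sum_nonneg_eq_0_iff) (auto simp: sum_nonneg)
  then have "\<forall>i<n. lk x i = 0" by (subst (asm) sum_nonneg_eq_0_iff) (auto simp: wpart_def)
  then show ?thesis using assms(2) by (intro poly_mapping_eqI) (metis latt_wt_def lookup_zero not_le)
qed

lemma B_pos: "latt_wt n x \<Longrightarrow> x \<noteq> 0 \<Longrightarrow> 0 < B x x"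
  using B_nonneg[of x] B_eq_0[of x] by fastforce

text \<open>Invariance under the i-th reflection, which negates its root, expresses the coroot
  pairing through \<open>B\<close>.\<close>

lemma B_sroot: "i < n \<Longrightarrow> 2 * B (\<alpha> i) x = lk x i * B (\<alpha> i) (\<alpha> i)"
proof -
  assume i: "i < n"
  have "B (\<alpha> i - smul 2 (\<alpha> i)) (x - smul (lk x i) (\<alpha> i)) = B (\<alpha> i) x"
    using B_inv[OF W0_gen[OF i], of "\<alpha> i" x] i by (simp only: wpart_fin_refl sroot_diag)
  then show ?thesis by (simp add: B_lin)
qed

lemma sroot_nz: "i < n \<Longrightarrow> \<alpha> i \<noteq> 0" using sroot_diag by fastforce
lemma B_sroot_pos: "i < n \<Longrightarrow> 0 < B (\<alpha> i) (\<alpha> i)"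
  using B_pos sroot_latt sroot_nz by blast

text \<open>Pair the relation with the j-th fundamental weight, which is orthogonal to every simple
  root except the j-th.\<close>

lemma sroot_indep:
  assumes "(\<Sum>i<n. smul (c i) (\<alpha> i)) = 0" "j < n" shows "c j = 0"
proof -
  let ?e = "Poly_Mapping.single j 1 :: wt"
  have "2 * B (smul (c i) (\<alpha> i)) ?e = (if i = j then c j * B (\<alpha> j) (\<alpha> j) else 0)" if "i < n" for i
    using B_sroot[OF that, of ?e] by (auto simp: B_smul lookup_single when_def)
  then have "(\<Sum>i<n. 2 * B (smul (c i) (\<alpha> i)) ?e) = (\<Sum>i<n. if i = j then c j * B (\<alpha> j) (\<alpha> j) else 0)"
    by (intro sum.cong) auto
  moreover have "(\<Sum>i<n. 2 * B (smul (c i) (\<alpha> i)) ?e) = 0"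
    using B_sum[of "\<lambda>i. smul (c i) (\<alpha> i)" "{..<n}" ?e] assms(1) by (simp add: B_zero flip: sum_distrib_left)
  ultimately show ?thesis using assms(2) B_sroot_pos[OF assms(2)] by simp
qed

lemma sroot_indep2:
  assumes "(\<Sum>i<n. smul (c i) (\<alpha> i)) = (\<Sum>i<n. smul (d i) (\<alpha> i))" "j < n" shows "c j = d j"
  using sroot_indep[of "\<lambda>i. c i - d i" j] assms by (simp add: smul_diff_left sum_subtractf)

text \<open>The squared norm of the component of \<open>x\<close> orthogonal to \<open>y\<close>,
  cleared of denominators: it gives Cauchy-Schwarz and its equality case over the integers.\<close>

lemma B_residual: "B (smul (B y y) x - smul (B x y) y) (smul (B y y) x - smul (B x y) y) = B y y * (B x x * B y y - B x y * B x y)"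
  by (simp add: B_lin B_sym[of y x] algebra_simps)

lemma Cauchy_Schwarz: "0 < B y y \<Longrightarrow> B x y * B x y \<le> B x x * B y y"
  using B_nonneg[of "smul (B y y) x - smul (B x y) y"] unfolding B_residual by (simp add: zero_le_mult_iff)

lemma Cauchy_Schwarz_eq:
  assumes "B x y * B x y = B x x * B y y" "latt_wt n x" "latt_wt n y" shows "smul (B y y) x = smul (B x y) y"
proof -
  have "smul (B y y) x - smul (B x y) y = 0"
    by (rule B_eq_0) (use assms B_residual[of y x] in \<open>simp_all add: latt_wt_closed\<close>)
  then show ?thesis by simp
qed

text \<open>\<open>p\<close> and \<open>q\<close> are the two Cartan integers, and their product is
  four times the squared cosine of the angle.\<close>

lemma pair_bound:
  assumes pq: "p * B x x = 2 * B x y" "q * B y y = 2 * B x y" and pos: "0 < B x x" "0 < B y y"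
  shows "p * q \<le> 4" "p * q = 4 \<Longrightarrow> B x y * B x y = B x x * B y y" "p < 0 \<longleftrightarrow> B x y < 0" "q < 0 \<longleftrightarrow> B x y < 0" "p = 0 \<longleftrightarrow> B x y = 0"  "q = 0 \<longleftrightarrow> B x y = 0"
proof -
  have e: "(p * q) * (B x x * B y y) = 4 * (B x y * B x y)"
  proof -
    have "(p * q) * (B x x * B y y) = (p * B x x) * (q * B y y)" by (simp add: mult_ac)
    then show ?thesis unfolding pq by simp
  qed
  have m: "0 < B x x * B y y" using pos by simp
  have "(p * q) * (B x x * B y y) \<le> 4 * (B x x * B y y)" using e Cauchy_Schwarz[OF pos(2), of x] by linarith
  then show "p * q \<le> 4" using m by (simp add: mult_le_cancel_right)
  show "p * q = 4 \<Longrightarrow> B x y * B x y = B x x * B y y" using e by simp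
  show "p < 0 \<longleftrightarrow> B x y < 0" using pq(1) pos(1) by (smt (verit) mult_less_0_iff zero_le_mult_iff)
  show "q < 0 \<longleftrightarrow> B x y < 0" using pq(2) pos(2) by (smt (verit) mult_less_0_iff zero_le_mult_iff)
  show "p = 0 \<longleftrightarrow> B x y = 0" using pq(1) pos(1) by auto
  show "q = 0 \<longleftrightarrow> B x y = 0" using pq(2) pos(2) by auto
qed

section \<open>The positive cone\<close>

definition nonneg_comb :: "wt \<Rightarrow> bool" where "nonneg_comb x \<longleftrightarrow> (\<exists>c::nat \<Rightarrow> nat. x = (\<Sum>i<n. smul (int (c i)) (\<alpha> i)))"
text \<open>The usual order on affine roots beta + k delta, extended to all pairs so that it is
  closed under addition; 0 is left out so that no pair is both positive and negative.\<close>

definition PosA :: "aff \<Rightarrow> bool" where "PosA p \<longleftrightarrow> 0 < snd p \<or> (snd p = 0 \<and> nonneg_comb (fst p) \<and> fst p \<noteq> 0)"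

lemma nonneg_comb_add:
  assumes "nonneg_comb x" "nonneg_comb y" shows "nonneg_comb (x + y)"
proof -
  obtain c d where cd: "x = (\<Sum>i<n. smul (int (c i)) (\<alpha> i))" "y = (\<Sum>i<n. smul (int (d i)) (\<alpha> i))"
    using assms by (auto simp: nonneg_comb_def)
  have "x + y = (\<Sum>i<n. smul (int (c i + d i)) (\<alpha> i))" by (simp add: cd smul_add_left sum.distrib)
  then show ?thesis unfolding nonneg_comb_def by (rule exI[of _ "\<lambda>i. c i + d i"])
qed

lemma nonneg_comb_antisym:
  assumes "nonneg_comb x" "nonneg_comb (- x)" shows "x = 0"
proof -
  obtain c d where cd: "x = (\<Sum>i<n. smul (int (c i)) (\<alpha> i))" "- x = (\<Sum>i<n. smul (int (d i)) (\<alpha> i))"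
    using assms by (auto simp: nonneg_comb_def)
  have "(\<Sum>i<n. smul (int (c i + d i)) (\<alpha> i)) = (\<Sum>i<n. smul (int (c i)) (\<alpha> i)) + (\<Sum>i<n. smul (int (d i)) (\<alpha> i))"
    by (simp add: smul_add_left sum.distrib)
  also have "\<dots> = x + - x" by (simp only: cd[symmetric])
  finally have "int (c j + d j) = 0" if "j < n" for j using that sroot_indep[of "\<lambda>i. int (c i + d i)" j] by simp
  then have "\<forall>j<n. c j = 0" by (metis add_is_0 of_nat_eq_0_iff)
  then show ?thesis unfolding cd(1) by simp
qed

lemma nonneg_comb_sroot: "i < n \<Longrightarrow> nonneg_comb (\<alpha> i)"
  unfolding nonneg_comb_def by (rule exI[of _ "\<lambda>j. if j = i then 1 else 0"])
    (simp add: if_distrib[of int] if_distrib[of "\<lambda>c. smul c _"] cong: if_cong)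

lemma nonneg_comb_latt: "nonneg_comb x \<Longrightarrow> latt_wt n x"
proof -
  have "latt_wt n (\<Sum>i\<in>S. smul (c i) (\<alpha> i))" for S c
    by (induction S rule: infinite_finite_induct) (simp_all add: latt_wt_closed sroot_latt)
  then show "nonneg_comb x \<Longrightarrow> latt_wt n x" by (auto simp: nonneg_comb_def)
qed

lemma PosA_add: "PosA p \<Longrightarrow> PosA q \<Longrightarrow> PosA (p + q)"
  using nonneg_comb_add[of "fst p" "fst q"] nonneg_comb_antisym[of "fst p"] 
  by (auto simp: PosA_def eq_neg_iff_add_eq_0[symmetric] dest: nonneg_comb_antisym)

lemma PosA_neg: "PosA p \<Longrightarrow> \<not> PosA (- p)"
  using nonneg_comb_antisym[of "fst p"] by (auto simp: PosA_def)

text \<open>For negative entries (-a - 1)(-b - 1) \<ge> 0 bounds -a - b by ab + 1, which leaves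
  finitely many pairs. The last assumption removes (-1,-4) and (-4,-1).\<close>

lemma pair_list:
  fixes a b :: int
  assumes "a \<le> 0" "b \<le> 0" "a = 0 \<longleftrightarrow> b = 0" "a * b \<le> 4" "a * b = 4 \<Longrightarrow> a = -2"
  shows "(a, b) \<in> {(0,0),(-1,-1),(-1,-2),(-2,-1),(-1,-3),(-3,-1),(-2,-2)}"
proof (cases "a = 0")
  case True then show ?thesis using assms by simp
next
  case False
  then have n: "a \<le> -1" "b \<le> -1" using assms by auto
  have "0 \<le> (- a - 1) * (- b - 1)" using n by simp
  then have "- a - b \<le> a * b + 1" by (simp add: algebra_simps)
  then have "a \<in> {-4,-3,-2,-1}" "b \<in> {-4,-3,-2,-1}" using assms(4) n by auto
  then show ?thesis using assms(4,5) by auto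
qed

lemma rank2_fin:
  assumes "i < n" "j < n" "i \<noteq> j"
  shows "(A i j, A j i) \<in> {(0,0),(-1,-1),(-1,-2),(-2,-1),(-1,-3),(-3,-1),(-2,-2)}"
proof -
  have p: "A i j * B (\<alpha> i) (\<alpha> i) = 2 * B (\<alpha> i) (\<alpha> j)" "A j i * B (\<alpha> j) (\<alpha> j) = 2 * B (\<alpha> i) (\<alpha> j)"
    using B_sroot[of i "\<alpha> j"] B_sroot[of j "\<alpha> i"] assms by (simp_all add: lookup_sroot B_sym)
  note b = pair_bound[OF p B_sroot_pos[OF assms(1)] B_sroot_pos[OF assms(2)]]
  \<comment> \<open>Product 4 is the equality case of Cauchy-Schwarz and would make two different
    simple roots proportional.\<close>
  have "A i j * A j i \<noteq> 4"
  proof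
    assume "A i j * A j i = 4"
    then have e: "smul (B (\<alpha> j) (\<alpha> j)) (\<alpha> i) = smul (B (\<alpha> i) (\<alpha> j)) (\<alpha> j)"
      using b Cauchy_Schwarz_eq sroot_latt by blast
    have s: "(\<Sum>k<n. smul (if k = l then c else 0) (\<alpha> k)) = smul c (\<alpha> l)" if "l < n" for l c
      using that by (simp add: if_distrib[of "\<lambda>c. smul c _"] cong: if_cong)
    have "(\<Sum>k<n. smul (if k = i then B (\<alpha> j) (\<alpha> j) else 0) (\<alpha> k)) = (\<Sum>k<n. smul (if k = j then B (\<alpha> i) (\<alpha> j) else 0) (\<alpha> k))"
      using e s[OF assms(1)] s[OF assms(2)] by simp
    from sroot_indep2[OF this assms(1)] show False using assms B_sroot_pos[OF assms(2)] by simp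
  qed
  moreover have "A i j \<le> 0" "A j i \<le> 0" using gcm assms by (auto simp: is_gcm_def)
  ultimately show ?thesis using b by (intro pair_list) auto
qed

lemma FG_rank2: "g \<in> FG \<Longrightarrow> h \<in> FG \<Longrightarrow> g \<noteq> h \<Longrightarrow> (cfa g (fst h), cfa h (fst g)) \<in> 
      {(0,0),(-1,-1),(-1,-2),(-2,-1),(-1,-3),(-3,-1),(-2,-2)}"
proof -
  assume "g \<in> FG" "h \<in> FG" "g \<noteq> h"
  then obtain i j where ij: "i < n" "g = (\<alpha> i, fin_refl n A i)" "j < n" "h = (\<alpha> j, fin_refl n A j)" "i \<noteq> j"
    unfolding FG_iff by auto
  have "cfa g (fst h) = A i j" "cfa h (fst g) = A j i" using ij by (simp_all add: FG_cf lookup_sroot)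
  then show ?thesis using rank2_fin[OF ij(1,3,5)] by simp
qed

lemma PosA_FG: "g \<in> FG \<Longrightarrow> PosA (fst g, leva g)"
  using FG_lev[of g] by (auto simp: PosA_def FG_iff nonneg_comb_sroot sroot_nz)

lemma FG_latt: "g \<in> FG \<Longrightarrow> Poly_Mapping.keys (fst g) \<subseteq> {..<n}"
  using sroot_latt unfolding FG_iff latt_wt_keys by (metis fst_conv)

lemma finite_FG: "finite FG"
proof -
  have "FG = (\<lambda>i. (\<alpha> i, fin_refl n A i)) ` {..<n}" by (auto simp: FG_iff)
  then show ?thesis by simp
qed

sublocale F: refl_system FG cfa leva n PosA
proof
  show "g \<in> FG \<Longrightarrow> h \<in> FG \<Longrightarrow> g \<noteq> h \<Longrightarrow> (cfa g (fst h), cfa h (fst g)) \<in> 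
      {(0,0),(-1,-1),(-1,-2),(-2,-1),(-1,-3),(-3,-1),(-2,-2)}" for g h by (rule FG_rank2)
  show "PosA p \<Longrightarrow> \<not> PosA (- p)" for p by (rule PosA_neg)
qed (simp_all only: PosA_add PosA_FG finite_FG FG_latt)

section \<open>Roots, coroots and reflections\<close>

lemma rootsE:
  assumes "\<beta> \<in> R" obtains v i where "v \<in> W0" "i < n" "\<beta> = wpart v (\<alpha> i)"
  using assms by (auto simp: roots_def Wfin_grp)

lemma rootsI: "v \<in> W0 \<Longrightarrow> i < n \<Longrightarrow> wpart v (\<alpha> i) \<in> R"
  by (auto simp: roots_def Wfin_grp)

lemma finite_roots: "finite R"
proof -
  have "R = (\<lambda>(v, i). wpart v (\<alpha> i)) ` (W0 \<times> {..<n})" by (auto simp: roots_def Wfin_grp)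
  then show ?thesis using finW0 by simp
qed

lemma sroot_root: "i < n \<Longrightarrow> \<alpha> i \<in> R"
  using rootsI[of id i] by (simp add: wpart_def)

lemma roots_wpart: "v \<in> W0 \<Longrightarrow> \<beta> \<in> R \<Longrightarrow> wpart v \<beta> \<in> R"
proof -
  assume v: "v \<in> W0" and "\<beta> \<in> R"
  then obtain u i where u: "u \<in> W0" "i < n" "\<beta> = wpart u (\<alpha> i)" by (auto elim: rootsE)
  then have "wpart v \<beta> = wpart (v \<circ> u) (\<alpha> i)" by (simp only: F0.wpart_comp[OF v])
  then show ?thesis using rootsI[OF grp_comp[OF v u(1)] u(2)] by simp
qed

lemma roots_NN:
  assumes "\<beta> \<in> R" shows "nonneg_comb \<beta> \<or> nonneg_comb (- \<beta>)" "\<beta> \<noteq> 0"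
proof -
  obtain v i where v: "v \<in> W0" "i < n" "\<beta> = wpart v (\<alpha> i)" using assms by (auto elim: rootsE)
  let ?g = "(\<alpha> i, fin_refl n A i)"
  have g: "?g \<in> FG" using v by (auto simp: FG_iff)
  have "v (F0.rt0 ?g) = (\<beta>, 0)" using v FG_lev[OF g] W0_apply by (simp add: F0.rt0_def)
  then have "PosA (\<beta>, 0) \<or> PosA (- (\<beta>, 0))" using F.root_dichotomy[OF g v(1)] by simp
  then show "nonneg_comb \<beta> \<or> nonneg_comb (- \<beta>)" "\<beta> \<noteq> 0" by (auto simp: PosA_def)
qed

lemma roots_latt: "\<beta> \<in> R \<Longrightarrow> latt_wt n \<beta>"
  using roots_NN(1)[of \<beta>] nonneg_comb_latt[of \<beta>] nonneg_comb_latt[of "- \<beta>"] latt_wt_closed(3)[of n "- \<beta>" "-1"] by auto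

lemma roots_B_pos: "\<beta> \<in> R \<Longrightarrow> 0 < B \<beta> \<beta>"
  using B_pos roots_latt roots_NN(2) by blast

lemma coroot_B:
  assumes "v \<in> W0" "v' \<in> W0" "v' \<circ> v = id" "i < n" "\<beta> = wpart v (\<alpha> i)"
  shows "lk (wpart v' \<mu>) i * B \<beta> \<beta> = 2 * B \<beta> \<mu>"
proof -
  have 1: "wpart v' \<beta> = \<alpha> i" using F0.wpart_comp[OF assms(2), of v "\<alpha> i"] assms by (simp add: wpart_def)
  have "B \<beta> \<beta> = B (\<alpha> i) (\<alpha> i)" "B \<beta> \<mu> = B (\<alpha> i) (wpart v' \<mu>)"
    using B_inv[OF assms(2), of \<beta> \<beta>] B_inv[OF assms(2), of \<beta> \<mu>] 1 by simp_all
  then show ?thesis using B_sroot[OF assms(4), of "wpart v' \<mu>"] by simp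
qed

text \<open>Every way of writing beta = v alpha_i gives the same value 2 B(beta, mu) / B(beta,
  beta), so the choice made in \<open>coroot_pair\<close> is immaterial.\<close>

lemma cp_B:
  assumes "\<beta> \<in> R" shows "cp \<beta> \<mu> * B \<beta> \<beta> = 2 * B \<beta> \<mu>"
proof -
  obtain v i where v: "v \<in> W0" "i < n" "\<beta> = wpart v (\<alpha> i)" using assms by (auto elim: rootsE)
  obtain v' where v': "v' \<in> W0" "v' \<circ> v = id" using W0_inverse[OF v(1)] by blast
  have "\<exists>c. \<exists>v v' i. v \<in> W0 \<and> v' \<in> W0 \<and> v' \<circ> v = id \<and> i < n \<and> \<beta> = wpart v (\<alpha> i) \<and> c = lk (wpart v' \<mu>) i"
    using v v' by blast
  then have "\<exists>v v' i. v \<in> W0 \<and> v' \<in> W0 \<and> v' \<circ> v = id \<and> i < n \<and> \<beta> = wpart v (\<alpha> i) \<and> cp \<beta> \<mu> = lk (wpart v' \<mu>) i"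
    unfolding coroot_pair_def Wfin_grp by (rule someI_ex)
  then show ?thesis using coroot_B by metis
qed

lemma cp_eqI: "\<beta> \<in> R \<Longrightarrow> c * B \<beta> \<beta> = 2 * B \<beta> \<mu> \<Longrightarrow> cp \<beta> \<mu> = c"
  using cp_B[of \<beta> \<mu>] roots_B_pos[of \<beta>] by (metis less_irrefl mult_right_cancel)

text \<open>For beta = v alpha_i, the conjugate of the i-th simple reflection by v is the reflection
  in beta.\<close>

lemma root_reflection:
  assumes "\<beta> \<in> R" obtains r where "r \<in> W0" "\<And>\<mu>. wpart r \<mu> = \<mu> - smul (cp \<beta> \<mu>) \<beta>"
proof -
  obtain v i where v: "v \<in> W0" "i < n" "\<beta> = wpart v (\<alpha> i)" using assms by (auto elim: rootsE)
  obtain v' where v': "v' \<in> W0" "v' \<circ> v = id" "\<And>\<mu>. wpart v (wpart v' \<mu>) = \<mu>" using W0_inverse[OF v(1)] by blast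
  let ?r = "v \<circ> (fin_refl n A i \<circ> v')"
  have "?r \<in> W0" using v v' W0_gen by (intro grp_comp) auto
  moreover have "wpart ?r \<mu> = \<mu> - smul (cp \<beta> \<mu>) \<beta>" for \<mu>
  proof -
    have "cp \<beta> \<mu> = lk (wpart v' \<mu>) i" by (rule cp_eqI[OF assms coroot_B[OF v(1) v'(1,2) v(2,3)]])
    then show ?thesis
      by (simp only: F0.wpart_comp[OF v(1)] F0.wpart_comp[OF W0_gen[OF v(2)]] wpart_fin_refl F0.wpart_diff[OF v(1)] F0.wpart_smul[OF v(1)] v'(3) v(3)[symmetric])
  qed
  ultimately show thesis using that by blast
qed

lemma root_refl_root: "\<beta> \<in> R \<Longrightarrow> \<gamma> \<in> R \<Longrightarrow> \<gamma> - smul (cp \<beta> \<gamma>) \<beta> \<in> R"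
  using root_reflection[of \<beta>] roots_wpart[of _ \<gamma>] by metis

lemma cp_self: "\<beta> \<in> R \<Longrightarrow> cp \<beta> \<beta> = 2" by (rule cp_eqI) auto
lemma cp_add: "\<beta> \<in> R \<Longrightarrow> cp \<beta> (x + y) = cp \<beta> x + cp \<beta> y"
  by (rule cp_eqI) (simp_all add: distrib_right cp_B B_add')

lemma roots_uminus: "\<beta> \<in> R \<Longrightarrow> - \<beta> \<in> R"
proof -
  assume b: "\<beta> \<in> R"
  have e: "\<beta> - smul 2 \<beta> = - \<beta>" by (rule poly_mapping_eqI) (simp add: lookup_minus)
  show ?thesis using root_refl_root[OF b b] unfolding cp_self[OF b] e .
qed

text \<open>If one Cartan integer is -1, the sum is a reflected root; otherwise both are -2, and the
  sum has norm 0.\<close>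

lemma root_sum:
  assumes "\<beta> \<in> R" "\<gamma> \<in> R" "B \<beta> \<gamma> < 0" "\<beta> + \<gamma> \<noteq> 0" shows "\<beta> + \<gamma> \<in> R"
proof -
  let ?p = "cp \<beta> \<gamma>" and ?q = "cp \<gamma> \<beta>"
  have p: "?p * B \<beta> \<beta> = 2 * B \<beta> \<gamma>" "?q * B \<gamma> \<gamma> = 2 * B \<beta> \<gamma>" using cp_B assms B_sym by simp_all
  note b = pair_bound[OF p roots_B_pos[OF assms(1)] roots_B_pos[OF assms(2)]]
  have n: "?p < 0" "?q < 0" using b assms(3) by auto
  consider "?p = -1" | "?q = -1" | "?p \<le> -2" "?q \<le> -2" using n by linarith
  then show ?thesis
  proof cases
    case 1 then show ?thesis using root_refl_root[OF assms(1,2)] by (simp add: add.commute)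
  next
    case 2 then show ?thesis using root_refl_root[OF assms(2,1)] by simp
  next
    case 3
    have "0 \<le> (- ?p - 2) * (- ?q - 2)" using 3 by simp
    then have "- 2 * ?p - 2 * ?q \<le> ?p * ?q + 4" by (simp add: algebra_simps)
    then have "?p = -2" "?q = -2" using b(1) 3 by linarith+
    then have "B (\<beta> + \<gamma>) (\<beta> + \<gamma>) = 0" using p by (simp add: B_lin B_sym[of \<gamma> \<beta>])
    then show ?thesis using B_eq_0 roots_latt assms latt_wt_closed(1) by blast
  qed
qed

lemma root_diff:
  assumes "\<beta> \<in> R" "\<gamma> \<in> R" "B \<beta> \<gamma> > 0" "\<beta> \<noteq> \<gamma>" shows "\<beta> - \<gamma> \<in> R"
  using root_sum[OF assms(1) roots_uminus[OF assms(2)]] assms by (simp add: B_lin)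

text \<open>Transported back by the inverse of v, a simple root would be twice an integral
  combination of simple roots, so 1 would be even.\<close>

lemma root_not_double:
  assumes "\<beta> \<in> R" "i < n" shows "\<beta> \<noteq> smul 2 (\<alpha> i)"
proof
  assume e: "\<beta> = smul 2 (\<alpha> i)"
  obtain v j where v: "v \<in> W0" "j < n" "\<beta> = wpart v (\<alpha> j)" using assms by (auto elim: rootsE)
  obtain v' where v': "v' \<in> W0" "\<And>\<mu>. wpart v' (wpart v \<mu>) = \<mu>" using W0_inverse[OF v(1)] by blast
  let ?\<gamma> = "wpart v' (\<alpha> i)"
  have g: "\<alpha> j = smul 2 ?\<gamma>" using v'(2)[of "\<alpha> j"] v(3) e F0.wpart_smul[OF v'(1)] by metis
  have "\<exists>d::nat \<Rightarrow> int. ?\<gamma> = (\<Sum>k<n. smul (d k) (\<alpha> k))"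
    using roots_NN(1)[OF roots_wpart[OF v'(1) sroot_root[OF assms(2)]]]
  proof
    assume "nonneg_comb ?\<gamma>" then show ?thesis unfolding nonneg_comb_def by metis
  next
    assume "nonneg_comb (- ?\<gamma>)"
    then obtain c :: "nat \<Rightarrow> nat" where "- ?\<gamma> = (\<Sum>k<n. smul (int (c k)) (\<alpha> k))" by (auto simp: nonneg_comb_def)
    then have "?\<gamma> = - (\<Sum>k<n. smul (int (c k)) (\<alpha> k))" by (metis minus_minus)
    also have "\<dots> = (\<Sum>k<n. smul (- int (c k)) (\<alpha> k))" by (simp add: smul_minus_left sum_negf)
    finally show ?thesis by (rule exI[of _ "\<lambda>k. - int (c k)"])
  qed
  then obtain d where d: "?\<gamma> = (\<Sum>k<n. smul (d k) (\<alpha> k))" by blast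
  have ss: "smul 2 (\<Sum>k\<in>S. f k) = (\<Sum>k\<in>S. smul 2 (f k))" for S and f :: "nat \<Rightarrow> wt"
    by (induction S rule: infinite_finite_induct) (simp_all add: smul_add_right)
  have "(\<Sum>k<n. smul (if k = j then 1 else 0) (\<alpha> k)) = \<alpha> j"
    using v(2) by (simp add: if_distrib[of "\<lambda>c. smul c _"] cong: if_cong)
  also have "\<dots> = (\<Sum>k<n. smul (2 * d k) (\<alpha> k))" unfolding g d ss by simp
  finally have "1 = 2 * d j" using sroot_indep2[of "\<lambda>k. if k = j then 1 else 0" "\<lambda>k. 2 * d k" j] v(2) by simp
  then show False by presburger
qed

section \<open>Highest roots of the simple factors\<close>

lemma max_rootsD:
  assumes "\<theta> \<in> max_roots n A"
  shows "\<theta> \<in> R" "nonneg_comb \<theta>" "\<And>i. i < n \<Longrightarrow> \<theta> + \<alpha> i \<notin> R" "\<theta> \<noteq> 0"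
  using assms roots_NN(2)[of \<theta>] by (auto simp: max_roots_def pos_roots_def nonneg_comb_def)

lemma nonneg_comb_add_nz: "nonneg_comb x \<Longrightarrow> nonneg_comb y \<Longrightarrow> x \<noteq> 0 \<Longrightarrow> x + y \<noteq> 0"
  using nonneg_comb_antisym[of x] by (metis add_eq_0_iff)

lemma max_root_dominant:
  assumes "\<theta> \<in> max_roots n A" "i < n" shows "0 \<le> B \<theta> (\<alpha> i)"
proof (rule ccontr)
  note t = max_rootsD[OF assms(1)]
  assume "\<not> ?thesis"
  then show False using root_sum[OF t(1) sroot_root[OF assms(2)]] t(3)[OF assms(2)] nonneg_comb_add_nz[OF t(2) nonneg_comb_sroot[OF assms(2)] t(4)] by simp
qed

text \<open>
  Induction on the height of \<open>\<beta>\<close>: for \<open>\<beta> = \<beta>' + \<alpha>\<^sub>i\<close>, if neither \<open>\<theta> + \<beta>'\<close> nor \<open>\<theta> + \<alpha>\<^sub>i\<close> is a root, then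
  \<open>\<theta> + \<beta>\<close> being a root would force \<open>B (\<theta> + \<beta>) \<beta> \<le> 0\<close> together with \<open>B \<theta> \<beta> \<ge> 0\<close>.
\<close>

lemma max_root_add_pos:
  assumes "\<theta> \<in> max_roots n A" "\<beta> \<in> R" "nonneg_comb \<beta>" shows "\<theta> + \<beta> \<notin> R"
proof -
  note t = max_rootsD[OF assms(1)]
  have "\<theta> + \<beta> \<notin> R" if "\<beta> \<in> R" "\<beta> = (\<Sum>i<n. smul (int (c i)) (\<alpha> i))" for c \<beta> using that
  proof (induction "\<Sum>i<n. c i" arbitrary: c \<beta> rule: less_induct)
    case less
    have nnb: "nonneg_comb \<beta>" using less.prems(2) unfolding nonneg_comb_def by blast
    have "0 < B \<beta> \<beta>" using roots_B_pos less.prems by blast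
    moreover have "B \<beta> \<beta> = (\<Sum>i<n. int (c i) * B (\<alpha> i) \<beta>)" 
      using B_sum[of "\<lambda>i. smul (int (c i)) (\<alpha> i)" "{..<n}" \<beta>] less.prems(2) by (simp add: B_smul)
    ultimately have "\<not> (\<forall>i<n. int (c i) * B (\<alpha> i) \<beta> \<le> 0)" using sum_nonpos[of "{..<n}" "\<lambda>i. int (c i) * B (\<alpha> i) \<beta>"] by force
    \<comment> \<open>Positivity of B(beta, beta) forces a simple root in the support of beta that
      pairs positively with it; subtracting this root lowers the height and gives a root unless beta
      is that simple root.\<close>
    then obtain i where i: "i < n" "0 < int (c i) * B (\<alpha> i) \<beta>" by force
    then have ci: "0 < c i" "0 < B \<beta> (\<alpha> i)" by (auto simp: zero_less_mult_iff B_sym)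
    show ?case
    proof (cases "\<beta> = \<alpha> i")
      case True then show ?thesis using t(3)[OF i(1)] by simp
    next
      case False
      let ?b = "\<beta> - \<alpha> i" and ?c = "c(i := c i - 1)"
      have b: "?b \<in> R" using root_diff[OF less.prems(1) sroot_root[OF i(1)] ci(2) False] .
      have sm: "(\<Sum>k<n. c k) = (\<Sum>k<n. ?c k) + 1"
      proof -
        have "(\<Sum>k<n. c k) = (\<Sum>k<n. ?c k + (if k = i then 1 else 0))" by (rule sum.cong) (use ci in auto)
        then show ?thesis using i(1) by (simp only: sum.distrib) simp
      qed
      have "\<beta> = (\<Sum>k<n. smul (int (?c k)) (\<alpha> k) + (if k = i then \<alpha> i else 0))" unfolding less.prems(2)
        by (rule sum.cong) (use ci in \<open>auto simp: of_nat_diff smul_diff_left\<close>)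
      then have bc: "?b = (\<Sum>k<n. smul (int (?c k)) (\<alpha> k))" using i(1) by (simp only: sum.distrib) simp
      have nnb': "nonneg_comb ?b" using bc unfolding nonneg_comb_def by blast
      have IH: "\<theta> + ?b \<notin> R" by (rule less.hyps[OF _ b bc]) (use sm in simp)
      show ?thesis
      proof
        assume s: "\<theta> + \<beta> \<in> R"
        have 1: "B (\<theta> + \<beta>) (\<alpha> i) \<le> 0"
          using root_diff[OF s sroot_root[OF i(1)]] IH nonneg_comb_add_nz[OF t(2) nnb' t(4)] by (force simp: algebra_simps)
        have 2: "B (\<theta> + \<beta>) ?b \<le> 0"
          using root_diff[OF s b] t(3)[OF i(1)] nonneg_comb_add_nz[OF t(2) nonneg_comb_sroot[OF i(1)] t(4)] by (force simp: algebra_simps)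
        have 3: "0 \<le> B \<theta> ?b"
          using root_sum[OF t(1) b] IH nonneg_comb_add_nz[OF t(2) nnb' t(4)] by force
        have 4: "0 \<le> B \<theta> (\<alpha> i)" using max_root_dominant[OF assms(1) i(1)] .
        show False using 1 2 3 4 \<open>0 < B \<beta> \<beta>\<close> by (simp add: B_lin)
      qed
    qed
  qed
  then show ?thesis using assms unfolding nonneg_comb_def by blast
qed

text \<open>Dominance gives a nonnegative product. Were it positive, the difference would be a root
  of one sign whose sum with one highest root is the other. Hence the affine reflections of
  different factors commute.\<close>

lemma max_roots_orth:
  assumes "\<theta> \<in> max_roots n A" "\<theta>' \<in> max_roots n A" "\<theta> \<noteq> \<theta>'" shows "B \<theta> \<theta>' = 0"
proof (rule ccontr)
  note t = max_rootsD[OF assms(1)] and t' = max_rootsD[OF assms(2)]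
  assume ne: "B \<theta> \<theta>' \<noteq> 0"
  obtain c :: "nat \<Rightarrow> nat" where c: "\<theta>' = (\<Sum>i<n. smul (int (c i)) (\<alpha> i))" using t'(2) by (auto simp: nonneg_comb_def)
  have "B \<theta>' \<theta> = (\<Sum>i<n. int (c i) * B (\<alpha> i) \<theta>)"
    using B_sum[of "\<lambda>i. smul (int (c i)) (\<alpha> i)" "{..<n}" \<theta>] c by (simp add: B_smul)
  also have "\<dots> \<ge> 0" using max_root_dominant[OF assms(1)] by (intro sum_nonneg) (simp add: B_sym)
  finally have "0 < B \<theta> \<theta>'" using ne by (simp add: B_sym)
  then have d: "\<theta> - \<theta>' \<in> R" using root_diff t(1) t'(1) assms(3) by blast
  from roots_NN(1)[OF d] show False
  proof
    assume "nonneg_comb (\<theta> - \<theta>')"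
    then show False using max_root_add_pos[OF assms(2) d] t(1) by simp
  next
    assume "nonneg_comb (- (\<theta> - \<theta>'))"
    then show False using max_root_add_pos[OF assms(1) roots_uminus[OF d]] t'(1) by simp
  qed
qed

lemma rank2_max:
  assumes "\<theta> \<in> max_roots n A" "i < n"
  shows "(- cp \<theta> (\<alpha> i), - lk \<theta> i) \<in> {(0,0),(-1,-1),(-1,-2),(-2,-1),(-1,-3),(-3,-1),(-2,-2)}"
proof -
  note t = max_rootsD[OF assms(1)]
  let ?p = "cp \<theta> (\<alpha> i)" and ?q = "lk \<theta> i"
  have p: "?p * B \<theta> \<theta> = 2 * B \<theta> (\<alpha> i)" "?q * B (\<alpha> i) (\<alpha> i) = 2 * B \<theta> (\<alpha> i)"
    using cp_B[OF t(1)] B_sroot[OF assms(2), of \<theta>] B_sym by simp_all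
  note b = pair_bound[OF p roots_B_pos[OF t(1)] B_sroot_pos[OF assms(2)]]
  have "0 \<le> ?p" "0 \<le> ?q" using b max_root_dominant[OF assms] by (auto simp: not_less[symmetric])
  \<comment> \<open>Product 4 makes theta a multiple c alpha_i, where c divides 2 and c = 2 is
    excluded by \<open>root_not_double\<close>. So theta = alpha_i, an A1 factor, and the pair is
    (-2,-2), not (-1,-4).\<close>
  moreover have "?p = 2" if pq: "?p * ?q = 4"
  proof -
    have e: "smul (B (\<alpha> i) (\<alpha> i)) \<theta> = smul (B \<theta> (\<alpha> i)) (\<alpha> i)"
      using b(2)[OF pq] Cauchy_Schwarz_eq sroot_latt roots_latt t(1) by blast
    obtain c :: "nat \<Rightarrow> nat" where c: "\<theta> = (\<Sum>k<n. smul (int (c k)) (\<alpha> k))" using t(2) by (auto simp: nonneg_comb_def)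
    have ss: "smul z (\<Sum>k\<in>S. f k) = (\<Sum>k\<in>S. smul z (f k))" for z S and f :: "nat \<Rightarrow> wt"
      by (induction S rule: infinite_finite_induct) (simp_all add: smul_add_right)
    have "(\<Sum>k<n. smul (B (\<alpha> i) (\<alpha> i) * int (c k)) (\<alpha> k)) = (\<Sum>k<n. smul (if k = i then B \<theta> (\<alpha> i) else 0) (\<alpha> k))"
      using e assms(2) unfolding c[symmetric] by (subst (asm) (1) c) (simp add: ss if_distrib[of "\<lambda>c. smul c _"] cong: if_cong)
    from sroot_indep2[OF this] have "c k = 0" if "k < n" "k \<noteq> i" for k
      using that B_sroot_pos[OF assms(2)] by fastforce
    then have "\<theta> = (\<Sum>k<n. if k = i then smul (int (c i)) (\<alpha> i) else 0)" by (subst c, intro sum.cong) auto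
    then have th: "\<theta> = smul (int (c i)) (\<alpha> i)" using assms(2) by simp
    have q: "?q = 2 * int (c i)" by (subst th) (simp add: sroot_diag[OF assms(2)])
    have "c i \<noteq> 2" using root_not_double[OF t(1) assms(2)] th by auto
    have "?p * int (c i) = 2" using pq q by (simp add: mult.commute)
    then have "int (c i) dvd 2" by (metis dvd_triv_right)
    then have "c i dvd 2" by (metis int_dvd_int_iff of_nat_numeral)
    then have "c i \<le> 2" by (rule dvd_imp_le) simp
    moreover have "c i \<noteq> 0" using \<open>?p * int (c i) = 2\<close> by (metis mult_zero_right of_nat_0 zero_neq_numeral)
    ultimately have "c i = 1 \<or> c i = 2" by arith
    then show ?thesis using \<open>c i \<noteq> 2\<close> \<open>?p * int (c i) = 2\<close> by simp
  qed
  ultimately show ?thesis using b by (intro pair_list) auto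
qed

section \<open>Affine simple reflections\<close>

definition aff_gen :: "wt \<Rightarrow> gen" where "aff_gen \<theta> = (- \<theta>, arefl (\<lambda>\<mu>. - cp \<theta> \<mu>) (- \<theta>) 1)"

lemma AG_cases:
  assumes "g \<in> AG"
  obtains i where "i < n" "g = (\<alpha> i, fin_refl n A i)" | \<theta> where "\<theta> \<in> max_roots n A" "g = aff_gen \<theta>"
  using assms by (auto simp: aff_gens_def fin_gens_def aff_gen_def)

lemma FG_AG: "FG \<subseteq> AG" by (auto simp: aff_gens_def)

lemma aff_gen_FG: "\<theta> \<in> max_roots n A \<Longrightarrow> aff_gen \<theta> \<notin> FG"
  using max_rootsD[of \<theta>] nonneg_comb_antisym[of \<theta>] nonneg_comb_sroot by (auto simp: FG_iff aff_gen_def)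

lemma aff_gen_cf: "\<theta> \<in> max_roots n A \<Longrightarrow> cfa (aff_gen \<theta>) = (\<lambda>\<mu>. - cp \<theta> \<mu>)"
  and aff_gen_lev: "\<theta> \<in> max_roots n A \<Longrightarrow> leva (aff_gen \<theta>) = 1"
  using aff_gen_FG[of \<theta>] by (auto simp: cfa_def leva_def aff_gen_def fun_eq_iff)

lemma cp_uminus: "\<beta> \<in> R \<Longrightarrow> cp \<beta> (- x) = - cp \<beta> x"
  by (rule cp_eqI) (simp_all add: cp_B B_minus')

sublocale A0: refl_group AG cfa leva
proof
  fix g assume "g \<in> AG"
  then show "snd g = arefl (cfa g) (fst g) (leva g)"
  proof (cases rule: AG_cases)
    case (1 i) then show ?thesis using FG_form[of g] by (auto simp: FG_iff)
  next
    case (2 \<theta>)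
    then have "snd g = arefl (cfa g) (- \<theta>) (leva g)" unfolding 2(2) aff_gen_cf[OF 2(1)] aff_gen_lev[OF 2(1)] by (simp add: aff_gen_def)
    then show ?thesis using 2(2) by (simp add: aff_gen_def)
  qed
next
  fix g x y assume "g \<in> AG"
  then show "cfa g (x + y) = cfa g x + cfa g y"
    by (cases rule: AG_cases) (auto simp: FG_cf lookup_add aff_gen_cf cp_add max_rootsD)
next
  fix g assume "g \<in> AG"
  then show "cfa g (fst g) = 2"
  proof (cases rule: AG_cases)
    case (2 \<theta>)
    have "fst (aff_gen \<theta>) = - \<theta>" by (simp add: aff_gen_def)
    then show ?thesis using 2 by (simp add: aff_gen_cf cp_uminus max_rootsD cp_self)
  qed (simp add: FG_cf sroot_diag)
qed

lemma AG_rank2: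
  assumes "g \<in> AG" "h \<in> AG" "g \<noteq> h" 
  shows "(cfa g (fst h), cfa h (fst g)) \<in> {(0,0),(-1,-1),(-1,-2),(-2,-1),(-1,-3),(-3,-1),(-2,-2)}"
proof -
  have fa: "fst (aff_gen \<theta>) = - \<theta>" for \<theta> by (simp add: aff_gen_def)
  have mix: "(cfa (aff_gen \<theta>) (\<alpha> i), cfa (\<alpha> i, fin_refl n A i) (- \<theta>)) \<in> {(0,0),(-1,-1),(-1,-2),(-2,-1),(-1,-3),(-3,-1),(-2,-2)}"
    if "\<theta> \<in> max_roots n A" "i < n" for \<theta> i
    using rank2_max[OF that] that by (simp add: aff_gen_cf FG_cf)
  from assms(1) show ?thesis
  proof (cases rule: AG_cases)
    case (1 i)
    from assms(2) show ?thesis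
    proof (cases rule: AG_cases)
      case (1 j)
      then show ?thesis using FG_rank2[of g h] \<open>i < n\<close> \<open>g = (\<alpha> i, fin_refl n A i)\<close> assms(3) by (auto simp: FG_iff)
    next
      case (2 \<theta>)
      then show ?thesis using mix[OF 2(1) 1(1)] 1(2) by (auto simp: fa)
    qed
  next
    case (2 \<theta>)
    from assms(2) show ?thesis
    proof (cases rule: AG_cases)
      case (1 j)
      then show ?thesis using mix[OF 2(1) 1(1)] 2(2) by (simp add: fa)
    next
      case (2 \<theta>')
      then have ne: "\<theta> \<noteq> \<theta>'" using assms(3) \<open>g = aff_gen \<theta>\<close> by auto
      have "B \<theta> \<theta>' = 0" "B \<theta>' \<theta> = 0" using max_roots_orth ne 2(1) \<open>\<theta> \<in> max_roots n A\<close> by auto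
      then have "cp \<theta> \<theta>' = 0" "cp \<theta>' \<theta> = 0" using cp_eqI max_rootsD(1) 2(1) \<open>\<theta> \<in> max_roots n A\<close> by auto
      then show ?thesis using 2 \<open>\<theta> \<in> max_roots n A\<close> \<open>g = aff_gen \<theta>\<close> by (simp add: fa aff_gen_cf cp_uminus max_rootsD)
    qed
  qed
qed

lemma finite_AG: "finite AG"
proof -
  have "max_roots n A \<subseteq> R" using max_rootsD(1) by blast
  then have "finite (max_roots n A)" using finite_roots finite_subset by blast
  moreover have "AG = FG \<union> aff_gen ` max_roots n A" by (auto simp: aff_gens_def aff_gen_def)
  ultimately show ?thesis using finite_FG by simp
qed

lemma PosA_AG: 
  assumes "g \<in> AG" shows "PosA (fst g, leva g)"
  using assms
proof (cases rule: AG_cases)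
  case (1 i)
  then have "g \<in> FG" by (auto simp: FG_iff)
  then show ?thesis by (rule PosA_FG)
next
  case (2 \<theta>) then show ?thesis by (simp add: PosA_def aff_gen_lev)
qed

lemma AG_latt: 
  assumes "g \<in> AG" shows "latt_wt n (fst g)"
  using assms
proof (cases rule: AG_cases)
  case (2 \<theta>) then show ?thesis using roots_latt[OF roots_uminus[OF max_rootsD(1)[OF 2(1)]]] by (simp add: aff_gen_def)
qed (simp_all add: sroot_latt)

sublocale A: refl_system AG cfa leva n PosA
proof
  show "g \<in> AG \<Longrightarrow> h \<in> AG \<Longrightarrow> g \<noteq> h \<Longrightarrow> (cfa g (fst h), cfa h (fst g)) \<in> 
      {(0,0),(-1,-1),(-1,-2),(-2,-1),(-1,-3),(-3,-1),(-2,-2)}" for g h by (rule AG_rank2)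
  show "PosA p \<Longrightarrow> \<not> PosA (- p)" for p by (rule PosA_neg)
qed (simp_all only: PosA_add PosA_AG finite_AG AG_latt latt_wt_keys[symmetric])

end

section \<open>The coproduct formula\<close>

context cartan begin

abbreviation Wa :: "wel set" where "Wa \<equiv> grp AG"

section \<open>Translations and the semidirect product\<close>

lemma W0_Wa: "v \<in> W0 \<Longrightarrow> v \<in> Wa"
  using FG_AG unfolding grp_word by blast

lemma W0_snd: "v \<in> W0 \<Longrightarrow> snd (v x) = snd x"
  using W0_apply[of v "fst x" "snd x"] by simp

text \<open>On weights the affine reflection attached to theta acts as the reflection in theta,
  which lies in the finite group.\<close>

lemma Wa_finite_part: "w \<in> Wa \<Longrightarrow> \<exists>v\<in>W0. \<forall>x. fst (w x) = fst (v x)"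
proof (induction rule: A0.W_induct)
  case id then show ?case by (intro bexI[of _ id]) auto
next
  case (step g u)
  then obtain v where v: "v \<in> W0" "\<forall>x. fst (u x) = fst (v x)" by blast
  have "\<exists>r\<in>W0. \<forall>\<mu>. \<mu> - smul (cfa g \<mu>) (fst g) = wpart r \<mu>"
    using step(1)
  proof (cases rule: AG_cases)
    case (1 i)
    then show ?thesis using W0_gen[OF 1(1)] by (intro bexI[of _ "fin_refl n A i"]) (simp_all add: FG_cf wpart_fin_refl)
  next
    case (2 \<theta>)
    obtain r where "r \<in> W0" "\<And>\<mu>. wpart r \<mu> = \<mu> - smul (cp \<theta> \<mu>) \<theta>" using root_reflection[OF max_rootsD(1)[OF 2(1)]] by blast
    moreover have "fst g = - \<theta>" using 2(2) by (simp add: aff_gen_def)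
    ultimately show ?thesis using 2 by (intro bexI[of _ r]) (simp_all add: aff_gen_cf smul_minus_left smul_minus_right)
  qed
  then obtain r where r: "r \<in> W0" "\<forall>\<mu>. \<mu> - smul (cfa g \<mu>) (fst g) = wpart r \<mu>" by blast
  have "fst (snd g (u x)) = fst (r (v x))" for x
  proof -
    have "fst (snd g (u x)) = wpart r (fst (u x))"
      using A0.refl_apply[OF step(1), of "fst (u x)" "snd (u x)"] r(2) by simp
    moreover have "fst (r (v x)) = wpart r (fst (v x))" using W0_apply[OF r(1), of "fst (v x)" "snd (v x)"] by simp
    ultimately show ?thesis using v(2) by simp
  qed
  then show ?case using grp_comp[OF r(1) v(1)] by (intro bexI[of _ "r \<circ> v"]) simp_all
qed

lemma QV_iff: "t \<in> QV n A \<longleftrightarrow> t \<in> Wa \<and> (\<forall>x. fst (t x) = fst x)"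
  unfolding QV_def by (rule mem_Collect_eq)

lemma QVD: 
  assumes "t \<in> QV n A" shows "t \<in> Wa" "fst (t x) = fst x"
  using assms unfolding QV_iff by (rule conjunct1, elim conjE allE)

text \<open>Dividing by the finite element with the same action on weights leaves an element that
  acts trivially there.\<close>

lemma Wa_decomp:
  assumes "w \<in> Wa"
  obtains t v where "t \<in> QV n A" "v \<in> W0" "w = t \<circ> v"
proof -
  obtain v where v: "v \<in> W0" "\<forall>x. fst (w x) = fst (v x)" using Wa_finite_part[OF assms] by (rule bexE)
  obtain v' where v': "v' \<in> W0" "v' \<circ> v = id" "v \<circ> v' = id" "len FG v' \<le> len FG v" using F0.W_inverse[OF v(1)] .
  have f: "fst ((w \<circ> v') x) = fst x" for x
    using spec[OF v(2), of "v' x"] fun_cong[OF v'(3), of x] by simp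
  then have "w \<circ> v' \<in> QV n A" using grp_comp[OF assms W0_Wa[OF v'(1)]] unfolding QV_iff by (intro conjI allI)
  moreover have "w = (w \<circ> v') \<circ> v" unfolding comp_assoc v'(2) by simp
  ultimately show thesis by (rule that[OF _ v(1)])
qed

text \<open>A translation fixes the weight and a finite element fixes the level, so t v determines
  both coordinates of v x.\<close>

lemma decomp_unique:
  assumes "t \<in> QV n A" "v \<in> W0" "t' \<in> QV n A" "v' \<in> W0" "t \<circ> v = t' \<circ> v'"
  shows "t = t'" "v = v'"
proof -
  have "v x = v' x" for x
  proof (rule prod_eqI)
    have "fst (v x) = fst ((t \<circ> v) x)" "fst (v' x) = fst ((t' \<circ> v') x)" using QVD(2) assms(1,3) by simp_all
    then show "fst (v x) = fst (v' x)" by (simp only: assms(5))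
    show "snd (v x) = snd (v' x)" using W0_snd assms(2,4) by simp
  qed
  then show v: "v = v'" by (rule ext)
  obtain u where "u \<in> W0" "u \<circ> v = id" and u: "v \<circ> u = id" and "len FG u \<le> len FG v" using F0.W_inverse[OF assms(2)] .
  have "t = (t \<circ> v) \<circ> u" unfolding comp_assoc u by simp
  also have "\<dots> = t'" unfolding assms(5) comp_assoc v[symmetric] u by simp
  finally show "t = t'" .
qed

lemma parts:
  assumes "t \<in> QV n A" "v \<in> W0"
  shows "trans_part n A (t \<circ> v) = t" "fin_part n A (t \<circ> v) = v"
proof -
  show "trans_part n A (t \<circ> v) = t" unfolding trans_part_def Wfin_grp
  proof (rule the_equality)
    show "t \<in> QV n A \<and> (\<exists>v'\<in>W0. t \<circ> v = t \<circ> v')" using assms by blast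
    show "t' = t" if "t' \<in> QV n A \<and> (\<exists>v'\<in>W0. t \<circ> v = t' \<circ> v')" for t'
      using that decomp_unique(1)[OF assms] by auto
  qed
  show "fin_part n A (t \<circ> v) = v" unfolding fin_part_def Wfin_grp
  proof (rule the_equality)
    show "v \<in> W0 \<and> (\<exists>t'\<in>QV n A. t \<circ> v = t' \<circ> v)" using assms by blast
    show "v' = v" if "v' \<in> W0 \<and> (\<exists>t'\<in>QV n A. t \<circ> v = t' \<circ> v')" for v'
      using that decomp_unique(2)[OF assms] by auto
  qed
qed

text \<open>Both systems share \<open>PosA\<close>, so a finite generator raises the finite length
  exactly when it raises the affine length.\<close>

lemma fin_red_aff_red: "is_red FG ws \<Longrightarrow> is_red AG ws"
proof (induction ws rule: rev_induct)
  case Nil then show ?case by (simp add: is_red_def)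
next
  case (snoc g ws)
  have g: "g \<in> FG" "set ws \<subseteq> FG" using snoc.prems by (auto simp: is_red_def)
  then have gA: "g \<in> AG" using FG_AG by blast
  have f: "is_red FG ws" using snoc.prems is_red_prefix by blast
  let ?w = "word_prod ws"
  have w: "?w \<in> W0" "?w \<in> Wa" using word_in_grp g W0_Wa by auto
  have "len FG ?w < len FG (?w \<circ> snd g)" using f snoc.prems by (simp add: is_red_def)
  then have "PosA (?w (F0.rt0 g))" using F.longer_iff_Pos[OF g(1) w(1)] by simp
  then have "len AG ?w < len AG (?w \<circ> snd g)" using A.longer_iff_Pos[OF gA w(2)] by (simp add: F0.rt0_def A0.rt0_def)
  then have "len AG (?w \<circ> snd g) = len AG ?w + 1" using A0.ln_right_le[OF gA w(2)] by simp
  then show ?case using snoc.IH[OF f] gA by (simp add: is_red_def)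
qed

lemma yel_fin_aff: "w \<in> W0 \<Longrightarrow> yel FG w = yel AG w"
  using A.yl_red[OF fin_red_aff_red[OF is_red_redword[of w FG]]] redword(3)[of w FG]
  by (simp add: yel_def[of FG] F.y_word_dlt)

text \<open>The finite expansion of \<open>v\<close> is also an affine one. This identifies the
  second factors of the two sums in the theorem.\<close>

lemma psibar_fin_aff:
  assumes "v \<in> W0" "w \<in> W0" shows "psibar n AG w v = psibar n FG w v"
proof -
  obtain T where T: "finite T" "T \<subseteq> W0" "\<forall>w\<in>W0. w \<notin> T \<longrightarrow> psibar n FG w v = 0"
    "\<forall>x. dlt v x = (\<Sum>w\<in>T. fr (psibar n FG w v) * yel FG w x)" using F.psibar_expand[OF assms(1)] by blast
  have "fr (psibar n AG w v) = fr (psibar n FG w v)"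
  proof (rule A.psibar_coeff[where S = T and c = "\<lambda>w. fr (psibar n FG w v)"])
    show "v \<in> Wa" "w \<in> Wa" "T \<subseteq> Wa" "finite T" using assms T W0_Wa by auto
    show "w \<notin> T \<Longrightarrow> fr (psibar n FG w v) = 0" using T(3) assms(2) by (simp add: fr_simps)
    fix x
    have "(\<Sum>w\<in>T. fr (psibar n FG w v) * yel FG w x) = (\<Sum>w\<in>T. fr (psibar n FG w v) * yel AG w x)"
      by (rule sum.cong) (use T(2) yel_fin_aff in auto)
    then show "dlt v x = (\<Sum>w\<in>T. fr (psibar n FG w v) * yel AG w x)" using T(4) by simp
  qed
  then show ?thesis by simp
qed

text \<open>For a translation this is left multiplication by its inverse; no twist of the scalars
  appears, since translations act trivially on weights.\<close>

definition left_tr :: "wel \<Rightarrow> nh \<Rightarrow> nh" where "left_tr t X u = X (t \<circ> u)"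

lemma left_tr_mul_y:
  assumes "t \<in> QV n A" shows "mul_y g (left_tr t X) = left_tr t (mul_y g X)"
proof (rule ext)
  fix u
  have e: "ex (t \<circ> w) x = ex w x" for w x using QVD(2)[OF assms] by (simp add: ex_def wpart_def)
  show "mul_y g (left_tr t X) u = left_tr t (mul_y g X) u"
    unfolding mul_y_def left_tr_def by (simp only: e comp_assoc)
qed

lemma left_tr_fold: "t \<in> QV n A \<Longrightarrow> fold mul_y ws (left_tr t X) = left_tr t (fold mul_y ws X)"
  by (induction ws arbitrary: X) (simp_all add: left_tr_mul_y)

lemma QV_inverse:
  assumes "t \<in> QV n A" obtains t' where "t' \<in> QV n A" "t' \<circ> t = id" "t \<circ> t' = id"
proof -
  obtain t' where t': "t' \<in> Wa" "t' \<circ> t = id" "t \<circ> t' = id" "len AG t' \<le> len AG t" using A0.W_inverse[OF QVD(1)[OF assms]] .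
  have "fst (t' x) = fst x" for x using QVD(2)[OF assms, of "t' x"] fun_cong[OF t'(3), of x] by simp
  then have "t' \<in> QV n A" using t'(1) unfolding QV_iff by (intro conjI allI)
  then show thesis using t'(2,3) by (rule that)
qed

text \<open>Needed because a sum over an infinite set of pairs would have the default value
  0.\<close>

lemma finite_dem_pairs: "w \<in> Wa \<Longrightarrow> finite (dem_pairs n A w)"
proof (rule finite_subset)
  show "dem_pairs n A w \<subseteq> {u \<in> Wa. len AG u \<le> len AG w} \<times> W0"
  proof
    fix p assume "p \<in> dem_pairs n A w"
    then show "p \<in> {u \<in> Wa. len AG u \<le> len AG w} \<times> W0"
      using A.dem_len[of "fst p" "snd p"] W0_Wa[of "snd p"] by (auto simp: dem_pairs_def Wfin_grp)
  qed
  show "finite ({u \<in> Wa. len AG u \<le> len AG w} \<times> W0)" using A.finite_ln_le finW0 by blast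
qed

theorem psibar_product:
  assumes t: "t \<in> QV n A" and v: "v \<in> W0" and w: "w \<in> Wa"
  shows "psibar n AG w (t \<circ> v) = (\<Sum>(w1, w2)\<in>dem_pairs n A w. psibar n AG w1 t * psibar n FG w2 v)"
proof -
  \<comment> \<open>\<open>left_tr\<close> inverts its argument, so \<open>left_tr t'\<close> is
    left multiplication by \<open>t\<close>.\<close>
  obtain t' where t': "t' \<in> QV n A" "t' \<circ> t = id" "t \<circ> t' = id" using QV_inverse[OF t] .
  obtain T1 where T1: "finite T1" "T1 \<subseteq> Wa" "\<forall>w\<in>Wa. w \<notin> T1 \<longrightarrow> psibar n AG w t = 0"
    "\<forall>x. dlt t x = (\<Sum>w\<in>T1. fr (psibar n AG w t) * yel AG w x)" using A.psibar_expand[OF QVD(1)[OF t]] by blast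
  obtain T2 where T2: "finite T2" "T2 \<subseteq> W0" "\<forall>w\<in>W0. w \<notin> T2 \<longrightarrow> psibar n FG w v = 0"
    "\<forall>x. dlt v x = (\<Sum>w\<in>T2. fr (psibar n FG w v) * yel FG w x)" using F.psibar_expand[OF v] by blast
  have solve: "t' \<circ> u = a \<longleftrightarrow> u = t \<circ> a" for u a 
  proof
    assume "t' \<circ> u = a"
    then have "t \<circ> a = (t \<circ> t') \<circ> u" by (simp only: comp_assoc)
    then show "u = t \<circ> a" unfolding t'(3) by simp
  next
    assume "u = t \<circ> a"
    then have "t' \<circ> u = (t' \<circ> t) \<circ> a" by (simp only: comp_assoc)
    then show "t' \<circ> u = a" unfolding t'(2) by simp
  qed
  have Ltd: "left_tr t' (dlt a) = dlt (t \<circ> a)" for a by (rule ext) (simp only: left_tr_def dlt_def solve)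
  have dt: "dlt t = (\<lambda>x. \<Sum>w\<in>T1. fr (psibar n AG w t) * yel AG w x)" using T1(4) by (intro ext) simp
  \<comment> \<open>The product of t and y_w2 is obtained by running the word of \<open>w2\<close>
    from \<open>t\<close> instead of the identity; then \<open>t\<close> itself is expanded.\<close>
  have key: "left_tr t' (yel AG w2) u = (\<Sum>w1\<in>T1. fr (psibar n AG w1 t) * yel AG (dem AG w1 w2) u)" if w2: "w2 \<in> W0" for w2 u
  proof -
    have "left_tr t' (yel AG w2) = fold mul_y (redword AG w2) (left_tr t' (dlt id))"
      unfolding yel_def A.y_word_dlt left_tr_fold[OF t'(1)] by (rule refl)
    also have "\<dots> = fold mul_y (redword AG w2) (dlt t)" unfolding Ltd by (simp only: comp_id)
    also have "\<dots> = (\<lambda>u. \<Sum>w1\<in>T1. fr (psibar n AG w1 t) * fold mul_y (redword AG w2) (yel AG w1) u)"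
      unfolding dt by (rule A.fold_mul_y_sum)
    finally have "left_tr t' (yel AG w2) u = (\<Sum>w1\<in>T1. fr (psibar n AG w1 t) * fold mul_y (redword AG w2) (yel AG w1) u)"
      by (rule fun_cong)
    also have "\<dots> = (\<Sum>w1\<in>T1. fr (psibar n AG w1 t) * yel AG (dem AG w1 w2) u)"
    proof (rule sum.cong[OF refl])
      fix w1 assume "w1 \<in> T1"
      then have "fold mul_y (redword AG w2) (yel AG w1) = yel AG (dem AG w1 w2)"
        using A.yop_dem[of w1 w2] T1(2) W0_Wa[OF w2] unfolding A.yop_def by blast
      then show "fr (psibar n AG w1 t) * fold mul_y (redword AG w2) (yel AG w1) u = fr (psibar n AG w1 t) * yel AG (dem AG w1 w2) u"
        by (simp only:)
    qed
    finally show ?thesis .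
  qed
  let ?P = "T1 \<times> T2" and ?d = "\<lambda>p. dem AG (fst p) (snd p)" and ?f = "\<lambda>p. fr (psibar n AG (fst p) t) * fr (psibar n FG (snd p) v)"
  \<comment> \<open>Pairs with the same Demazure product are collected, so that each y_w occurs once
    and its coefficient can be compared.\<close>
  define c where "c w = (\<Sum>p\<in>{p\<in>?P. ?d p = w}. ?f p)" for w
  have P: "finite ?P" using T1 T2 by simp
  have ex: "dlt (t \<circ> v) u = (\<Sum>w\<in>?d ` ?P. c w * yel AG w u)" for u
  proof -
    have "dlt (t \<circ> v) u = dlt v (t' \<circ> u)" using fun_cong[OF Ltd[of v], of u] unfolding left_tr_def by (rule sym)
    also have "\<dots> = (\<Sum>w2\<in>T2. fr (psibar n FG w2 v) * left_tr t' (yel AG w2) u)"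
      using T2(2,4) yel_fin_aff unfolding left_tr_def by (simp add: subset_iff cong: sum.cong)
    also have "\<dots> = (\<Sum>w2\<in>T2. \<Sum>w1\<in>T1. fr (psibar n AG w1 t) * fr (psibar n FG w2 v) * yel AG (dem AG w1 w2) u)"
    proof (rule sum.cong[OF refl])
      fix w2 assume "w2 \<in> T2"
      then have "w2 \<in> W0" using T2(2) by blast
      show "fr (psibar n FG w2 v) * left_tr t' (yel AG w2) u = (\<Sum>w1\<in>T1. fr (psibar n AG w1 t) * fr (psibar n FG w2 v) * yel AG (dem AG w1 w2) u)"
        unfolding key[OF \<open>w2 \<in> W0\<close>] sum_distrib_left by (rule sum.cong) (simp_all add: mult_ac)
    qed
    also have "\<dots> = (\<Sum>p\<in>?P. ?f p * yel AG (?d p) u)"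
      by (subst sum.swap) (simp add: sum.cartesian_product split_beta)
    also have "\<dots> = (\<Sum>w\<in>?d ` ?P. \<Sum>p\<in>{p\<in>?P. ?d p = w}. ?f p * yel AG (?d p) u)"
      by (rule sum.image_gen[OF P])
    also have "\<dots> = (\<Sum>w\<in>?d ` ?P. c w * yel AG w u)"
      unfolding c_def sum_distrib_right by (intro sum.cong) auto
    finally show ?thesis .
  qed
  have "fr (psibar n AG w (t \<circ> v)) = c w"
  proof (rule A.psibar_coeff[where S = "?d ` ?P"])
    show "t \<circ> v \<in> Wa" using t v by (intro grp_comp QVD(1) W0_Wa)
    show "?d ` ?P \<subseteq> Wa" 
    proof
      fix x assume "x \<in> ?d ` ?P"
      then obtain w1 w2 where p: "w1 \<in> T1" "w2 \<in> T2" "x = dem AG w1 w2" by auto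
      show "x \<in> Wa" unfolding p(3) by (rule A.dem_W) (use p(1,2) T1(2) T2(2) W0_Wa[of w2] in \<open>simp_all add: subset_iff\<close>)
    qed
    show "c w = 0" if "w \<notin> ?d ` ?P"
    proof -
      have "?d p \<noteq> w" if "p \<in> ?P" for p using imageI[OF that, of ?d] \<open>w \<notin> ?d ` ?P\<close> by metis
      then have "{p\<in>?P. ?d p = w} = {}" by (simp only: Collect_empty_eq simp_thms not_False_eq_True cong: conj_cong)
      then show ?thesis unfolding c_def by (simp only: sum.empty)
    qed
    show "dlt (t \<circ> v) x = (\<Sum>w\<in>?d ` ?P. c w * yel AG w x)" for x by (rule ex)
    show "finite (?d ` ?P)" using P by (rule finite_imageI)
  qed (rule w)
  \<comment> \<open>Outside \<open>T1\<close> and \<open>T2\<close> the values at \<open>t\<close>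
    and \<open>v\<close> vanish, so the index set can be enlarged to one that does not depend on
    \<open>t\<close> and \<open>v\<close>.\<close>
  also have "c w = (\<Sum>p\<in>dem_pairs n A w. ?f p)" unfolding c_def
  proof (rule sum.mono_neutral_left[OF finite_dem_pairs[OF w]])
    show "{p \<in> ?P. ?d p = w} \<subseteq> dem_pairs n A w" using T1(2) T2(2) by (auto simp: dem_pairs_def Wfin_grp)
    show "\<forall>p\<in>dem_pairs n A w - {p \<in> ?P. ?d p = w}. ?f p = 0"
    proof
      fix p assume p: "p \<in> dem_pairs n A w - {p \<in> ?P. ?d p = w}"
      then have "fst p \<in> Wa" "snd p \<in> W0" "fst p \<notin> T1 \<or> snd p \<notin> T2" by (auto simp: dem_pairs_def Wfin_grp)
      then have "psibar n AG (fst p) t = 0 \<or> psibar n FG (snd p) v = 0" using T1(3) T2(3) by blast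
      then show "?f p = 0" by auto
    qed
  qed
  also have "\<dots> = fr (\<Sum>p\<in>dem_pairs n A w. psibar n AG (fst p) t * psibar n FG (snd p) v)"
    unfolding fr_sum by (simp only: fr_simps)
  finally show ?thesis by (simp add: split_beta)
qed

end

theorem theorem4p13:
  fixes n :: nat and A :: "nat \<Rightarrow> nat \<Rightarrow> int" and w :: wel
  assumes "is_gcm n A"
    and "finite (Wfin n A)"
    and "w \<in> grp (aff_gens n A)"
  shows "psibar_aff n A w =
           (\<lambda>x. \<Sum>(w1, w2)\<in>dem_pairs n A w.
                  cup (p_star n A (Gbar n A w1)) (ev1_star n A (psibar_GB n A w2)) x)
       \<and> (\<lambda>x. \<Sum>(w1, w2)\<in>dem_pairs n A w.
                  cup (p_star n A (Gbar n A w1)) (ev1_star n A (psibar_GB n A w2)) x) =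
         (\<lambda>x. \<Sum>(w1, w2)\<in>dem_pairs n A w.
                  cup (theta_map n A (psibar_aff n A w1)) (eta_map n A (psibar_aff n A w2)) x)"
proof -
  interpret cartan n A by unfold_locales (use assms in auto)
  have 1: "psibar_aff n A w x = (\<Sum>(w1, w2)\<in>dem_pairs n A w. cup (p_star n A (Gbar n A w1)) (ev1_star n A (psibar_GB n A w2)) x)" for x
  proof (cases "x \<in> Wa")
    case True
    obtain t v where tv: "t \<in> QV n A" "v \<in> W0" "x = t \<circ> v" using Wa_decomp[OF True] .
    have "p_star n A (Gbar n A w1) x = psibar n AG w1 t" "ev1_star n A (psibar_GB n A w2) x = psibar n FG w2 v" for w1 w2
      using True parts[OF tv(1,2)] tv(1,3) by (simp_all add: p_star_def Gbar_def phi_star_def psibar_aff_def ev1_star_def psibar_GB_def)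
    then show ?thesis using psibar_product[OF tv(1,2) assms(3)] tv(3) by (simp add: psibar_aff_def cup_def)
  next
    case False
    \<comment> \<open>Off the group both sides vanish, the right one because \<open>p_star\<close>
      extends by 0.\<close>
    then show ?thesis using A.psibar_outside[OF assms(3)] by (simp add: psibar_aff_def cup_def p_star_def split_beta)
  qed
  \<comment> \<open>The two sums agree term by term. The first factors coincide by definition, so
    only the affine and the finite dual functions on the finite part have to be compared.\<close>
  have 2: "cup (p_star n A (Gbar n A w1)) (ev1_star n A (psibar_GB n A w2)) x = cup (theta_map n A (psibar_aff n A w1)) (eta_map n A (psibar_aff n A w2)) x"
    if "(w1, w2) \<in> dem_pairs n A w" for w1 w2 x
  proof (cases "x \<in> Wa")
    case True
    obtain t v where tv: "t \<in> QV n A" "v \<in> W0" "x = t \<circ> v" using Wa_decomp[OF True] .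
    have "w2 \<in> W0" using that by (simp add: dem_pairs_def Wfin_grp)
    then have "psibar n AG w2 v = psibar n FG w2 v" by (rule psibar_fin_aff[OF tv(2)])
    then show ?thesis using True parts[OF tv(1,2)] tv
      by (simp add: cup_def theta_map_def eta_map_def Gbar_def ev1_star_def q_star_def psibar_aff_def psibar_GB_def Wfin_grp)
  next
    case False
    then show ?thesis by (simp add: cup_def p_star_def theta_map_def)
  qed
  show ?thesis
  proof (intro conjI ext)
    show "psibar_aff n A w x = (\<Sum>(w1, w2)\<in>dem_pairs n A w. cup (p_star n A (Gbar n A w1)) (ev1_star n A (psibar_GB n A w2)) x)" for x by (rule 1)
    show "(\<Sum>(w1, w2)\<in>dem_pairs n A w. cup (p_star n A (Gbar n A w1)) (ev1_star n A (psibar_GB n A w2)) x) =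
        (\<Sum>(w1, w2)\<in>dem_pairs n A w. cup (theta_map n A (psibar_aff n A w1)) (eta_map n A (psibar_aff n A w2)) x)" for x
      by (rule sum.cong) (auto simp: 2)
  qed
qed

end
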